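(* Let $k$ be a field, $A$ a finite dimensional $k$-algebra, and $\mathrm{mod}\text{-}A$ the category of all finitely generated right $A$-modules. (1) Suppose that $\mathcal{C}$ is a small full subcategory of $\mathrm{mod}\text{-}A$ and that there exists a finite subset $\mathcal{X}\subseteq\mathcal{C}_0$ such that each object of $\mathcal{C}$ is isomorphic to a finite direct sum of elements of $\mathcal{X}$. Then, with $\Gamma:=\mathcal{C}_0\times\mathcal{C}_0$, the $\Gamma$-graded ring $R_{\mathcal{C}}$ is both a left and a right $\Gamma_0$-artinian ring, and both a left and a right $\Gamma_0$-noetherian ring. (2) If $\mathcal{C}$ is a skeleton of $\mathrm{mod}\text{-}A$ and $A$ is representation-finite, that is, there are only finitely many isomorphism classes of indecomposable finitely generated right $A$-modules, then $R_{\mathcal{C}}$ (graded by $\Gamma=\mathcal{C}_0\times\mathcal{C}_0$) is both a left and a right $\Gamma_0$-artinian ring, and both a left and a right $\Gamma_0$-noetherian ring.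
   Context: For a set $X$, $X\times X$ is a groupoid: $(z,w)(y,x)$ is defined iff $w=y$, and then $(z,y)(y,x)=(z,x)$; its set of objects (identified with identities) is $\{(x,x):x\in X\}$. For $\gamma=(y,x)$, $r(\gamma)=(y,y)$ and $d(\gamma)=(x,x)$. For a groupoid $\Gamma$, $\Gamma_0$ denotes its set of objects, identified with the identity morphisms. For a small preadditive category $\mathcal{C}$ with set of objects $\mathcal{C}_0$ and morphism groups $\mathcal{C}(X,Y)$ (morphisms $X\to Y$), the ring $R_{\mathcal{C}}:=\bigoplus_{X,Y\in\mathcal{C}_0}\mathcal{C}(X,Y)$ has product $fg:=f\circ g$ if composable and $0$ otherwise (extended bilinearly). It is graded by $\Gamma=\mathcal{C}_0\times\mathcal{C}_0$ via $(R_{\mathcal{C}})_{(X,Y)}:=\mathcal{C}(Y,X)$; for $e=(X,X)\in\Gamma_0$ the identity $1_e$ of $(R_{\mathcal{C}})_e$ is $\mathrm{id}_X$. For a $\Gamma$-graded ring $R=\bigoplus_{\gamma}R_\gamma$ with identities $1_e\in R_e$ ($e\in\Gamma_0$), graded right (left) submodules are those submodules $N$ that are the direct sum of their intersections with the homogeneous components. $R$ is right $\Gamma_0$-artinian (resp. right $\Gamma_0$-noetherian) if for every $e\in\Gamma_0$ the right $R$-module $R(e)=1_eR=\bigoplus_{r(\gamma)=e}R_\gamma$ satisfies the descending (resp. ascending) chain condition on graded right submodules. Left versions: the same for the left module $R1_e=\bigoplus_{d(\gamma)=e}R_\gamma$ for every $e\in\Gamma_0$. *)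

theory Defs
  imports "HOL-Algebra.Module" "HOL-Algebra.AbelCoset" "HOL-Library.FuncSet"
begin

section \<open>Finite dimensional algebras\<close>

text \<open>The locale \<^locale>\<open>algebra\<close> of the library only covers commutative algebras.\<close>

locale k_algebra = K?: field K + module K A + A?: ring A for K (structure) and A (structure) +
  assumes smult_mult_left: "\<lbrakk>c \<in> carrier K; x \<in> carrier A; y \<in> carrier A\<rbrakk> \<Longrightarrow>
      (c \<odot>\<^bsub>A\<^esub> x) \<otimes>\<^bsub>A\<^esub> y = c \<odot>\<^bsub>A\<^esub> (x \<otimes>\<^bsub>A\<^esub> y)"
    and smult_mult_right: "\<lbrakk>c \<in> carrier K; x \<in> carrier A; y \<in> carrier A\<rbrakk> \<Longrightarrow>
      x \<otimes>\<^bsub>A\<^esub> (c \<odot>\<^bsub>A\<^esub> y) = c \<odot>\<^bsub>A\<^esub> (x \<otimes>\<^bsub>A\<^esub> y)"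

definition is_basis :: "('k, 'p) ring_scheme \<Rightarrow> ('k, 'a, 'q) module_scheme \<Rightarrow> 'a set \<Rightarrow> bool" where
  "is_basis K A B \<longleftrightarrow> finite B \<and> B \<subseteq> carrier A \<and>
     (\<forall>x\<in>carrier A. \<exists>!c. c \<in> B \<rightarrow>\<^sub>E carrier K \<and> x = (\<Oplus>\<^bsub>A\<^esub>b\<in>B. c b \<odot>\<^bsub>A\<^esub> b))"

definition finite_dimensional :: "('k, 'p) ring_scheme \<Rightarrow> ('k, 'a, 'q) module_scheme \<Rightarrow> bool" where
  "finite_dimensional K A \<longleftrightarrow> (\<exists>B. is_basis K A B)"


section \<open>Right modules\<close>

record ('a, 'm) rmodule = "'m ring" +
  ract :: "'m \<Rightarrow> 'a \<Rightarrow> 'm" (infixl \<open>\<cdot>\<index>\<close> 70)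

locale right_module = A?: ring A + M?: abelian_group M for A (structure) and M (structure) +
  assumes ract_closed: "\<lbrakk>m \<in> carrier M; a \<in> carrier A\<rbrakk> \<Longrightarrow> m \<cdot>\<^bsub>M\<^esub> a \<in> carrier M"
    and ract_add_left: "\<lbrakk>m \<in> carrier M; n \<in> carrier M; a \<in> carrier A\<rbrakk> \<Longrightarrow>
      (m \<oplus>\<^bsub>M\<^esub> n) \<cdot>\<^bsub>M\<^esub> a = m \<cdot>\<^bsub>M\<^esub> a \<oplus>\<^bsub>M\<^esub> n \<cdot>\<^bsub>M\<^esub> a"
    and ract_add_right: "\<lbrakk>m \<in> carrier M; a \<in> carrier A; b \<in> carrier A\<rbrakk> \<Longrightarrow>
      m \<cdot>\<^bsub>M\<^esub> (a \<oplus>\<^bsub>A\<^esub> b) = m \<cdot>\<^bsub>M\<^esub> a \<oplus>\<^bsub>M\<^esub> m \<cdot>\<^bsub>M\<^esub> b"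
    and ract_assoc: "\<lbrakk>m \<in> carrier M; a \<in> carrier A; b \<in> carrier A\<rbrakk> \<Longrightarrow>
      m \<cdot>\<^bsub>M\<^esub> (a \<otimes>\<^bsub>A\<^esub> b) = (m \<cdot>\<^bsub>M\<^esub> a) \<cdot>\<^bsub>M\<^esub> b"
    and ract_one: "m \<in> carrier M \<Longrightarrow> m \<cdot>\<^bsub>M\<^esub> \<one>\<^bsub>A\<^esub> = m"

definition finitely_generated :: "('a, 'p) ring_scheme \<Rightarrow> ('a, 'm) rmodule \<Rightarrow> bool" where
  "finitely_generated A M \<longleftrightarrow> (\<exists>S. finite S \<and> S \<subseteq> carrier M \<and>
     (\<forall>m\<in>carrier M. \<exists>c\<in>S \<rightarrow> carrier A. m = (\<Oplus>\<^bsub>M\<^esub>s\<in>S. s \<cdot>\<^bsub>M\<^esub> c s)))"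

text \<open>The objects of mod-\<open>A\<close> whose underlying set lies in the type \<open>'m\<close>.\<close>

definition fg_mod :: "('a, 'p) ring_scheme \<Rightarrow> ('a, 'm) rmodule set" where
  "fg_mod A = {M. right_module A M \<and> finitely_generated A M}"

definition rmod_hom ::
    "('a, 'p) ring_scheme \<Rightarrow> ('a, 'm) rmodule \<Rightarrow> ('a, 'n) rmodule \<Rightarrow> ('m \<Rightarrow> 'n) set" where
  "rmod_hom A M N = {f \<in> carrier M \<rightarrow>\<^sub>E carrier N.
     (\<forall>x\<in>carrier M. \<forall>y\<in>carrier M. f (x \<oplus>\<^bsub>M\<^esub> y) = f x \<oplus>\<^bsub>N\<^esub> f y) \<and>
     (\<forall>x\<in>carrier M. \<forall>a\<in>carrier A. f (x \<cdot>\<^bsub>M\<^esub> a) = f x \<cdot>\<^bsub>N\<^esub> a)}"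

definition rmod_isomorphic ::
    "('a, 'p) ring_scheme \<Rightarrow> ('a, 'm) rmodule \<Rightarrow> ('a, 'n) rmodule \<Rightarrow> bool" where
  "rmod_isomorphic A M N \<longleftrightarrow> (\<exists>f\<in>rmod_hom A M N. bij_betw f (carrier M) (carrier N))"

text \<open>The direct sum of a finite list of modules; the empty list gives the zero module.\<close>

definition direct_sum :: "('a, 'm) rmodule list \<Rightarrow> ('a, nat \<Rightarrow> 'm) rmodule" where
  "direct_sum Ms = \<lparr>
     carrier = (\<Pi>\<^sub>E i\<in>{..<length Ms}. carrier (Ms ! i)),
     mult = undefined,
     one = undefined,
     zero = (\<lambda>i\<in>{..<length Ms}. \<zero>\<^bsub>Ms ! i\<^esub>),
     add = (\<lambda>x y. \<lambda>i\<in>{..<length Ms}. x i \<oplus>\<^bsub>Ms ! i\<^esub> y i),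
     ract = (\<lambda>x a. \<lambda>i\<in>{..<length Ms}. x i \<cdot>\<^bsub>Ms ! i\<^esub> a)\<rparr>"

definition rsubmodule :: "('a, 'p) ring_scheme \<Rightarrow> ('a, 'm) rmodule \<Rightarrow> 'm set \<Rightarrow> bool" where
  "rsubmodule A M N \<longleftrightarrow> additive_subgroup N M \<and> (\<forall>x\<in>N. \<forall>a\<in>carrier A. x \<cdot>\<^bsub>M\<^esub> a \<in> N)"

definition indecomposable :: "('a, 'p) ring_scheme \<Rightarrow> ('a, 'm) rmodule \<Rightarrow> bool" where
  "indecomposable A M \<longleftrightarrow> carrier M \<noteq> {\<zero>\<^bsub>M\<^esub>} \<and>
     (\<forall>N P. rsubmodule A M N \<and> rsubmodule A M P \<and>
        N <+>\<^bsub>M\<^esub> P = carrier M \<and> N \<inter> P = {\<zero>\<^bsub>M\<^esub>} \<longrightarrow> N = {\<zero>\<^bsub>M\<^esub>} \<or> P = {\<zero>\<^bsub>M\<^esub>})"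

text \<open>
  A statement about all of mod-\<open>A\<close> has to be made over a type that is large enough to hold a copy
  of every finitely generated module. An element of such a module is determined by its coefficients
  with respect to a finite list of generators, so \<open>'a list\<close> is large enough; the lemma
  \<open>fg_mod_universe\<close> below shows this.
\<close>

definition representation_finite :: "('a, 'p) ring_scheme \<Rightarrow> bool" where
  "representation_finite A \<longleftrightarrow>
     (let Ind = {M :: ('a, 'a list) rmodule. M \<in> fg_mod A \<and> indecomposable A M}
      in finite (Ind // {(M, N). M \<in> Ind \<and> N \<in> Ind \<and> rmod_isomorphic A M N}))"

definition skeleton_of_fg_mod :: "('a, 'p) ring_scheme \<Rightarrow> ('a, 'm) rmodule set \<Rightarrow> bool" where
  "skeleton_of_fg_mod A C \<longleftrightarrow> C \<subseteq> fg_mod A \<and>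
     (\<forall>M\<in>C. \<forall>N\<in>C. rmod_isomorphic A M N \<longrightarrow> M = N) \<and>
     (\<forall>M \<in> (fg_mod A :: ('a, 'a list) rmodule set). \<exists>N\<in>C. rmod_isomorphic A M N)"


section \<open>Groupoids and groupoid-graded rings\<close>

text \<open>\<open>gcomp \<Gamma> g h\<close> is the product \<open>gh\<close>, which only has a meaning if \<open>d(g) = r(h)\<close>.\<close>

record 'g groupoid =
  arrows :: "'g set"
  gdom :: "'g \<Rightarrow> 'g"
  grng :: "'g \<Rightarrow> 'g"
  gcomp :: "'g \<Rightarrow> 'g \<Rightarrow> 'g"

definition gobj :: "'g groupoid \<Rightarrow> 'g set" where
  "gobj \<Gamma> = gdom \<Gamma> ` arrows \<Gamma>"

locale groupoid =
  fixes \<Gamma> :: "'g groupoid"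
  assumes gdom_closed: "g \<in> arrows \<Gamma> \<Longrightarrow> gdom \<Gamma> g \<in> arrows \<Gamma>"
    and grng_closed: "g \<in> arrows \<Gamma> \<Longrightarrow> grng \<Gamma> g \<in> arrows \<Gamma>"
    and obj_gdom: "e \<in> gobj \<Gamma> \<Longrightarrow> gdom \<Gamma> e = e"
    and obj_grng: "e \<in> gobj \<Gamma> \<Longrightarrow> grng \<Gamma> e = e"
    and grng_obj: "g \<in> arrows \<Gamma> \<Longrightarrow> grng \<Gamma> g \<in> gobj \<Gamma>"
    and gcomp_closed: "\<lbrakk>g \<in> arrows \<Gamma>; h \<in> arrows \<Gamma>; gdom \<Gamma> g = grng \<Gamma> h\<rbrakk> \<Longrightarrow>
      gcomp \<Gamma> g h \<in> arrows \<Gamma> \<and> gdom \<Gamma> (gcomp \<Gamma> g h) = gdom \<Gamma> h \<and>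
      grng \<Gamma> (gcomp \<Gamma> g h) = grng \<Gamma> g"
    and gcomp_assoc: "\<lbrakk>f \<in> arrows \<Gamma>; g \<in> arrows \<Gamma>; h \<in> arrows \<Gamma>; gdom \<Gamma> f = grng \<Gamma> g;
      gdom \<Gamma> g = grng \<Gamma> h\<rbrakk> \<Longrightarrow> gcomp \<Gamma> (gcomp \<Gamma> f g) h = gcomp \<Gamma> f (gcomp \<Gamma> g h)"
    and gcomp_ident: "g \<in> arrows \<Gamma> \<Longrightarrow>
      gcomp \<Gamma> g (gdom \<Gamma> g) = g \<and> gcomp \<Gamma> (grng \<Gamma> g) g = g"
    and ginverse: "g \<in> arrows \<Gamma> \<Longrightarrow> \<exists>h\<in>arrows \<Gamma>. gdom \<Gamma> h = grng \<Gamma> g \<and> grng \<Gamma> h = gdom \<Gamma> g \<and>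
      gcomp \<Gamma> g h = grng \<Gamma> g \<and> gcomp \<Gamma> h g = gdom \<Gamma> g"

definition pair_groupoid :: "'x set \<Rightarrow> ('x \<times> 'x) groupoid" where
  "pair_groupoid X = \<lparr>
     arrows = X \<times> X,
     gdom = (\<lambda>(y, x). (x, x)),
     grng = (\<lambda>(y, x). (y, y)),
     gcomp = (\<lambda>(z, w) (y, x). (z, x))\<rparr>"

text \<open>
  \<open>hcomp R \<gamma>\<close> is the homogeneous component of degree \<open>\<gamma>\<close>, and \<open>hone R e\<close> the identity
  \<open>1\<^sub>e\<close> of the component ring of degree \<open>e \<in> \<Gamma>\<^sub>0\<close>. The ring need not have an identity, so the inherited
  field \<^const>\<open>one\<close> is not used.
\<close>

record ('g, 'r) gr_ring = "'r ring" +
  hcomp :: "'g \<Rightarrow> 'r set"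
  hone :: "'g \<Rightarrow> 'r"

locale graded_ring = groupoid \<Gamma> + R?: abelian_group R
  for \<Gamma> :: "'g groupoid" and R :: "('g, 'r) gr_ring" (structure) +
  assumes mult_closed: "\<lbrakk>x \<in> carrier R; y \<in> carrier R\<rbrakk> \<Longrightarrow> x \<otimes> y \<in> carrier R"
    and mult_assoc: "\<lbrakk>x \<in> carrier R; y \<in> carrier R; z \<in> carrier R\<rbrakk> \<Longrightarrow>
      (x \<otimes> y) \<otimes> z = x \<otimes> (y \<otimes> z)"
    and mult_l_distr: "\<lbrakk>x \<in> carrier R; y \<in> carrier R; z \<in> carrier R\<rbrakk> \<Longrightarrow>
      (x \<oplus> y) \<otimes> z = x \<otimes> z \<oplus> y \<otimes> z"
    and mult_r_distr: "\<lbrakk>x \<in> carrier R; y \<in> carrier R; z \<in> carrier R\<rbrakk> \<Longrightarrow>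
      z \<otimes> (x \<oplus> y) = z \<otimes> x \<oplus> z \<otimes> y"
    and hcomp_subgroup: "\<gamma> \<in> arrows \<Gamma> \<Longrightarrow> additive_subgroup (hcomp R \<gamma>) R"
    and hcomp_spans: "x \<in> carrier R \<Longrightarrow>
      \<exists>F c. finite F \<and> F \<subseteq> arrows \<Gamma> \<and> (\<forall>\<gamma>\<in>F. c \<gamma> \<in> hcomp R \<gamma>) \<and> x = (\<Oplus>\<gamma>\<in>F. c \<gamma>)"
    and hcomp_independent: "\<lbrakk>finite F; F \<subseteq> arrows \<Gamma>; \<forall>\<gamma>\<in>F. c \<gamma> \<in> hcomp R \<gamma>;
      (\<Oplus>\<gamma>\<in>F. c \<gamma>) = \<zero>\<rbrakk> \<Longrightarrow> \<forall>\<gamma>\<in>F. c \<gamma> = \<zero>"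
    and hcomp_mult: "\<lbrakk>\<gamma> \<in> arrows \<Gamma>; \<delta> \<in> arrows \<Gamma>; x \<in> hcomp R \<gamma>; y \<in> hcomp R \<delta>\<rbrakk> \<Longrightarrow>
      if gdom \<Gamma> \<gamma> = grng \<Gamma> \<delta> then x \<otimes> y \<in> hcomp R (gcomp \<Gamma> \<gamma> \<delta>) else x \<otimes> y = \<zero>"
    and hone_closed: "e \<in> gobj \<Gamma> \<Longrightarrow> hone R e \<in> hcomp R e"
    and hone_left: "\<lbrakk>\<gamma> \<in> arrows \<Gamma>; x \<in> hcomp R \<gamma>\<rbrakk> \<Longrightarrow> hone R (grng \<Gamma> \<gamma>) \<otimes> x = x"
    and hone_right: "\<lbrakk>\<gamma> \<in> arrows \<Gamma>; x \<in> hcomp R \<gamma>\<rbrakk> \<Longrightarrow> x \<otimes> hone R (gdom \<Gamma> \<gamma>) = x"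

text \<open>
  The right module \<open>R(e) = 1\<^sub>e R\<close> and the left module \<open>R 1\<^sub>e\<close>, as subsets of \<open>R\<close>.
\<close>

definition right_part :: "('g, 'r) gr_ring \<Rightarrow> 'g \<Rightarrow> 'r set" where
  "right_part R e = (\<lambda>x. hone R e \<otimes>\<^bsub>R\<^esub> x) ` carrier R"

definition left_part :: "('g, 'r) gr_ring \<Rightarrow> 'g \<Rightarrow> 'r set" where
  "left_part R e = (\<lambda>x. x \<otimes>\<^bsub>R\<^esub> hone R e) ` carrier R"

text \<open>
  The sum of the homogeneous components is direct in \<open>R\<close>, so \<open>N\<close> is the direct sum of its intersections
  with them as soon as it is their sum.
\<close>

definition homogeneously_spanned :: "'g groupoid \<Rightarrow> ('g, 'r) gr_ring \<Rightarrow> 'r set \<Rightarrow> bool" where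
  "homogeneously_spanned \<Gamma> R N \<longleftrightarrow> (\<forall>x\<in>N. \<exists>F c. finite F \<and> F \<subseteq> arrows \<Gamma> \<and>
     (\<forall>\<gamma>\<in>F. c \<gamma> \<in> N \<inter> hcomp R \<gamma>) \<and> x = (\<Oplus>\<^bsub>R\<^esub>\<gamma>\<in>F. c \<gamma>))"

definition graded_right_submodule :: "'g groupoid \<Rightarrow> ('g, 'r) gr_ring \<Rightarrow> 'g \<Rightarrow> 'r set \<Rightarrow> bool" where
  "graded_right_submodule \<Gamma> R e N \<longleftrightarrow> additive_subgroup N R \<and> N \<subseteq> right_part R e \<and>
     (\<forall>x\<in>N. \<forall>r\<in>carrier R. x \<otimes>\<^bsub>R\<^esub> r \<in> N) \<and> homogeneously_spanned \<Gamma> R N"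

definition graded_left_submodule :: "'g groupoid \<Rightarrow> ('g, 'r) gr_ring \<Rightarrow> 'g \<Rightarrow> 'r set \<Rightarrow> bool" where
  "graded_left_submodule \<Gamma> R e N \<longleftrightarrow> additive_subgroup N R \<and> N \<subseteq> left_part R e \<and>
     (\<forall>x\<in>N. \<forall>r\<in>carrier R. r \<otimes>\<^bsub>R\<^esub> x \<in> N) \<and> homogeneously_spanned \<Gamma> R N"

definition desc_chain_cond :: "('r set \<Rightarrow> bool) \<Rightarrow> bool" where
  "desc_chain_cond P \<longleftrightarrow>
     (\<forall>N :: nat \<Rightarrow> 'r set. (\<forall>i. P (N i)) \<and> antimono N \<longrightarrow> (\<exists>n. \<forall>i\<ge>n. N i = N n))"

definition asc_chain_cond :: "('r set \<Rightarrow> bool) \<Rightarrow> bool" where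
  "asc_chain_cond P \<longleftrightarrow>
     (\<forall>N :: nat \<Rightarrow> 'r set. (\<forall>i. P (N i)) \<and> mono N \<longrightarrow> (\<exists>n. \<forall>i\<ge>n. N i = N n))"

definition right_obj_artinian :: "'g groupoid \<Rightarrow> ('g, 'r) gr_ring \<Rightarrow> bool" where
  "right_obj_artinian \<Gamma> R \<longleftrightarrow> (\<forall>e\<in>gobj \<Gamma>. desc_chain_cond (graded_right_submodule \<Gamma> R e))"

definition left_obj_artinian :: "'g groupoid \<Rightarrow> ('g, 'r) gr_ring \<Rightarrow> bool" where
  "left_obj_artinian \<Gamma> R \<longleftrightarrow> (\<forall>e\<in>gobj \<Gamma>. desc_chain_cond (graded_left_submodule \<Gamma> R e))"

definition right_obj_noetherian :: "'g groupoid \<Rightarrow> ('g, 'r) gr_ring \<Rightarrow> bool" where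
  "right_obj_noetherian \<Gamma> R \<longleftrightarrow> (\<forall>e\<in>gobj \<Gamma>. asc_chain_cond (graded_right_submodule \<Gamma> R e))"

definition left_obj_noetherian :: "'g groupoid \<Rightarrow> ('g, 'r) gr_ring \<Rightarrow> bool" where
  "left_obj_noetherian \<Gamma> R \<longleftrightarrow> (\<forall>e\<in>gobj \<Gamma>. asc_chain_cond (graded_left_submodule \<Gamma> R e))"


section \<open>Preadditive categories and their rings\<close>

text \<open>
  \<open>hom C X Y\<close> is the group of morphisms \<open>X \<rightarrow> Y\<close>, and \<open>comp C X Y Z g f\<close> the composite of
  \<open>f : X \<rightarrow> Y\<close> and \<open>g : Y \<rightarrow> Z\<close>.
\<close>

record ('o, 'h) precat =
  obj :: "'o set"
  hom :: "'o \<Rightarrow> 'o \<Rightarrow> 'h ring"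
  comp :: "'o \<Rightarrow> 'o \<Rightarrow> 'o \<Rightarrow> 'h \<Rightarrow> 'h \<Rightarrow> 'h"
  ident :: "'o \<Rightarrow> 'h"

hide_const (open) hom comp

locale preadditive_category =
  fixes C :: "('o, 'h) precat"
  assumes hom_group: "\<lbrakk>X \<in> obj C; Y \<in> obj C\<rbrakk> \<Longrightarrow> abelian_group (precat.hom C X Y)"
    and comp_closed: "\<lbrakk>X \<in> obj C; Y \<in> obj C; Z \<in> obj C; f \<in> carrier (precat.hom C X Y);
      g \<in> carrier (precat.hom C Y Z)\<rbrakk> \<Longrightarrow> precat.comp C X Y Z g f \<in> carrier (precat.hom C X Z)"
    and comp_assoc: "\<lbrakk>W \<in> obj C; X \<in> obj C; Y \<in> obj C; Z \<in> obj C; f \<in> carrier (precat.hom C W X);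
      g \<in> carrier (precat.hom C X Y); h \<in> carrier (precat.hom C Y Z)\<rbrakk> \<Longrightarrow>
      precat.comp C W X Z (precat.comp C X Y Z h g) f = precat.comp C W Y Z h (precat.comp C W X Y g f)"
    and comp_add_left: "\<lbrakk>X \<in> obj C; Y \<in> obj C; Z \<in> obj C; f \<in> carrier (precat.hom C X Y);
      g \<in> carrier (precat.hom C Y Z); g' \<in> carrier (precat.hom C Y Z)\<rbrakk> \<Longrightarrow>
      precat.comp C X Y Z (g \<oplus>\<^bsub>precat.hom C Y Z\<^esub> g') f =
      precat.comp C X Y Z g f \<oplus>\<^bsub>precat.hom C X Z\<^esub> precat.comp C X Y Z g' f"
    and comp_add_right: "\<lbrakk>X \<in> obj C; Y \<in> obj C; Z \<in> obj C; f \<in> carrier (precat.hom C X Y);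
      f' \<in> carrier (precat.hom C X Y); g \<in> carrier (precat.hom C Y Z)\<rbrakk> \<Longrightarrow>
      precat.comp C X Y Z g (f \<oplus>\<^bsub>precat.hom C X Y\<^esub> f') =
      precat.comp C X Y Z g f \<oplus>\<^bsub>precat.hom C X Z\<^esub> precat.comp C X Y Z g f'"
    and ident_closed: "X \<in> obj C \<Longrightarrow> ident C X \<in> carrier (precat.hom C X X)"
    and ident_right: "\<lbrakk>X \<in> obj C; Y \<in> obj C; f \<in> carrier (precat.hom C X Y)\<rbrakk> \<Longrightarrow>
      precat.comp C X X Y f (ident C X) = f"
    and ident_left: "\<lbrakk>X \<in> obj C; Y \<in> obj C; f \<in> carrier (precat.hom C X Y)\<rbrakk> \<Longrightarrow>
      precat.comp C X Y Y (ident C Y) f = f"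

text \<open>The full subcategory of mod-\<open>A\<close> with set of objects \<open>C\<close>.\<close>

definition full_subcat ::
    "('a, 'p) ring_scheme \<Rightarrow> ('a, 'm) rmodule set \<Rightarrow> (('a, 'm) rmodule, 'm \<Rightarrow> 'm) precat" where
  "full_subcat A C = \<lparr>
     obj = C,
     hom = (\<lambda>X Y. \<lparr>
       carrier = rmod_hom A X Y,
       mult = undefined,
       one = undefined,
       zero = (\<lambda>x\<in>carrier X. \<zero>\<^bsub>Y\<^esub>),
       add = (\<lambda>f g. \<lambda>x\<in>carrier X. f x \<oplus>\<^bsub>Y\<^esub> g x)\<rparr>),
     comp = (\<lambda>X Y Z g f. compose (carrier X) g f),
     ident = (\<lambda>X. \<lambda>x\<in>carrier X. x)\<rparr>"

text \<open>
  An element of \<open>R\<^sub>C\<close> is a finitely supported family \<open>\<phi>\<close> with \<open>\<phi> (Z, X) : X \<rightarrow> Z\<close>, so multiplication is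
  that of matrices: the entry of \<open>\<phi>\<psi>\<close> at \<open>(Z, X)\<close> is the sum of all \<open>\<phi> (Z, Y) \<circ> \<psi> (Y, X)\<close>. Only the
  finitely many \<open>Y\<close> with \<open>\<phi> (Z, Y) \<noteq> 0\<close> contribute; they have to be singled out because
  \<^const>\<open>finsum\<close> is zero on infinite index sets.
\<close>

definition single :: "('o, 'h) precat \<Rightarrow> 'o \<times> 'o \<Rightarrow> 'h \<Rightarrow> 'o \<times> 'o \<Rightarrow> 'h" where
  "single C \<gamma> f = (\<lambda>(Z, X)\<in>obj C \<times> obj C. if (Z, X) = \<gamma> then f else \<zero>\<^bsub>precat.hom C X Z\<^esub>)"

definition cat_ring :: "('o, 'h) precat \<Rightarrow> ('o \<times> 'o, 'o \<times> 'o \<Rightarrow> 'h) gr_ring" where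
  "cat_ring C = \<lparr>
     carrier = {\<phi> \<in> \<Pi>\<^sub>E (Z, X)\<in>obj C \<times> obj C. carrier (precat.hom C X Z).
       finite {(Z, X) \<in> obj C \<times> obj C. \<phi> (Z, X) \<noteq> \<zero>\<^bsub>precat.hom C X Z\<^esub>}},
     mult = (\<lambda>\<phi> \<psi>. \<lambda>(Z, X)\<in>obj C \<times> obj C.
       \<Oplus>\<^bsub>precat.hom C X Z\<^esub>Y\<in>{Y \<in> obj C. \<phi> (Z, Y) \<noteq> \<zero>\<^bsub>precat.hom C Y Z\<^esub>}.
         precat.comp C X Y Z (\<phi> (Z, Y)) (\<psi> (Y, X))),
     one = undefined,
     zero = (\<lambda>(Z, X)\<in>obj C \<times> obj C. \<zero>\<^bsub>precat.hom C X Z\<^esub>),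
     add = (\<lambda>\<phi> \<psi>. \<lambda>(Z, X)\<in>obj C \<times> obj C. \<phi> (Z, X) \<oplus>\<^bsub>precat.hom C X Z\<^esub> \<psi> (Z, X)),
     hcomp = (\<lambda>(Y, X). single C (Y, X) ` carrier (precat.hom C X Y)),
     hone = (\<lambda>(Y, X). single C (Y, X) (ident C X))\<rparr>"


section \<open>The ring of a preadditive category is graded by the pair groupoid\<close>

lemma groupoid_pair_groupoid: "groupoid (pair_groupoid X)"
  by unfold_locales (auto simp: pair_groupoid_def gobj_def)

lemma compose_rmod_hom:
  assumes "right_module A X" "f \<in> rmod_hom A X Y" "g \<in> rmod_hom A Y Z"
  shows "compose (carrier X) g f \<in> rmod_hom A X Z"
proof -
  interpret X: right_module A X by fact
  show ?thesis using assms(2,3)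
    by (auto simp: rmod_hom_def compose_def PiE_iff X.ract_closed)
qed

lemma abelian_group_rmod_hom:
  assumes "right_module A X" "right_module A Y"
  shows "abelian_group (precat.hom (full_subcat A C) X Y)" (is "abelian_group ?H")
proof -
  interpret X: right_module A X by fact
  interpret Y: right_module A Y by fact
  show ?thesis
  proof (rule abelian_groupI)
    fix f g assume fg: "f \<in> carrier ?H" "g \<in> carrier ?H"
    then show "f \<oplus>\<^bsub>?H\<^esub> g \<in> carrier ?H"
      by (auto simp: full_subcat_def rmod_hom_def PiE_iff Y.ract_add_left Y.M.a_ac X.ract_closed)
    show "f \<oplus>\<^bsub>?H\<^esub> g = g \<oplus>\<^bsub>?H\<^esub> f" using fg
      by (auto simp: full_subcat_def rmod_hom_def PiE_iff Y.M.a_ac restrict_def fun_eq_iff)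
    fix h assume "h \<in> carrier ?H" with fg show "f \<oplus>\<^bsub>?H\<^esub> g \<oplus>\<^bsub>?H\<^esub> h = f \<oplus>\<^bsub>?H\<^esub> (g \<oplus>\<^bsub>?H\<^esub> h)"
      by (auto simp: full_subcat_def rmod_hom_def PiE_iff Y.M.a_ac restrict_def fun_eq_iff)
  next
    have *: "\<zero>\<^bsub>Y\<^esub> = \<zero>\<^bsub>Y\<^esub> \<cdot>\<^bsub>Y\<^esub> a" if "a \<in> carrier A" for a
      using Y.ract_add_left[of "\<zero>\<^bsub>Y\<^esub>" "\<zero>\<^bsub>Y\<^esub>" a] that Y.ract_closed[of "\<zero>\<^bsub>Y\<^esub>" a]
      by (metis Y.M.add.l_cancel_one' Y.M.l_zero Y.M.zero_closed)
    then show "\<zero>\<^bsub>?H\<^esub> \<in> carrier ?H"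
      by (auto simp: full_subcat_def rmod_hom_def PiE_iff X.ract_closed)
    fix f assume f: "f \<in> carrier ?H"
    then show "\<zero>\<^bsub>?H\<^esub> \<oplus>\<^bsub>?H\<^esub> f = f"
      by (auto simp: full_subcat_def rmod_hom_def PiE_iff extensional_def restrict_def fun_eq_iff)
    let ?g = "\<lambda>x\<in>carrier X. \<ominus>\<^bsub>Y\<^esub> f x"
    have neg: "\<ominus>\<^bsub>Y\<^esub> (y \<cdot>\<^bsub>Y\<^esub> a) = (\<ominus>\<^bsub>Y\<^esub> y) \<cdot>\<^bsub>Y\<^esub> a" if "a \<in> carrier A" "y \<in> carrier Y" for a y
      using that Y.ract_add_left[of "\<ominus>\<^bsub>Y\<^esub> y" "y" a] *[of a]
      by (intro Y.M.minus_equality) (auto simp: Y.M.l_neg Y.ract_closed)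
    have "?g \<in> carrier ?H" using f
      by (auto simp: full_subcat_def rmod_hom_def PiE_iff Y.M.minus_add X.ract_closed neg)
    moreover have "?g \<oplus>\<^bsub>?H\<^esub> f = \<zero>\<^bsub>?H\<^esub>" using f
      by (auto simp: full_subcat_def rmod_hom_def PiE_iff Y.M.l_neg restrict_def fun_eq_iff)
    ultimately show "\<exists>g\<in>carrier ?H. g \<oplus>\<^bsub>?H\<^esub> f = \<zero>\<^bsub>?H\<^esub>" by blast
  qed
qed

lemma preadditive_full_subcat:
  assumes "C \<subseteq> fg_mod A"
  shows "preadditive_category (full_subcat A C)"
proof -
  have [simp]: "obj (full_subcat A C) = C" "\<And>X. ident (full_subcat A C) X = (\<lambda>x\<in>carrier X. x)"
    "\<And>X Y. carrier (precat.hom (full_subcat A C) X Y) = rmod_hom A X Y"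
    "\<And>X Y f g. f \<oplus>\<^bsub>precat.hom (full_subcat A C) X Y\<^esub> g = (\<lambda>x\<in>carrier X. f x \<oplus>\<^bsub>Y\<^esub> g x)"
    "\<And>X Y Z g f. precat.comp (full_subcat A C) X Y Z g f = compose (carrier X) g f"
    by (auto simp: full_subcat_def)
  have rm: "right_module A X" if "X \<in> C" for X using that assms by (auto simp: fg_mod_def)
  show ?thesis
  proof (rule preadditive_category.intro)
    fix X Y assume "X \<in> obj (full_subcat A C)" "Y \<in> obj (full_subcat A C)"
    then show "abelian_group (precat.hom (full_subcat A C) X Y)"
      using abelian_group_rmod_hom[of A X Y C] rm by auto
  next
    fix X assume "X \<in> obj (full_subcat A C)"
    then interpret X: right_module A X using rm by simp
    show "ident (full_subcat A C) X \<in> carrier (precat.hom (full_subcat A C) X X)"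
      by (auto simp: rmod_hom_def X.ract_closed)
  next
    fix X Y f assume "f \<in> carrier (precat.hom (full_subcat A C) X Y)"
    then have f: "f \<in> carrier X \<rightarrow>\<^sub>E carrier Y" by (simp add: rmod_hom_def)
    show "precat.comp (full_subcat A C) X X Y f (ident (full_subcat A C) X) = f"
      and "precat.comp (full_subcat A C) X Y Y (ident (full_subcat A C) Y) f = f"
      using f by (auto simp: compose_def fun_eq_iff PiE_iff extensional_def)
  qed (auto simp: compose_rmod_hom rm, (auto simp: rmod_hom_def PiE_iff compose_def fun_eq_iff)[3])
qed


lemma finsum_hom:
  assumes "abelian_monoid G" "abelian_group H" "\<And>x. x \<in> carrier G \<Longrightarrow> h x \<in> carrier H"
    and add: "\<And>x y. x \<in> carrier G \<Longrightarrow> y \<in> carrier G \<Longrightarrow> h (x \<oplus>\<^bsub>G\<^esub> y) = h x \<oplus>\<^bsub>H\<^esub> h y"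
    and "f \<in> I \<rightarrow> carrier G"
  shows "h (finsum G f I) = finsum H (\<lambda>i. h (f i)) I"
proof -
  interpret G: abelian_monoid G by fact
  interpret H: abelian_group H by fact
  have z: "h \<zero>\<^bsub>G\<^esub> = \<zero>\<^bsub>H\<^esub>"
    using add[of "\<zero>\<^bsub>G\<^esub>" "\<zero>\<^bsub>G\<^esub>"] assms(3)[of "\<zero>\<^bsub>G\<^esub>"] by (simp add: H.add.l_cancel_one')
  show ?thesis using \<open>f \<in> I \<rightarrow> carrier G\<close>
  proof (induction I rule: infinite_finite_induct)
    case (insert x I)
    then show ?case using assms(3)
      by (simp add: G.finsum_insert H.finsum_insert Pi_iff add G.finsum_closed)
  qed (auto simp: z G.finsum_infinite)
qed

lemma (in abelian_monoid) finsum_swap: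
  assumes "finite I" "finite J" "\<And>i j. i \<in> I \<Longrightarrow> j \<in> J \<Longrightarrow> f i j \<in> carrier G"
  shows "(\<Oplus>i\<in>I. \<Oplus>j\<in>J. f i j) = (\<Oplus>j\<in>J. \<Oplus>i\<in>I. f i j)"
  using assms(1,3)
proof (induction I)
  case (insert x I)
  have "(\<Oplus>j\<in>J. \<Oplus>i\<in>insert x I. f i j) = (\<Oplus>j\<in>J. f x j \<oplus> (\<Oplus>i\<in>I. f i j))"
    by (rule finsum_cong') (use insert in \<open>auto simp: Pi_iff intro!: finsum_closed\<close>)
  also have "\<dots> = (\<Oplus>j\<in>J. f x j) \<oplus> (\<Oplus>j\<in>J. \<Oplus>i\<in>I. f i j)"
    by (rule finsum_addf) (use insert in \<open>auto intro!: finsum_closed\<close>)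
  finally show ?case using insert by (simp add: Pi_iff)
qed (use assms in simp)

context preadditive_category
begin

abbreviation H where "H \<equiv> precat.hom C"
abbreviation cmp where "cmp \<equiv> precat.comp C"
abbreviation R where "R \<equiv> cat_ring C"

lemma hom_monoid: "X \<in> obj C \<Longrightarrow> Y \<in> obj C \<Longrightarrow> abelian_monoid (H X Y)"
  using hom_group by (simp add: abelian_group_def)

lemma hom_finsum_closed:
  "X \<in> obj C \<Longrightarrow> Y \<in> obj C \<Longrightarrow> (\<And>i. i \<in> I \<Longrightarrow> f i \<in> carrier (H X Y)) \<Longrightarrow> finsum (H X Y) f I \<in> carrier (H X Y)"
  by (rule abelian_monoid.finsum_closed[OF hom_monoid]) auto

lemma hom_zero_closed: "X \<in> obj C \<Longrightarrow> Y \<in> obj C \<Longrightarrow> \<zero>\<^bsub>H X Y\<^esub> \<in> carrier (H X Y)"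
  by (rule abelian_monoid.zero_closed[OF hom_monoid])

lemma hom_minus_zero:
  assumes "X \<in> obj C" "Y \<in> obj C" shows "\<ominus>\<^bsub>H X Y\<^esub> \<zero>\<^bsub>H X Y\<^esub> = \<zero>\<^bsub>H X Y\<^esub>"
proof -
  interpret abelian_group "H X Y" by (rule hom_group) fact+
  show ?thesis by (intro minus_equality) auto
qed

lemma hom_add_closed: "X \<in> obj C \<Longrightarrow> Y \<in> obj C \<Longrightarrow> f \<in> carrier (H X Y) \<Longrightarrow> g \<in> carrier (H X Y) \<Longrightarrow>
    f \<oplus>\<^bsub>H X Y\<^esub> g \<in> carrier (H X Y)"
  by (rule abelian_monoid.a_closed[OF hom_monoid])

lemma comp_finsum_right:
  assumes "X \<in> obj C" "Y \<in> obj C" "Z \<in> obj C" "g \<in> carrier (H Y Z)"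
    "\<And>i. i \<in> I \<Longrightarrow> f i \<in> carrier (H X Y)"
  shows "cmp X Y Z g (finsum (H X Y) f I) = finsum (H X Z) (\<lambda>i. cmp X Y Z g (f i)) I"
  by (rule finsum_hom) (use assms in \<open>auto intro: hom_monoid hom_group comp_closed comp_add_right\<close>)

lemma comp_finsum_left:
  assumes "X \<in> obj C" "Y \<in> obj C" "Z \<in> obj C" "f \<in> carrier (H X Y)"
    "\<And>i. i \<in> I \<Longrightarrow> g i \<in> carrier (H Y Z)"
  shows "cmp X Y Z (finsum (H Y Z) g I) f = finsum (H X Z) (\<lambda>i. cmp X Y Z (g i) f) I"
  by (rule finsum_hom[where h = "\<lambda>g. cmp X Y Z g f"])
    (use assms in \<open>auto intro: hom_monoid hom_group comp_closed comp_add_left\<close>)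

lemma comp_zero_right:
  assumes "X \<in> obj C" "Y \<in> obj C" "Z \<in> obj C" "g \<in> carrier (H Y Z)"
  shows "cmp X Y Z g \<zero>\<^bsub>H X Y\<^esub> = \<zero>\<^bsub>H X Z\<^esub>"
proof -
  interpret XY: abelian_group "H X Y" by (rule hom_group) fact+
  interpret XZ: abelian_group "H X Z" by (rule hom_group) fact+
  show ?thesis using comp_finsum_right[OF assms, of "{}" "\<lambda>_::unit. undefined"] by simp
qed

lemma comp_zero_left:
  assumes "X \<in> obj C" "Y \<in> obj C" "Z \<in> obj C" "f \<in> carrier (H X Y)"
  shows "cmp X Y Z \<zero>\<^bsub>H Y Z\<^esub> f = \<zero>\<^bsub>H X Z\<^esub>"
proof -
  interpret XY: abelian_group "H Y Z" by (rule hom_group) fact+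
  interpret XZ: abelian_group "H X Z" by (rule hom_group) fact+
  show ?thesis using comp_finsum_left[OF assms, of "{}" "\<lambda>_::unit. undefined"] by simp
qed

definition supp where
  "supp \<phi> = {(Z, X) \<in> obj C \<times> obj C. \<phi> (Z, X) \<noteq> \<zero>\<^bsub>H X Z\<^esub>}"

lemma carrier_iff: "\<phi> \<in> carrier R \<longleftrightarrow> \<phi> \<in> extensional (obj C \<times> obj C) \<and>
    (\<forall>Z\<in>obj C. \<forall>X\<in>obj C. \<phi> (Z, X) \<in> carrier (H X Z)) \<and> finite (supp \<phi>)"
  by (auto simp: cat_ring_def PiE_iff supp_def)

lemma carrierD:
  assumes "\<phi> \<in> carrier R"
  shows "\<phi> \<in> extensional (obj C \<times> obj C)" "finite (supp \<phi>)"
    "Z \<in> obj C \<Longrightarrow> X \<in> obj C \<Longrightarrow> \<phi> (Z, X) \<in> carrier (H X Z)"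
  using assms by (auto simp: carrier_iff)

lemma R_eqI:
  assumes "\<phi> \<in> extensional (obj C \<times> obj C)" "\<psi> \<in> extensional (obj C \<times> obj C)"
    "\<And>Z X. Z \<in> obj C \<Longrightarrow> X \<in> obj C \<Longrightarrow> \<phi> (Z, X) = \<psi> (Z, X)"
  shows "\<phi> = \<psi>"
  by (rule extensionalityI[OF assms(1,2)]) (use assms(3) in auto)

lemma R_ext [simp]: "\<phi> \<oplus>\<^bsub>R\<^esub> \<psi> \<in> extensional (obj C \<times> obj C)"
    "\<phi> \<otimes>\<^bsub>R\<^esub> \<psi> \<in> extensional (obj C \<times> obj C)" "\<zero>\<^bsub>R\<^esub> \<in> extensional (obj C \<times> obj C)"
    "single C \<gamma> f \<in> extensional (obj C \<times> obj C)"
  by (auto simp: cat_ring_def single_def)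

lemma R_entry [simp]:
  assumes "Z \<in> obj C" "X \<in> obj C"
  shows "(\<phi> \<oplus>\<^bsub>R\<^esub> \<psi>) (Z, X) = \<phi> (Z, X) \<oplus>\<^bsub>H X Z\<^esub> \<psi> (Z, X)"
    "\<zero>\<^bsub>R\<^esub> (Z, X) = \<zero>\<^bsub>H X Z\<^esub>"
    "single C \<gamma> f (Z, X) = (if (Z, X) = \<gamma> then f else \<zero>\<^bsub>H X Z\<^esub>)"
  using assms by (auto simp: cat_ring_def single_def)

lemma mult_entry:
  assumes "\<phi> \<in> carrier R" "\<psi> \<in> carrier R" "Z \<in> obj C" "X \<in> obj C" "finite S" "S \<subseteq> obj C"
    "\<And>Y. Y \<in> obj C - S \<Longrightarrow> \<phi> (Z, Y) = \<zero>\<^bsub>H Y Z\<^esub> \<or> \<psi> (Y, X) = \<zero>\<^bsub>H X Y\<^esub>"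
  shows "(\<phi> \<otimes>\<^bsub>R\<^esub> \<psi>) (Z, X) = (\<Oplus>\<^bsub>H X Z\<^esub>Y\<in>S. cmp X Y Z (\<phi> (Z, Y)) (\<psi> (Y, X)))"
proof -
  interpret XZ: abelian_group "H X Z" by (rule hom_group) fact+
  note cd = assms(1,2)[THEN carrierD(3)]
  have fin: "finite {Y \<in> obj C. \<phi> (Z, Y) \<noteq> \<zero>\<^bsub>H Y Z\<^esub>}"
    by (rule finite_subset[of _ "snd ` supp \<phi>"])
      (use carrierD(2)[OF assms(1)] assms(3) in \<open>auto simp: supp_def image_iff\<close>)
  show ?thesis using assms(3,4)
  proof (simp add: cat_ring_def, intro XZ.add.finprod_mono_neutral_cong fin assms(5))
    fix Y assume "Y \<in> S - {Y \<in> obj C. \<phi> (Z, Y) \<noteq> \<zero>\<^bsub>H Y Z\<^esub>}"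
    then show "cmp X Y Z (\<phi> (Z, Y)) (\<psi> (Y, X)) = \<zero>\<^bsub>H X Z\<^esub>"
      using assms by (auto intro!: comp_zero_left cd)
  next
    fix Y assume "Y \<in> {Y \<in> obj C. \<phi> (Z, Y) \<noteq> \<zero>\<^bsub>H Y Z\<^esub>} - S"
    then show "cmp X Y Z (\<phi> (Z, Y)) (\<psi> (Y, X)) = \<zero>\<^bsub>H X Z\<^esub>"
      using assms(7)[of Y] assms(1-4) by (auto intro!: comp_zero_right cd)
  qed (use assms in \<open>auto intro!: comp_closed cd\<close>)
qed

lemma common_support:
  assumes "\<phi> \<in> carrier R" "\<psi> \<in> carrier R"
  obtains S where "finite S" "S \<subseteq> obj C"
    "\<And>Z Y. Z \<in> obj C \<Longrightarrow> Y \<in> obj C \<Longrightarrow> Z \<notin> S \<or> Y \<notin> S \<Longrightarrow> \<phi> (Z, Y) = \<zero>\<^bsub>H Y Z\<^esub>"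
    "\<And>Z Y. Z \<in> obj C \<Longrightarrow> Y \<in> obj C \<Longrightarrow> Z \<notin> S \<or> Y \<notin> S \<Longrightarrow> \<psi> (Z, Y) = \<zero>\<^bsub>H Y Z\<^esub>"
proof -
  define S where "S = fst ` supp \<phi> \<union> snd ` supp \<phi> \<union> fst ` supp \<psi> \<union> snd ` supp \<psi>"
  have S: "Z \<in> S \<and> Y \<in> S" if "(Z, Y) \<in> supp \<phi> \<union> supp \<psi>" for Z Y
    using that by (force simp: S_def)
  have "finite S" using carrierD(2)[OF assms(1)] carrierD(2)[OF assms(2)] by (simp add: S_def)
  moreover have "S \<subseteq> obj C" by (auto simp: S_def supp_def)
  moreover have "\<phi> (Z, Y) = \<zero>\<^bsub>H Y Z\<^esub>" "\<psi> (Z, Y) = \<zero>\<^bsub>H Y Z\<^esub>"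
    if "Z \<in> obj C" "Y \<in> obj C" "Z \<notin> S \<or> Y \<notin> S" for Z Y
    using that S[of Z Y] by (auto simp: supp_def)
  ultimately show ?thesis by (rule that)
qed

lemma supp_zero: "supp \<zero>\<^bsub>R\<^esub> = {}"
  by (auto simp: supp_def)

lemma R_add_closed:
  assumes "\<phi> \<in> carrier R" "\<psi> \<in> carrier R" shows "\<phi> \<oplus>\<^bsub>R\<^esub> \<psi> \<in> carrier R"
proof -
  have "supp (\<phi> \<oplus>\<^bsub>R\<^esub> \<psi>) \<subseteq> supp \<phi> \<union> supp \<psi>"
    by (auto simp: supp_def hom_zero_closed abelian_monoid.l_zero[OF hom_monoid])
  then have "finite (supp (\<phi> \<oplus>\<^bsub>R\<^esub> \<psi>))"
    using carrierD(2) assms by (meson finite_Un finite_subset)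
  then show ?thesis using assms
    by (auto simp: carrier_iff hom_add_closed)
qed

lemma R_mult_closed:
  assumes "\<phi> \<in> carrier R" "\<psi> \<in> carrier R" shows "\<phi> \<otimes>\<^bsub>R\<^esub> \<psi> \<in> carrier R"
proof -
  obtain S where S: "finite S" "S \<subseteq> obj C"
    "\<And>Z Y. Z \<in> obj C \<Longrightarrow> Y \<in> obj C \<Longrightarrow> Z \<notin> S \<or> Y \<notin> S \<Longrightarrow> \<phi> (Z, Y) = \<zero>\<^bsub>H Y Z\<^esub>"
    "\<And>Z Y. Z \<in> obj C \<Longrightarrow> Y \<in> obj C \<Longrightarrow> Z \<notin> S \<or> Y \<notin> S \<Longrightarrow> \<psi> (Z, Y) = \<zero>\<^bsub>H Y Z\<^esub>"
    using common_support[OF assms] by blast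
  have e: "(\<phi> \<otimes>\<^bsub>R\<^esub> \<psi>) (Z, X) = (\<Oplus>\<^bsub>H X Z\<^esub>Y\<in>S. cmp X Y Z (\<phi> (Z, Y)) (\<psi> (Y, X)))"
    if "Z \<in> obj C" "X \<in> obj C" for Z X
    by (rule mult_entry[OF assms]) (use that S in auto)
  have "(\<phi> \<otimes>\<^bsub>R\<^esub> \<psi>) (Z, X) = \<zero>\<^bsub>H X Z\<^esub>" if "Z \<in> obj C" "X \<in> obj C" "Z \<notin> S \<or> X \<notin> S" for Z X
  proof -
    interpret XZ: abelian_group "H X Z" by (rule hom_group) fact+
    show ?thesis
      using that(3)
    proof
      assume "Z \<notin> S"
      then show ?thesis using mult_entry[OF assms that(1,2), of "{}"] S(3) that by auto
    next
      assume "X \<notin> S"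
      then show ?thesis using mult_entry[OF assms that(1,2), of "{}"] S(4) that by auto
    qed
  qed
  then have "supp (\<phi> \<otimes>\<^bsub>R\<^esub> \<psi>) \<subseteq> S \<times> S" by (auto simp: supp_def)
  then have "finite (supp (\<phi> \<otimes>\<^bsub>R\<^esub> \<psi>))" using S(1) by (meson finite_SigmaI finite_subset)
  moreover have "(\<phi> \<otimes>\<^bsub>R\<^esub> \<psi>) (Z, X) \<in> carrier (H X Z)" if "Z \<in> obj C" "X \<in> obj C" for Z X
    using that S(2) assms by (auto simp: e[OF that] intro!: hom_finsum_closed comp_closed assms[THEN carrierD(3)])
  ultimately show ?thesis by (auto simp: carrier_iff)
qed

lemma abelian_group_R: "abelian_group R"
proof (rule abelian_groupI)
  fix \<phi> \<psi> \<chi> assume *: "\<phi> \<in> carrier R" "\<psi> \<in> carrier R" "\<chi> \<in> carrier R"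
  show "\<phi> \<oplus>\<^bsub>R\<^esub> \<psi> \<oplus>\<^bsub>R\<^esub> \<chi> = \<phi> \<oplus>\<^bsub>R\<^esub> (\<psi> \<oplus>\<^bsub>R\<^esub> \<chi>)"
    by (rule R_eqI) (use * in \<open>auto simp: carrierD abelian_monoid.a_assoc[OF hom_monoid]\<close>)
next
  fix \<phi> \<psi> assume *: "\<phi> \<in> carrier R" "\<psi> \<in> carrier R"
  show "\<phi> \<oplus>\<^bsub>R\<^esub> \<psi> = \<psi> \<oplus>\<^bsub>R\<^esub> \<phi>"
    by (rule R_eqI) (use * in \<open>auto simp: carrierD abelian_monoid.a_comm[OF hom_monoid]\<close>)
  show "\<phi> \<oplus>\<^bsub>R\<^esub> \<psi> \<in> carrier R" using * by (rule R_add_closed)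
next
  show "\<zero>\<^bsub>R\<^esub> \<in> carrier R"
    by (auto simp: carrier_iff hom_zero_closed supp_zero)
next
  fix \<phi> assume *: "\<phi> \<in> carrier R"
  show "\<zero>\<^bsub>R\<^esub> \<oplus>\<^bsub>R\<^esub> \<phi> = \<phi>"
    by (rule R_eqI) (use * in \<open>auto simp: carrierD abelian_monoid.l_zero[OF hom_monoid]\<close>)
  let ?\<psi> = "\<lambda>(Z, X)\<in>obj C \<times> obj C. \<ominus>\<^bsub>H X Z\<^esub> \<phi> (Z, X)"
  have "supp ?\<psi> \<subseteq> supp \<phi>"
    by (auto simp: supp_def hom_minus_zero)
  then have "?\<psi> \<in> carrier R" using * finite_subset
    by (auto simp: carrier_iff abelian_group.a_inv_closed[OF hom_group])
  moreover have "?\<psi> \<oplus>\<^bsub>R\<^esub> \<phi> = \<zero>\<^bsub>R\<^esub>"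
    by (rule R_eqI) (use * in \<open>auto simp: carrierD abelian_group.l_neg[OF hom_group]\<close>)
  ultimately show "\<exists>\<psi>\<in>carrier R. \<psi> \<oplus>\<^bsub>R\<^esub> \<phi> = \<zero>\<^bsub>R\<^esub>" by blast
qed

lemma R_mult_assoc:
  assumes "\<phi> \<in> carrier R" "\<psi> \<in> carrier R" "\<chi> \<in> carrier R"
  shows "(\<phi> \<otimes>\<^bsub>R\<^esub> \<psi>) \<otimes>\<^bsub>R\<^esub> \<chi> = \<phi> \<otimes>\<^bsub>R\<^esub> (\<psi> \<otimes>\<^bsub>R\<^esub> \<chi>)"
proof (rule R_eqI)
  fix W X assume WX: "W \<in> obj C" "X \<in> obj C"
  obtain S where S: "finite S" "S \<subseteq> obj C"
    "\<And>Z Y. Z \<in> obj C \<Longrightarrow> Y \<in> obj C \<Longrightarrow> Z \<notin> S \<or> Y \<notin> S \<Longrightarrow> \<phi> (Z, Y) = \<zero>\<^bsub>H Y Z\<^esub>"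
    "\<And>Z Y. Z \<in> obj C \<Longrightarrow> Y \<in> obj C \<Longrightarrow> Z \<notin> S \<or> Y \<notin> S \<Longrightarrow> \<chi> (Z, Y) = \<zero>\<^bsub>H Y Z\<^esub>"
    using common_support[OF assms(1,3)] by blast
  note cl = comp_closed assms[THEN carrierD(3)] R_mult_closed[OF assms(1,2), THEN carrierD(3)]
    R_mult_closed[OF assms(2,3), THEN carrierD(3)] WX S(2)[THEN subsetD]
  interpret WX: abelian_group "H X W" by (rule hom_group) fact+
  have "((\<phi> \<otimes>\<^bsub>R\<^esub> \<psi>) \<otimes>\<^bsub>R\<^esub> \<chi>) (W, X) = (\<Oplus>\<^bsub>H X W\<^esub>Y\<in>S. cmp X Y W ((\<phi> \<otimes>\<^bsub>R\<^esub> \<psi>) (W, Y)) (\<chi> (Y, X)))"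
    by (rule mult_entry) (use assms WX S in \<open>auto intro: R_mult_closed\<close>)
  also have "\<dots> = (\<Oplus>\<^bsub>H X W\<^esub>Y\<in>S. \<Oplus>\<^bsub>H X W\<^esub>Z\<in>S. cmp X Z W (\<phi> (W, Z)) (cmp X Y Z (\<psi> (Z, Y)) (\<chi> (Y, X))))"
  proof (rule WX.finsum_cong')
    fix Y assume Y: "Y \<in> S"
    have "(\<phi> \<otimes>\<^bsub>R\<^esub> \<psi>) (W, Y) = (\<Oplus>\<^bsub>H Y W\<^esub>Z\<in>S. cmp Y Z W (\<phi> (W, Z)) (\<psi> (Z, Y)))"
      by (rule mult_entry) (use assms WX S Y in auto)
    then have "cmp X Y W ((\<phi> \<otimes>\<^bsub>R\<^esub> \<psi>) (W, Y)) (\<chi> (Y, X)) =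
        (\<Oplus>\<^bsub>H X W\<^esub>Z\<in>S. cmp X Y W (cmp Y Z W (\<phi> (W, Z)) (\<psi> (Z, Y))) (\<chi> (Y, X)))"
      using Y by (simp, intro comp_finsum_left) (auto intro!: cl)
    also have "\<dots> = (\<Oplus>\<^bsub>H X W\<^esub>Z\<in>S. cmp X Z W (\<phi> (W, Z)) (cmp X Y Z (\<psi> (Z, Y)) (\<chi> (Y, X))))"
      by (rule WX.finsum_cong') (use Y in \<open>auto intro!: comp_assoc cl\<close>)
    finally show "cmp X Y W ((\<phi> \<otimes>\<^bsub>R\<^esub> \<psi>) (W, Y)) (\<chi> (Y, X)) =
      (\<Oplus>\<^bsub>H X W\<^esub>Z\<in>S. cmp X Z W (\<phi> (W, Z)) (cmp X Y Z (\<psi> (Z, Y)) (\<chi> (Y, X))))" .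
  qed (auto intro!: hom_finsum_closed cl)
  also have "\<dots> = (\<Oplus>\<^bsub>H X W\<^esub>Z\<in>S. \<Oplus>\<^bsub>H X W\<^esub>Y\<in>S. cmp X Z W (\<phi> (W, Z)) (cmp X Y Z (\<psi> (Z, Y)) (\<chi> (Y, X))))"
    by (rule WX.finsum_swap) (auto intro!: S(1) cl)
  also have "\<dots> = (\<Oplus>\<^bsub>H X W\<^esub>Z\<in>S. cmp X Z W (\<phi> (W, Z)) ((\<psi> \<otimes>\<^bsub>R\<^esub> \<chi>) (Z, X)))"
  proof (rule WX.finsum_cong')
    fix Z assume Z: "Z \<in> S"
    have "(\<psi> \<otimes>\<^bsub>R\<^esub> \<chi>) (Z, X) = (\<Oplus>\<^bsub>H X Z\<^esub>Y\<in>S. cmp X Y Z (\<psi> (Z, Y)) (\<chi> (Y, X)))"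
      by (rule mult_entry) (use assms WX S Z in auto)
    then show "(\<Oplus>\<^bsub>H X W\<^esub>Y\<in>S. cmp X Z W (\<phi> (W, Z)) (cmp X Y Z (\<psi> (Z, Y)) (\<chi> (Y, X)))) =
        cmp X Z W (\<phi> (W, Z)) ((\<psi> \<otimes>\<^bsub>R\<^esub> \<chi>) (Z, X))"
      using Z by (simp, intro comp_finsum_right[symmetric]) (auto intro!: cl)
  qed (auto intro!: cl)
  also have "\<dots> = (\<phi> \<otimes>\<^bsub>R\<^esub> (\<psi> \<otimes>\<^bsub>R\<^esub> \<chi>)) (W, X)"
    by (rule mult_entry[symmetric]) (use assms WX S in \<open>auto intro: R_mult_closed\<close>)
  finally show "(\<phi> \<otimes>\<^bsub>R\<^esub> \<psi> \<otimes>\<^bsub>R\<^esub> \<chi>) (W, X) = (\<phi> \<otimes>\<^bsub>R\<^esub> (\<psi> \<otimes>\<^bsub>R\<^esub> \<chi>)) (W, X)" .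
qed simp_all

lemma R_distr:
  assumes "\<phi> \<in> carrier R" "\<psi> \<in> carrier R" "\<chi> \<in> carrier R"
  shows "(\<phi> \<oplus>\<^bsub>R\<^esub> \<psi>) \<otimes>\<^bsub>R\<^esub> \<chi> = \<phi> \<otimes>\<^bsub>R\<^esub> \<chi> \<oplus>\<^bsub>R\<^esub> \<psi> \<otimes>\<^bsub>R\<^esub> \<chi>" (is ?L)
    and "\<chi> \<otimes>\<^bsub>R\<^esub> (\<phi> \<oplus>\<^bsub>R\<^esub> \<psi>) = \<chi> \<otimes>\<^bsub>R\<^esub> \<phi> \<oplus>\<^bsub>R\<^esub> \<chi> \<otimes>\<^bsub>R\<^esub> \<psi>" (is ?R)
proof -
  obtain S where S: "finite S" "S \<subseteq> obj C"
    "\<And>Z Y. Z \<in> obj C \<Longrightarrow> Y \<in> obj C \<Longrightarrow> Z \<notin> S \<or> Y \<notin> S \<Longrightarrow> \<chi> (Z, Y) = \<zero>\<^bsub>H Y Z\<^esub>"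
    "\<And>Z Y. Z \<in> obj C \<Longrightarrow> Y \<in> obj C \<Longrightarrow> Z \<notin> S \<or> Y \<notin> S \<Longrightarrow> \<phi> (Z, Y) = \<zero>\<^bsub>H Y Z\<^esub>"
    using common_support[OF assms(3,1)] by blast
  note cl = comp_closed assms[THEN carrierD(3)] S(2)[THEN subsetD]
  have entry: "(\<alpha> \<otimes>\<^bsub>R\<^esub> \<beta>) (Z, X) = (\<Oplus>\<^bsub>H X Z\<^esub>Y\<in>S. cmp X Y Z (\<alpha> (Z, Y)) (\<beta> (Y, X)))"
    if "\<alpha> \<in> carrier R" "\<beta> \<in> carrier R" "\<alpha> = \<chi> \<or> \<beta> = \<chi>" "Z \<in> obj C" "X \<in> obj C" for \<alpha> \<beta> Z X
  proof (rule mult_entry[OF that(1,2,4,5) S(1,2)])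
    fix Y assume "Y \<in> obj C - S"
    then show "\<alpha> (Z, Y) = \<zero>\<^bsub>H Y Z\<^esub> \<or> \<beta> (Y, X) = \<zero>\<^bsub>H X Y\<^esub>"
      using S(3)[of Z Y] S(3)[of Y X] that(3-5) by blast
  qed
  show ?L
  proof (rule R_eqI)
    fix Z X assume ZX: "Z \<in> obj C" "X \<in> obj C"
    interpret XZ: abelian_group "H X Z" by (rule hom_group) fact+
    have "((\<phi> \<oplus>\<^bsub>R\<^esub> \<psi>) \<otimes>\<^bsub>R\<^esub> \<chi>) (Z, X) = (\<Oplus>\<^bsub>H X Z\<^esub>Y\<in>S. cmp X Y Z ((\<phi> \<oplus>\<^bsub>R\<^esub> \<psi>) (Z, Y)) (\<chi> (Y, X)))"
      by (rule entry) (use ZX assms in \<open>auto intro: R_add_closed\<close>)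
    also have "\<dots> = (\<Oplus>\<^bsub>H X Z\<^esub>Y\<in>S. cmp X Y Z (\<phi> (Z, Y)) (\<chi> (Y, X)) \<oplus>\<^bsub>H X Z\<^esub>
        cmp X Y Z (\<psi> (Z, Y)) (\<chi> (Y, X)))"
      by (rule XZ.finsum_cong') (use ZX in \<open>auto simp: cl comp_add_left\<close>)
    also have "\<dots> = (\<phi> \<otimes>\<^bsub>R\<^esub> \<chi> \<oplus>\<^bsub>R\<^esub> \<psi> \<otimes>\<^bsub>R\<^esub> \<chi>) (Z, X)"
      using ZX assms XZ.finsum_addf by (simp add: entry cl Pi_iff)
    finally show "((\<phi> \<oplus>\<^bsub>R\<^esub> \<psi>) \<otimes>\<^bsub>R\<^esub> \<chi>) (Z, X) = (\<phi> \<otimes>\<^bsub>R\<^esub> \<chi> \<oplus>\<^bsub>R\<^esub> \<psi> \<otimes>\<^bsub>R\<^esub> \<chi>) (Z, X)" .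
  qed simp_all
  show ?R
  proof (rule R_eqI)
    fix Z X assume ZX: "Z \<in> obj C" "X \<in> obj C"
    interpret XZ: abelian_group "H X Z" by (rule hom_group) fact+
    have "(\<chi> \<otimes>\<^bsub>R\<^esub> (\<phi> \<oplus>\<^bsub>R\<^esub> \<psi>)) (Z, X) = (\<Oplus>\<^bsub>H X Z\<^esub>Y\<in>S. cmp X Y Z (\<chi> (Z, Y)) ((\<phi> \<oplus>\<^bsub>R\<^esub> \<psi>) (Y, X)))"
      by (rule entry) (use ZX assms in \<open>auto intro: R_add_closed\<close>)
    also have "\<dots> = (\<Oplus>\<^bsub>H X Z\<^esub>Y\<in>S. cmp X Y Z (\<chi> (Z, Y)) (\<phi> (Y, X)) \<oplus>\<^bsub>H X Z\<^esub>
        cmp X Y Z (\<chi> (Z, Y)) (\<psi> (Y, X)))"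
      by (rule XZ.finsum_cong') (use ZX in \<open>auto simp: cl comp_add_right\<close>)
    also have "\<dots> = (\<chi> \<otimes>\<^bsub>R\<^esub> \<phi> \<oplus>\<^bsub>R\<^esub> \<chi> \<otimes>\<^bsub>R\<^esub> \<psi>) (Z, X)"
      using ZX assms XZ.finsum_addf by (simp add: entry cl Pi_iff)
    finally show "(\<chi> \<otimes>\<^bsub>R\<^esub> (\<phi> \<oplus>\<^bsub>R\<^esub> \<psi>)) (Z, X) = (\<chi> \<otimes>\<^bsub>R\<^esub> \<phi> \<oplus>\<^bsub>R\<^esub> \<chi> \<otimes>\<^bsub>R\<^esub> \<psi>) (Z, X)" .
  qed simp_all
qed

lemma single_closed:
  assumes "Y \<in> obj C" "X \<in> obj C" "f \<in> carrier (H X Y)"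
  shows "single C (Y, X) f \<in> carrier R"
proof -
  have "supp (single C (Y, X) f) \<subseteq> {(Y, X)}" by (auto simp: supp_def split: if_splits)
  then have "finite (supp (single C (Y, X) f))" using finite_subset by blast
  then show ?thesis using assms by (auto simp: carrier_iff hom_zero_closed)
qed

lemma single_mult:
  assumes "Z \<in> obj C" "Y \<in> obj C" "Y' \<in> obj C" "X \<in> obj C" "g \<in> carrier (H Y Z)" "f \<in> carrier (H X Y')"
  shows "single C (Z, Y) g \<otimes>\<^bsub>R\<^esub> single C (Y', X) f =
    (if Y = Y' then single C (Z, X) (cmp X Y Z g f) else \<zero>\<^bsub>R\<^esub>)"
proof (rule R_eqI)
  fix W V assume WV: "W \<in> obj C" "V \<in> obj C"
  interpret abelian_group "H V W" by (rule hom_group) fact+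
  have "(single C (Z, Y) g \<otimes>\<^bsub>R\<^esub> single C (Y', X) f) (W, V) =
    (\<Oplus>\<^bsub>H V W\<^esub>U\<in>{Y}. cmp V U W (single C (Z, Y) g (W, U)) (single C (Y', X) f (U, V)))"
    by (rule mult_entry) (use WV assms in \<open>auto intro: single_closed\<close>)
  also have "\<dots> = cmp V Y W (single C (Z, Y) g (W, Y)) (single C (Y', X) f (Y, V))"
    using WV assms by (subst finsum_insert)
      (auto intro!: comp_closed single_closed[THEN carrierD(3)] r_zero simp del: R_entry)
  also have "\<dots> = (if Y = Y' then single C (Z, X) (cmp X Y Z g f) else \<zero>\<^bsub>R\<^esub>) (W, V)"
    using WV assms by (auto simp: comp_zero_left comp_zero_right hom_zero_closed)
  finally show "(single C (Z, Y) g \<otimes>\<^bsub>R\<^esub> single C (Y', X) f) (W, V) =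
    (if Y = Y' then single C (Z, X) (cmp X Y Z g f) else \<zero>\<^bsub>R\<^esub>) (W, V)" .
qed simp_all

lemma finsum_entry:
  assumes "Z \<in> obj C" "X \<in> obj C" "c \<in> F \<rightarrow> carrier R"
  shows "finsum R c F (Z, X) = finsum (H X Z) (\<lambda>\<gamma>. c \<gamma> (Z, X)) F"
  by (rule finsum_hom[where h = "\<lambda>\<phi>. \<phi> (Z, X)"])
    (use assms abelian_group_R in \<open>auto intro: hom_group abelian_group.axioms(1) simp: carrierD\<close>)

lemma hcomp_R: "hcomp R (Y, X) = single C (Y, X) ` carrier (H X Y)"
  by (simp add: cat_ring_def)

lemma hcomp_finsum_entry:
  assumes "finite F" "F \<subseteq> obj C \<times> obj C" "\<forall>\<gamma>\<in>F. c \<gamma> \<in> hcomp R \<gamma>" "Z \<in> obj C" "X \<in> obj C"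
  shows "finsum R c F (Z, X) = (if (Z, X) \<in> F then c (Z, X) (Z, X) else \<zero>\<^bsub>H X Z\<^esub>)"
proof -
  interpret abelian_group "H X Z" by (rule hom_group) fact+
  have c: "c \<in> F \<rightarrow> carrier R" using assms(2,3) by (force simp: hcomp_R intro: single_closed)
  have eq: "c \<gamma> (Z, X) = (if (Z, X) = \<gamma> then c \<gamma> (Z, X) else \<zero>\<^bsub>H X Z\<^esub>)" if "\<gamma> \<in> F" for \<gamma>
    using assms(3-5) that by (cases \<gamma>) (force simp: hcomp_R)
  have cl: "(\<lambda>\<gamma>. c \<gamma> (Z, X)) \<in> F \<rightarrow> carrier (H X Z)" using c assms(4,5) by (auto simp: Pi_iff carrierD)
  have "finsum R c F (Z, X) = (\<Oplus>\<^bsub>H X Z\<^esub>\<gamma>\<in>F. if (Z, X) = \<gamma> then c \<gamma> (Z, X) else \<zero>\<^bsub>H X Z\<^esub>)"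
    unfolding finsum_entry[OF assms(4,5) c]
    by (rule finsum_cong') (use eq cl in auto)
  also have "\<dots> = (if (Z, X) \<in> F then c (Z, X) (Z, X) else \<zero>\<^bsub>H X Z\<^esub>)"
    using finsum_singleton[OF _ assms(1) cl, of "(Z, X)"]
    by (auto intro!: add.finprod_one_eqI)
  finally show ?thesis .
qed

lemma hcomp_subgroup_R:
  assumes "Y \<in> obj C" "X \<in> obj C"
  shows "additive_subgroup (hcomp R (Y, X)) R"
proof -
  interpret R: abelian_group R by (rule abelian_group_R)
  interpret XY: abelian_group "H X Y" by (rule hom_group) fact+
  have add: "single C (Y, X) f \<oplus>\<^bsub>R\<^esub> single C (Y, X) g = single C (Y, X) (f \<oplus>\<^bsub>H X Y\<^esub> g)"
    if "f \<in> carrier (H X Y)" "g \<in> carrier (H X Y)" for f g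
    by (rule R_eqI) (auto simp: hom_zero_closed abelian_monoid.l_zero[OF hom_monoid])
  have zero: "single C (Y, X) \<zero>\<^bsub>H X Y\<^esub> = \<zero>\<^bsub>R\<^esub>"
    by (rule R_eqI) auto
  have "\<ominus>\<^bsub>R\<^esub> single C (Y, X) f = single C (Y, X) (\<ominus>\<^bsub>H X Y\<^esub> f)" if "f \<in> carrier (H X Y)" for f
    by (rule R.minus_equality) (use that assms in \<open>auto simp: add XY.l_neg zero intro: single_closed\<close>)
  then have inv: "\<ominus>\<^bsub>R\<^esub> x \<in> hcomp R (Y, X)" if "x \<in> hcomp R (Y, X)" for x
    using that by (auto simp: hcomp_R)
  show ?thesis
    unfolding additive_subgroup_def
    by (rule R.add.subgroupI)
      (use assms inv zero add in \<open>auto simp: hcomp_R a_inv_def intro: single_closed\<close>)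
qed

lemma graded_ring_R: "graded_ring (pair_groupoid (obj C)) R"
proof (intro graded_ring.intro groupoid_pair_groupoid abelian_group_R graded_ring_axioms.intro)
  let ?\<Gamma> = "pair_groupoid (obj C)"
  have [simp]: "arrows ?\<Gamma> = obj C \<times> obj C" "gobj ?\<Gamma> = {(X, X) | X. X \<in> obj C}"
    "\<And>y x. gdom ?\<Gamma> (y, x) = (x, x)" "\<And>y x. grng ?\<Gamma> (y, x) = (y, y)"
    "\<And>z w y x. gcomp ?\<Gamma> (z, w) (y, x) = (z, x)"
    by (auto simp: pair_groupoid_def gobj_def)
  have [simp]: "\<And>X. hone R (X, X) = single C (X, X) (ident C X)" by (simp add: cat_ring_def)
  show "\<And>x y. x \<in> carrier R \<Longrightarrow> y \<in> carrier R \<Longrightarrow> x \<otimes>\<^bsub>R\<^esub> y \<in> carrier R" by (rule R_mult_closed)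
  show "\<And>x y z. x \<in> carrier R \<Longrightarrow> y \<in> carrier R \<Longrightarrow> z \<in> carrier R \<Longrightarrow>
      x \<otimes>\<^bsub>R\<^esub> y \<otimes>\<^bsub>R\<^esub> z = x \<otimes>\<^bsub>R\<^esub> (y \<otimes>\<^bsub>R\<^esub> z)" by (rule R_mult_assoc)
  show "\<And>x y z. x \<in> carrier R \<Longrightarrow> y \<in> carrier R \<Longrightarrow> z \<in> carrier R \<Longrightarrow>
      (x \<oplus>\<^bsub>R\<^esub> y) \<otimes>\<^bsub>R\<^esub> z = x \<otimes>\<^bsub>R\<^esub> z \<oplus>\<^bsub>R\<^esub> y \<otimes>\<^bsub>R\<^esub> z" by (rule R_distr)
  show "\<And>x y z. x \<in> carrier R \<Longrightarrow> y \<in> carrier R \<Longrightarrow> z \<in> carrier R \<Longrightarrow>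
      z \<otimes>\<^bsub>R\<^esub> (x \<oplus>\<^bsub>R\<^esub> y) = z \<otimes>\<^bsub>R\<^esub> x \<oplus>\<^bsub>R\<^esub> z \<otimes>\<^bsub>R\<^esub> y" by (rule R_distr)
  show "\<And>\<gamma>. \<gamma> \<in> arrows ?\<Gamma> \<Longrightarrow> additive_subgroup (hcomp R \<gamma>) R" by (auto intro: hcomp_subgroup_R)
  show "\<exists>F c. finite F \<and> F \<subseteq> arrows ?\<Gamma> \<and> (\<forall>\<gamma>\<in>F. c \<gamma> \<in> hcomp R \<gamma>) \<and> x = finsum R c F"
    if x: "x \<in> carrier R" for x
  proof (intro exI conjI)
    let ?c = "\<lambda>\<gamma>. single C \<gamma> (x \<gamma>)"
    show fin: "finite (supp x)" and sub: "supp x \<subseteq> arrows ?\<Gamma>"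
      using x by (auto simp: carrierD) (auto simp: supp_def)
    show c: "\<forall>\<gamma>\<in>supp x. ?c \<gamma> \<in> hcomp R \<gamma>"
      using x by (auto simp: supp_def hcomp_R intro!: imageI carrierD(3)[OF x])
    interpret R: abelian_group R by (rule abelian_group_R)
    have "?c \<in> supp x \<rightarrow> carrier R"
      using x by (auto simp: supp_def intro!: single_closed carrierD(3)[OF x])
    then show "x = finsum R ?c (supp x)"
      using fin sub c x hcomp_finsum_entry[OF fin _ c]
      by (intro R_eqI) (auto simp: carrierD supp_def)
  qed
  show "\<forall>\<gamma>\<in>F. c \<gamma> = \<zero>\<^bsub>R\<^esub>"
    if F: "finite F" "F \<subseteq> arrows ?\<Gamma>" "\<forall>\<gamma>\<in>F. c \<gamma> \<in> hcomp R \<gamma>" "finsum R c F = \<zero>\<^bsub>R\<^esub>" for F c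
  proof
    fix \<gamma> assume g: "\<gamma> \<in> F"
    obtain Y X where [simp]: "\<gamma> = (Y, X)" by (cases \<gamma>)
    have YX: "Y \<in> obj C" "X \<in> obj C" using g F(2) by auto
    obtain f where f: "c \<gamma> = single C \<gamma> f" using bspec[OF F(3) g] by (auto simp: hcomp_R)
    have "f = \<zero>\<^bsub>H X Y\<^esub>"
      using hcomp_finsum_entry[of F c Y X] F g YX f by auto
    then show "c \<gamma> = \<zero>\<^bsub>R\<^esub>" using f by (intro R_eqI) auto
  qed
  show "if gdom ?\<Gamma> \<gamma> = grng ?\<Gamma> \<delta> then x \<otimes>\<^bsub>R\<^esub> y \<in> hcomp R (gcomp ?\<Gamma> \<gamma> \<delta>) else x \<otimes>\<^bsub>R\<^esub> y = \<zero>\<^bsub>R\<^esub>"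
    if "\<gamma> \<in> arrows ?\<Gamma>" "\<delta> \<in> arrows ?\<Gamma>" "x \<in> hcomp R \<gamma>" "y \<in> hcomp R \<delta>" for \<gamma> \<delta> x y
    using that by (cases \<gamma>; cases \<delta>) (auto simp: hcomp_R single_mult intro!: imageI comp_closed)
  show "hone R e \<in> hcomp R e" if "e \<in> gobj ?\<Gamma>" for e
    using that by (auto simp: hcomp_R intro!: imageI ident_closed)
  show "hone R (grng ?\<Gamma> \<gamma>) \<otimes>\<^bsub>R\<^esub> x = x" "x \<otimes>\<^bsub>R\<^esub> hone R (gdom ?\<Gamma> \<gamma>) = x"
    if "\<gamma> \<in> arrows ?\<Gamma>" "x \<in> hcomp R \<gamma>" for \<gamma> x
    using that by (cases \<gamma>; auto simp: hcomp_R single_mult ident_closed ident_left ident_right)+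
qed

end


section \<open>The universe for mod-\<open>A\<close>\<close>

lemma fg_mod_transport:
  fixes M :: "('a, 'm) rmodule" and f :: "'m \<Rightarrow> 'n"
  assumes M: "M \<in> fg_mod A" and inj: "inj_on f (carrier M)"
  obtains N :: "('a, 'n) rmodule" where "N \<in> fg_mod A" "rmod_isomorphic A M N"
proof -
  define g where "g = inv_into (carrier M) f"
  have gf [simp]: "g (f x) = x" if "x \<in> carrier M" for x using that inj by (simp add: g_def)
  define N :: "('a, 'n) rmodule" where "N = \<lparr>carrier = f ` carrier M, mult = undefined, one = undefined, zero = f \<zero>\<^bsub>M\<^esub>,
    add = (\<lambda>x y. f (g x \<oplus>\<^bsub>M\<^esub> g y)), ract = (\<lambda>x a. f (g x \<cdot>\<^bsub>M\<^esub> a))\<rparr>"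
  have [simp]: "carrier N = f ` carrier M" "\<zero>\<^bsub>N\<^esub> = f \<zero>\<^bsub>M\<^esub>" "\<And>x y. x \<oplus>\<^bsub>N\<^esub> y = f (g x \<oplus>\<^bsub>M\<^esub> g y)"
    "\<And>x a. x \<cdot>\<^bsub>N\<^esub> a = f (g x \<cdot>\<^bsub>M\<^esub> a)" by (auto simp: N_def)
  interpret M: right_module A M using M by (simp add: fg_mod_def)
  have N: "abelian_group N"
  proof (rule abelian_groupI)
    fix x assume "x \<in> carrier N"
    then obtain m where "m \<in> carrier M" "x = f m" by auto
    then show "\<exists>y\<in>carrier N. y \<oplus>\<^bsub>N\<^esub> x = \<zero>\<^bsub>N\<^esub>"
      by (intro bexI[of _ "f (\<ominus>\<^bsub>M\<^esub> m)"]) (auto simp: M.M.l_neg)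
  qed (auto simp: M.M.a_ac)
  have rN: "right_module A N"
    by (intro right_module.intro right_module_axioms.intro N M.A.ring_axioms)
      (auto simp: M.ract_closed M.ract_add_left M.ract_add_right M.ract_assoc M.ract_one)
  obtain S where S: "finite S" "S \<subseteq> carrier M"
    "\<And>m. m \<in> carrier M \<Longrightarrow> \<exists>c\<in>S \<rightarrow> carrier A. m = (\<Oplus>\<^bsub>M\<^esub>s\<in>S. s \<cdot>\<^bsub>M\<^esub> c s)"
    using M unfolding fg_mod_def finitely_generated_def by blast
  interpret N: abelian_group N by (rule N)
  have "\<exists>c\<in>f ` S \<rightarrow> carrier A. f m = (\<Oplus>\<^bsub>N\<^esub>s\<in>f ` S. s \<cdot>\<^bsub>N\<^esub> c s)" if m: "m \<in> carrier M" for m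
  proof -
    obtain c where c: "c \<in> S \<rightarrow> carrier A" "m = (\<Oplus>\<^bsub>M\<^esub>s\<in>S. s \<cdot>\<^bsub>M\<^esub> c s)" using S(3)[OF m] by blast
    have "f m = (\<Oplus>\<^bsub>N\<^esub>s\<in>S. f (s \<cdot>\<^bsub>M\<^esub> c s))" unfolding c(2)
      by (rule finsum_hom) (use S(2) c(1) N in \<open>auto intro!: M.ract_closed M.M.abelian_monoid_axioms\<close>)
    also have "\<dots> = (\<Oplus>\<^bsub>N\<^esub>s\<in>S. f s \<cdot>\<^bsub>N\<^esub> c (g (f s)))"
      by (rule N.finsum_cong') (use S(2) c(1) in \<open>auto intro!: M.ract_closed imageI simp: subset_iff Pi_iff\<close>)
    also have "\<dots> = (\<Oplus>\<^bsub>N\<^esub>t\<in>f ` S. t \<cdot>\<^bsub>N\<^esub> c (g t))"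
      by (rule N.finsum_reindex[symmetric])
        (use S(2) c(1) inj in \<open>auto intro!: M.ract_closed imageI simp: subset_iff Pi_iff inj_on_def\<close>)
    finally show ?thesis using S(2) c(1)
      by (intro bexI[of _ "c \<circ> g"]) (auto simp: subset_iff Pi_iff)
  qed
  then have "finitely_generated A N"
    unfolding finitely_generated_def using S(1,2)
    by (intro exI[of _ "f ` S"]) auto
  then have "N \<in> fg_mod A" using rN by (simp add: fg_mod_def)
  moreover have "restrict f (carrier M) \<in> rmod_hom A M N"
    by (auto simp: rmod_hom_def M.ract_closed)
  moreover have "bij_betw (restrict f (carrier M)) (carrier M) (carrier N)"
    using inj by (simp add: bij_betw_def inj_on_def)
  ultimately show ?thesis
    using that unfolding rmod_isomorphic_def by blast
qed

lemma fg_mod_universe: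
  fixes A :: "('a, 'p) ring_scheme" and M :: "('a, 'm) rmodule"
  assumes M: "M \<in> fg_mod A"
  obtains N :: "('a, 'a list) rmodule" where "N \<in> fg_mod A" "rmod_isomorphic A M N"
proof -
  interpret M: right_module A M using M by (simp add: fg_mod_def)
  obtain S where S: "finite S" "S \<subseteq> carrier M"
    "\<And>m. m \<in> carrier M \<Longrightarrow> \<exists>c\<in>S \<rightarrow> carrier A. m = (\<Oplus>\<^bsub>M\<^esub>s\<in>S. s \<cdot>\<^bsub>M\<^esub> c s)"
    using M unfolding fg_mod_def finitely_generated_def by blast
  obtain c where c: "\<And>m. m \<in> carrier M \<Longrightarrow> c m \<in> S \<rightarrow> carrier A \<and> m = (\<Oplus>\<^bsub>M\<^esub>s\<in>S. s \<cdot>\<^bsub>M\<^esub> c m s)"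
    using S(3) by metis
  obtain ss where ss: "set ss = S" using S(1) finite_list by blast
  have "inj_on (\<lambda>m. map (c m) ss) (carrier M)"
  proof (rule inj_onI)
    fix m n assume mn: "m \<in> carrier M" "n \<in> carrier M" "map (c m) ss = map (c n) ss"
    have "(\<Oplus>\<^bsub>M\<^esub>s\<in>S. s \<cdot>\<^bsub>M\<^esub> c m s) = (\<Oplus>\<^bsub>M\<^esub>s\<in>S. s \<cdot>\<^bsub>M\<^esub> c n s)"
      by (rule M.M.finsum_cong') (use mn ss S(2) c in \<open>auto intro!: M.ract_closed simp: Pi_iff subset_iff\<close>)
    then show "m = n" using c mn by metis
  qed
  from fg_mod_transport[OF M this] that show ?thesis by blast
qed

lemma rmod_isomorphic_trans:
  assumes "right_module A L" "rmod_isomorphic A L M" "rmod_isomorphic A M N"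
  shows "rmod_isomorphic A L N"
proof -
  obtain f where f: "f \<in> rmod_hom A L M" "bij_betw f (carrier L) (carrier M)"
    using assms(2) unfolding rmod_isomorphic_def by blast
  obtain g where g: "g \<in> rmod_hom A M N" "bij_betw g (carrier M) (carrier N)"
    using assms(3) unfolding rmod_isomorphic_def by blast
  have "bij_betw (compose (carrier L) g f) (carrier L) (carrier N)"
    using f(2) g(2) by (rule bij_betw_compose)
  then show ?thesis
    unfolding rmod_isomorphic_def using compose_rmod_hom[OF assms(1) f(1) g(1)] by blast
qed

lemma skeleton_of_fg_mod_dense:
  fixes M :: "('a, 'n) rmodule"
  assumes "skeleton_of_fg_mod A C" "M \<in> fg_mod A"
  obtains N where "N \<in> C" "rmod_isomorphic A M N"
proof -
  have M: "right_module A M" using assms(2) unfolding fg_mod_def by blast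
  obtain L :: "('a, 'a list) rmodule" where L: "L \<in> fg_mod A" "rmod_isomorphic A M L"
    using assms(2) by (rule fg_mod_universe)
  obtain N where N: "N \<in> C" "rmod_isomorphic A L N"
    using assms(1) L(1) unfolding skeleton_of_fg_mod_def by blast
  show ?thesis using N(1) rmod_isomorphic_trans[OF M L(2) N(2)] by (rule that)
qed

lemma graded_ring_full_subcat:
  "C \<subseteq> fg_mod A \<Longrightarrow> graded_ring (pair_groupoid C) (cat_ring (full_subcat A C))"
  using preadditive_category.graded_ring_R[OF preadditive_full_subcat[of C A]]
  by (simp add: full_subcat_def)

end

theory Submission
  imports Defs
begin

text \<open>
  Let \<open>\<X>\<close> be a finite set of objects such that the identity of every object \<open>M\<close> is a finite sum of
  morphisms \<open>i \<circ> p\<close> that factor through objects of \<open>\<X>\<close>, as it is when \<open>M\<close> is a direct sum of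
  such objects. A graded right submodule \<open>N\<close> of \<open>1\<^sub>e R\<close>, where \<open>e = (Z, Z)\<close>, amounts to a
  family of subgroups \<open>N\<^sub>M\<close> of \<open>Hom(M, Z)\<close> that is closed under composition from the right. Writing
  \<open>f \<in> N\<^sub>M\<close> as \<open>f \<circ> id\<close>, a sum of terms \<open>(f \<circ> i) \<circ> p\<close> with \<open>f \<circ> i \<in> N\<^sub>X\<close>, shows that \<open>N\<close> is
  determined by the finitely many \<open>N\<^sub>X\<close> with \<open>X \<in> \<X>\<close>. Each of these is closed under the scalars in
  \<open>End(X)\<close>, so it is a subspace of \<open>Hom(X, Z)\<close>, and this space is finite dimensional because \<open>X\<close> is
  finitely generated and \<open>Z\<close> is finite dimensional. The sum of the dimensions of the \<open>N\<^sub>X\<close> is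
  therefore a bounded, strictly monotone function of \<open>N\<close>, and both chain conditions follow. Left
  modules are treated dually. These steps are \<open>comp_factoring_in_component\<close>,
  \<open>finite_length_rmod_hom\<close>, \<open>bounded_rank_product\<close> and, put together,
  \<open>chain_conditions_if_identities_factor\<close>.

  In the first part of the theorem the identities have the required form by
  \<open>identity_factors_if_direct_sum\<close>. In the second part \<open>\<X>\<close> consists of the indecomposable objects of
  the skeleton, which are finitely many since the algebra is representation-finite
  (\<open>finite_indecomposables_of_skeleton\<close>), and a finitely generated module splits into
  indecomposables by induction on the dimension
  (\<open>identity_factors_through_indecomposables\<close>).
\<close>


section \<open>Chain conditions from a bounded rank\<close>

text \<open>
  For the lattices below, of subgroups, the best possible bound is the length of the lattice. A bounded
  strictly monotone rank yields the descending and the ascending chain condition by the same argument,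
  and ranks of finitely many pieces can simply be added.
\<close>

definition bounded_rank :: "('r set \<Rightarrow> bool) \<Rightarrow> bool" where
  "bounded_rank P \<longleftrightarrow> (\<exists>r :: 'r set \<Rightarrow> nat. \<exists>n. \<forall>W. P W \<longrightarrow>
     r W \<le> n \<and> (\<forall>W'. P W' \<and> W \<subset> W' \<longrightarrow> r W < r W'))"

lemma bounded_rankI:
  assumes "\<And>W. P W \<Longrightarrow> r W \<le> (n::nat)" "\<And>W W'. P W \<Longrightarrow> P W' \<Longrightarrow> W \<subset> W' \<Longrightarrow> r W < r W'"
  shows "bounded_rank P"
  unfolding bounded_rank_def using assms by blast

lemma bounded_rankE:
  assumes "bounded_rank P"
  obtains r and n :: nat where "\<And>W. P W \<Longrightarrow> r W \<le> n" "\<And>W W'. P W \<Longrightarrow> P W' \<Longrightarrow> W \<subset> W' \<Longrightarrow> r W < r W'"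
  using assms unfolding bounded_rank_def by blast

lemma bounded_rank_subclass: "bounded_rank P \<Longrightarrow> (\<And>W. Q W \<Longrightarrow> P W) \<Longrightarrow> bounded_rank Q"
  unfolding bounded_rank_def by meson

lemma desc_chain_cond_if_bounded_rank:
  assumes "bounded_rank P"
  shows "desc_chain_cond P"
  unfolding desc_chain_cond_def
proof (intro allI impI, elim conjE)
  fix N :: "nat \<Rightarrow> _" assume N: "\<forall>i. P (N i)" "antimono N"
  obtain r n where r: "\<And>W. P W \<Longrightarrow> r W \<le> (n::nat)" "\<And>W W'. P W \<Longrightarrow> P W' \<Longrightarrow> W \<subset> W' \<Longrightarrow> r W < r W'"
    using bounded_rankE[OF assms] by metis
  obtain k where k: "\<And>i. r (N k) \<le> r (N i)"
    using exists_least_iff[of "\<lambda>m. \<exists>i. r (N i) = m"] by (metis not_less)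
  have "N i = N k" if "i \<ge> k" for i
    using k[of i] r(2)[of "N i" "N k"] N that by (metis antimonoD not_less psubsetI)
  then show "\<exists>n. \<forall>i\<ge>n. N i = N n" by blast
qed

lemma asc_chain_cond_if_bounded_rank:
  assumes "bounded_rank P"
  shows "asc_chain_cond P"
  unfolding asc_chain_cond_def
proof (intro allI impI, elim conjE)
  fix N :: "nat \<Rightarrow> _" assume N: "\<forall>i. P (N i)" "mono N"
  obtain r n where r: "\<And>W. P W \<Longrightarrow> r W \<le> (n::nat)" "\<And>W W'. P W \<Longrightarrow> P W' \<Longrightarrow> W \<subset> W' \<Longrightarrow> r W < r W'"
    using bounded_rankE[OF assms] by metis
  obtain k where k: "\<And>i. r (N i) \<le> r (N k)"
    using ex_has_greatest_nat[of "\<lambda>_. True" 0 "\<lambda>i. r (N i)" "Suc n"] r(1) N(1) by (auto simp: less_Suc_eq_le)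
  have "N i = N k" if "i \<ge> k" for i
    using k[of i] r(2)[of "N k" "N i"] N that by (metis monoD not_less psubsetI)
  then show "\<exists>n. \<forall>i\<ge>n. N i = N n" by blast
qed

text \<open>
  The ranks of the finitely many pieces \<open>t x W\<close> add up to a rank of \<open>W\<close>: if \<open>W\<close> grows strictly, then so
  does at least one piece, because the pieces determine \<open>W\<close> among comparable members.
\<close>

lemma bounded_rank_product:
  assumes fin: "finite X" and Q: "\<And>x. x \<in> X \<Longrightarrow> bounded_rank (Q x)"
    and t: "\<And>x W. x \<in> X \<Longrightarrow> P W \<Longrightarrow> Q x (t x W)"
    and mono: "\<And>x W W'. x \<in> X \<Longrightarrow> W \<subseteq> W' \<Longrightarrow> t x W \<subseteq> t x W'"
    and inj: "\<And>W W'. P W \<Longrightarrow> P W' \<Longrightarrow> W \<subseteq> W' \<Longrightarrow> (\<And>x. x \<in> X \<Longrightarrow> t x W' = t x W) \<Longrightarrow> W' \<subseteq> W"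
  shows "bounded_rank P"
proof -
  have "\<forall>x. \<exists>r. \<exists>n::nat. x \<in> X \<longrightarrow> (\<forall>W. Q x W \<longrightarrow> r W \<le> n \<and> (\<forall>W'. Q x W' \<and> W \<subset> W' \<longrightarrow> r W < r W'))"
    using Q unfolding bounded_rank_def by metis
  then obtain r and n :: "_ \<Rightarrow> nat" where
    r: "\<And>x W. x \<in> X \<Longrightarrow> Q x W \<Longrightarrow> r x W \<le> n x"
       "\<And>x W W'. x \<in> X \<Longrightarrow> Q x W \<Longrightarrow> Q x W' \<Longrightarrow> W \<subset> W' \<Longrightarrow> r x W < r x W'"
    by metis
  show ?thesis
  proof (rule bounded_rankI[where r = "\<lambda>W. \<Sum>x\<in>X. r x (t x W)" and n = "\<Sum>x\<in>X. n x"])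
    show "(\<Sum>x\<in>X. r x (t x W)) \<le> (\<Sum>x\<in>X. n x)" if "P W" for W
      using that by (intro sum_mono r(1) t)
    fix W W' assume W: "P W" "P W'" "W \<subset> W'"
    obtain x where x: "x \<in> X" "t x W' \<noteq> t x W" using inj[OF W(1,2)] W(3) by blast
    show "(\<Sum>x\<in>X. r x (t x W)) < (\<Sum>x\<in>X. r x (t x W'))"
    proof (rule sum_strict_mono_ex1[OF fin])
      show "\<forall>x\<in>X. r x (t x W) \<le> r x (t x W')"
        using r(2) mono t W by (metis order_less_imp_le psubsetI psubset_imp_subset order_refl)
      show "\<exists>x\<in>X. r x (t x W) < r x (t x W')"
        using x r(2)[OF x(1) t[OF x(1) W(1)] t[OF x(1) W(2)]] mono[OF x(1), of W W'] W(3) by blast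
    qed
  qed
qed


section \<open>Groups with operators of finite length\<close>

lemma additive_subgroupI:
  assumes "abelian_group G" "W \<subseteq> carrier G" "\<zero>\<^bsub>G\<^esub> \<in> W"
    "\<And>x y. x \<in> W \<Longrightarrow> y \<in> W \<Longrightarrow> x \<oplus>\<^bsub>G\<^esub> y \<in> W" "\<And>x. x \<in> W \<Longrightarrow> \<ominus>\<^bsub>G\<^esub> x \<in> W"
  shows "additive_subgroup W G"
proof -
  interpret abelian_group G by fact
  show ?thesis unfolding additive_subgroup_def
    by (rule add.subgroupI) (use assms in \<open>auto simp: a_inv_def\<close>)
qed

lemma additive_subgroup_facts:
  assumes "abelian_group G" "additive_subgroup W G"
  shows "W \<subseteq> carrier G" "\<zero>\<^bsub>G\<^esub> \<in> W" "x \<in> W \<Longrightarrow> x \<in> carrier G" "x \<in> W \<Longrightarrow> y \<in> W \<Longrightarrow> x \<oplus>\<^bsub>G\<^esub> y \<in> W"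
    "x \<in> W \<Longrightarrow> \<ominus>\<^bsub>G\<^esub> x \<in> W" "x \<in> W \<Longrightarrow> y \<in> W \<Longrightarrow> x \<ominus>\<^bsub>G\<^esub> y \<in> W"
proof -
  interpret abelian_group G by fact
  interpret W: additive_subgroup W G by fact
  show sub: "W \<subseteq> carrier G" and "\<zero>\<^bsub>G\<^esub> \<in> W" by (rule W.a_subset, rule W.zero_closed)
  show "x \<in> W \<Longrightarrow> x \<in> carrier G" using sub by blast
  show "x \<in> W \<Longrightarrow> y \<in> W \<Longrightarrow> x \<oplus>\<^bsub>G\<^esub> y \<in> W" by (rule W.a_closed)
  have inv: "z \<in> W \<Longrightarrow> \<ominus>\<^bsub>G\<^esub> z \<in> W" for z
    using subgroup.m_inv_closed[OF W.a_subgroup] by (simp add: a_inv_def)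
  then show "x \<in> W \<Longrightarrow> \<ominus>\<^bsub>G\<^esub> x \<in> W" .
  show "x \<in> W \<Longrightarrow> y \<in> W \<Longrightarrow> x \<ominus>\<^bsub>G\<^esub> y \<in> W" by (simp add: a_minus_def inv)
qed

lemma finsum_in_subgroup:
  assumes "abelian_group G" "additive_subgroup W G" "\<And>i. i \<in> I \<Longrightarrow> f i \<in> W"
  shows "finsum G f I \<in> W"
proof -
  interpret abelian_group G by fact
  note W = additive_subgroup_facts[OF assms(1,2)]
  show ?thesis using assms(3)
    by (induction I rule: infinite_finite_induct) (auto simp: W finsum_insert Pi_iff finsum_infinite)
qed

lemma additive_map_zero_minus:
  assumes G: "abelian_group G" and H: "abelian_group H"
    and h: "\<And>x. x \<in> carrier G \<Longrightarrow> h x \<in> carrier H"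
    and add: "\<And>x y. x \<in> carrier G \<Longrightarrow> y \<in> carrier G \<Longrightarrow> h (x \<oplus>\<^bsub>G\<^esub> y) = h x \<oplus>\<^bsub>H\<^esub> h y"
  shows "h \<zero>\<^bsub>G\<^esub> = \<zero>\<^bsub>H\<^esub>" "x \<in> carrier G \<Longrightarrow> h (\<ominus>\<^bsub>G\<^esub> x) = \<ominus>\<^bsub>H\<^esub> h x"
proof -
  interpret G: abelian_group G by fact
  interpret H: abelian_group H by fact
  show z: "h \<zero>\<^bsub>G\<^esub> = \<zero>\<^bsub>H\<^esub>"
    using add[of "\<zero>\<^bsub>G\<^esub>" "\<zero>\<^bsub>G\<^esub>"] h[of "\<zero>\<^bsub>G\<^esub>"] by (simp add: H.add.l_cancel_one')
  show "h (\<ominus>\<^bsub>G\<^esub> x) = \<ominus>\<^bsub>H\<^esub> h x" if "x \<in> carrier G"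
    using add[of "\<ominus>\<^bsub>G\<^esub> x" x] that h z by (intro H.minus_equality[symmetric]) (auto simp: G.l_neg)
qed

lemma additive_subgroup_vimage:
  assumes G: "abelian_group G" and H: "abelian_group H"
    and h: "\<And>x. x \<in> carrier G \<Longrightarrow> h x \<in> carrier H"
    and add: "\<And>x y. x \<in> carrier G \<Longrightarrow> y \<in> carrier G \<Longrightarrow> h (x \<oplus>\<^bsub>G\<^esub> y) = h x \<oplus>\<^bsub>H\<^esub> h y"
    and U: "additive_subgroup U G" and W: "additive_subgroup W H"
  shows "additive_subgroup {x \<in> U. h x \<in> W} G"
proof -
  note U' = additive_subgroup_facts[OF G U] note W' = additive_subgroup_facts[OF H W]
  note z = additive_map_zero_minus[of G H h, OF G H h add]
  show ?thesis
    by (rule additive_subgroupI[OF G]) (auto simp: U' W' add z)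
qed

text \<open>
  The operators are given as a family with index set \<open>K\<close>, so that the same \<open>K\<close> can act on several groups
  and a homomorphism can be required to commute with the actions.
\<close>

definition op_subgroup :: "'k set \<Rightarrow> ('k \<Rightarrow> 'g \<Rightarrow> 'g) \<Rightarrow> ('g, 'p) ring_scheme \<Rightarrow> 'g set \<Rightarrow> bool" where
  "op_subgroup K act G W \<longleftrightarrow> additive_subgroup W G \<and> (\<forall>c\<in>K. \<forall>x\<in>W. act c x \<in> W)"

text \<open>
  \<open>finite_length K act G V\<close> says that \<open>V\<close> has a composition series in which each factor \<open>V/U\<close> consists
  of the multiples of any of its non-zero elements, stated without quotients: every \<open>v \<in> V\<close> agrees
  modulo \<open>U\<close> with a multiple of any given \<open>u \<in> V - U\<close>. For vector spaces these are the factors of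
  dimension one.
\<close>

inductive finite_length :: "'k set \<Rightarrow> ('k \<Rightarrow> 'g \<Rightarrow> 'g) \<Rightarrow> ('g, 'p) ring_scheme \<Rightarrow> 'g set \<Rightarrow> bool"
  for K act G where
  zero: "finite_length K act G {\<zero>\<^bsub>G\<^esub>}"
| step: "finite_length K act G V"
    if "finite_length K act G U" "op_subgroup K act G U" "op_subgroup K act G V" "U \<subseteq> V"
      "\<And>u v. u \<in> V - U \<Longrightarrow> v \<in> V \<Longrightarrow> \<exists>c\<in>K. v \<ominus>\<^bsub>G\<^esub> act c u \<in> U"

text \<open>
  The rank of \<open>W\<close> counts the factors of the series that \<open>W\<close> meets. It is strictly monotone by the
  usual modularity argument: if \<open>W \<subseteq> W'\<close> have the same intersection with \<open>U\<close> and \<open>W\<close> contains some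
  \<open>u \<notin> U\<close>, then each \<open>w \<in> W'\<close> differs from a multiple of \<open>u\<close> by an element of \<open>W' \<inter> U = W \<inter> U\<close>, and so
  lies in \<open>W\<close>.
\<close>

lemma bounded_rank_if_finite_length:
  assumes G: "abelian_group G" and "finite_length K act G V"
  shows "bounded_rank (\<lambda>W. op_subgroup K act G W \<and> W \<subseteq> V)"
  using assms(2)
proof induction
  case zero
  show ?case
    by (rule bounded_rankI[where r = "\<lambda>_. 0" and n = 0])
      (auto simp: op_subgroup_def dest: additive_subgroup_facts[OF G])
next
  case (step U V)
  interpret abelian_group G by fact
  obtain r n where r: "\<And>W. op_subgroup K act G W \<and> W \<subseteq> U \<Longrightarrow> r W \<le> (n::nat)"
    "\<And>W W'. op_subgroup K act G W \<and> W \<subseteq> U \<Longrightarrow> op_subgroup K act G W' \<and> W' \<subseteq> U \<Longrightarrow> W \<subset> W' \<Longrightarrow> r W < r W'"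
    using bounded_rankE[OF step.IH] by metis
  have int: "op_subgroup K act G (W \<inter> U) \<and> W \<inter> U \<subseteq> U" if "op_subgroup K act G W" for W
    using that step.hyps(2)
    by (auto simp: op_subgroup_def intro!: additive_subgroupI[OF G] dest: additive_subgroup_facts[OF G])
  show ?case
  proof (rule bounded_rankI[where r = "\<lambda>W. r (W \<inter> U) + (if W \<subseteq> U then 0 else 1)" and n = "Suc n"])
    fix W assume "op_subgroup K act G W \<and> W \<subseteq> V"
    then show "r (W \<inter> U) + (if W \<subseteq> U then 0 else 1) \<le> Suc n" using r(1)[OF int[of W]] by auto
  next
    fix W W'
    assume W: "op_subgroup K act G W \<and> W \<subseteq> V" and W': "op_subgroup K act G W' \<and> W' \<subseteq> V"
      and sub: "W \<subset> W'"
    show "r (W \<inter> U) + (if W \<subseteq> U then 0 else 1) < r (W' \<inter> U) + (if W' \<subseteq> U then 0 else 1)"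
    proof (cases "W \<inter> U = W' \<inter> U")
      case False
      then have "r (W \<inter> U) < r (W' \<inter> U)" using r(2) int W W' sub by blast
      then show ?thesis using sub by auto
    next
      case eq: True
      have "W \<subseteq> U"
      proof (rule ccontr)
        assume "\<not> W \<subseteq> U"
        then obtain u where u: "u \<in> W" "u \<notin> U" by blast
        note facts = additive_subgroup_facts[OF G, of W] additive_subgroup_facts[OF G, of W']
        have "w \<in> W" if w: "w \<in> W'" for w
        proof -
          obtain c where c: "c \<in> K" "w \<ominus>\<^bsub>G\<^esub> act c u \<in> U" using step.hyps(5)[of u w] u w W W' by blast
          have au: "act c u \<in> W" "act c u \<in> W'" using c(1) u W sub by (auto simp: op_subgroup_def)
          have "w \<ominus>\<^bsub>G\<^esub> act c u \<in> W' \<inter> U"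
            using au w W' c(2) facts by (auto simp: op_subgroup_def)
          then have "(w \<ominus>\<^bsub>G\<^esub> act c u) \<oplus>\<^bsub>G\<^esub> act c u \<in> W"
            using au eq W facts(4) by (auto simp: op_subgroup_def)
          moreover have "w \<in> carrier G" "act c u \<in> carrier G"
            using W' w au facts by (auto simp: op_subgroup_def)
          ultimately show ?thesis by (simp add: a_minus_def a_assoc l_neg)
        qed
        then show False using sub by blast
      qed
      then show ?thesis using eq sub by auto
    qed
  qed
qed

text \<open>
  A composition series of the kernel is continued by the preimages of a composition series of \<open>W\<close>;
  each factor of the continued part embeds into the corresponding factor of \<open>W\<close>.
\<close>

lemma finite_length_vimage:
  assumes G: "abelian_group G" and H: "abelian_group H"
    and h: "\<And>x. x \<in> carrier G \<Longrightarrow> h x \<in> carrier H"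
    and add: "\<And>x y. x \<in> carrier G \<Longrightarrow> y \<in> carrier G \<Longrightarrow> h (x \<oplus>\<^bsub>G\<^esub> y) = h x \<oplus>\<^bsub>H\<^esub> h y"
    and act: "\<And>c x. c \<in> K \<Longrightarrow> x \<in> carrier G \<Longrightarrow> h (act c x) = act' c (h x)"
    and U: "op_subgroup K act G U"
    and ker: "finite_length K act G {x \<in> U. h x = \<zero>\<^bsub>H\<^esub>}"
    and W: "finite_length K act' H W"
  shows "finite_length K act G {x \<in> U. h x \<in> W}"
  using W
proof induction
  case zero
  then show ?case using ker by simp
next
  case (step V W)
  have sub: "U \<subseteq> carrier G" and actU: "\<And>c x. c \<in> K \<Longrightarrow> x \<in> U \<Longrightarrow> act c x \<in> U"
    using U additive_subgroup_facts(1)[OF G] by (auto simp: op_subgroup_def)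
  have *: "op_subgroup K act G {x \<in> U. h x \<in> W}" if "op_subgroup K act' H W" for W
    using that U additive_subgroup_vimage[of G H h U W, OF G H h add] actU act sub
    by (auto simp: op_subgroup_def subset_iff)
  show ?case
  proof (rule finite_length.step[OF step.IH *[OF step.hyps(2)] *[OF step.hyps(3)]])
    show "{x \<in> U. h x \<in> V} \<subseteq> {x \<in> U. h x \<in> W}" using step.hyps(4) by blast
    fix u v assume uv: "u \<in> {x \<in> U. h x \<in> W} - {x \<in> U. h x \<in> V}" "v \<in> {x \<in> U. h x \<in> W}"
    then obtain c where c: "c \<in> K" "h v \<ominus>\<^bsub>H\<^esub> act' c (h u) \<in> V" using step.hyps(5)[of "h u" "h v"] by blast
    interpret G: abelian_group G by fact
    have "act c u \<in> U" using actU c uv by auto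
    moreover have "h (v \<ominus>\<^bsub>G\<^esub> act c u) = h v \<ominus>\<^bsub>H\<^esub> act' c (h u)"
      using \<open>act c u \<in> U\<close> uv sub c(1) additive_map_zero_minus(2)[of G H h, OF G H h add]
      by (auto simp: a_minus_def add act subset_iff)
    ultimately show "\<exists>c\<in>K. v \<ominus>\<^bsub>G\<^esub> act c u \<in> {x \<in> U. h x \<in> V}"
      using c uv U additive_subgroup_facts(6)[OF G] by (intro bexI[OF _ c(1)]) (auto simp: op_subgroup_def)
  qed
qed


section \<open>Finite length of modules and of their morphism groups over the base field\<close>

context right_module
begin

lemma ract_zero: "a \<in> carrier A \<Longrightarrow> \<zero>\<^bsub>M\<^esub> \<cdot>\<^bsub>M\<^esub> a = \<zero>\<^bsub>M\<^esub>"
  using additive_map_zero_minus(1)[of M M "\<lambda>x. x \<cdot>\<^bsub>M\<^esub> a"] ract_closed ract_add_left M.abelian_group_axioms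
  by blast

lemma ract_minus_right: "m \<in> carrier M \<Longrightarrow> a \<in> carrier A \<Longrightarrow> m \<cdot>\<^bsub>M\<^esub> (\<ominus>\<^bsub>A\<^esub> a) = \<ominus>\<^bsub>M\<^esub> (m \<cdot>\<^bsub>M\<^esub> a)"
  using additive_map_zero_minus(2)[of A M "\<lambda>a. m \<cdot>\<^bsub>M\<^esub> a"] ract_closed ract_add_right
    M.abelian_group_axioms A.is_abelian_group
  by blast

end

text \<open>
  A module over a \<open>k\<close>-algebra is a vector space over \<open>k\<close> because \<open>c \<cdot> 1\<close> is a central element of the
  algebra for every scalar \<open>c\<close>.
\<close>

definition scalar_act :: "('k, 'a, 'q) module_scheme \<Rightarrow> ('a, 'm) rmodule \<Rightarrow> 'k \<Rightarrow> 'm \<Rightarrow> 'm" where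
  "scalar_act A M c m = m \<cdot>\<^bsub>M\<^esub> (c \<odot>\<^bsub>A\<^esub> \<one>\<^bsub>A\<^esub>)"

locale module_over_k_algebra = k_algebra K A + right_module A M
  for K :: "('k, 'p) ring_scheme" and A :: "('k, 'a, 'q) module_scheme" and M :: "('a, 'm) rmodule"
begin

lemma scalar_one_closed [simp]: "c \<in> carrier K \<Longrightarrow> c \<odot>\<^bsub>A\<^esub> \<one>\<^bsub>A\<^esub> \<in> carrier A"
  by (simp add: smult_closed)

lemma scalar_central:
  assumes "c \<in> carrier K" "a \<in> carrier A"
  shows "a \<otimes>\<^bsub>A\<^esub> (c \<odot>\<^bsub>A\<^esub> \<one>\<^bsub>A\<^esub>) = c \<odot>\<^bsub>A\<^esub> a" "(c \<odot>\<^bsub>A\<^esub> \<one>\<^bsub>A\<^esub>) \<otimes>\<^bsub>A\<^esub> a = c \<odot>\<^bsub>A\<^esub> a"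
  using assms by (simp_all add: smult_mult_left smult_mult_right)

lemma scalar_act_closed: "c \<in> carrier K \<Longrightarrow> m \<in> carrier M \<Longrightarrow> scalar_act A M c m \<in> carrier M"
  by (simp add: scalar_act_def ract_closed)

lemma scalar_act_add:
  "c \<in> carrier K \<Longrightarrow> m \<in> carrier M \<Longrightarrow> n \<in> carrier M \<Longrightarrow>
    scalar_act A M c (m \<oplus>\<^bsub>M\<^esub> n) = scalar_act A M c m \<oplus>\<^bsub>M\<^esub> scalar_act A M c n"
  by (simp add: scalar_act_def ract_add_left)

lemma scalar_act_add_scalar:
  "c \<in> carrier K \<Longrightarrow> d \<in> carrier K \<Longrightarrow> m \<in> carrier M \<Longrightarrow>
    scalar_act A M (c \<oplus>\<^bsub>K\<^esub> d) m = scalar_act A M c m \<oplus>\<^bsub>M\<^esub> scalar_act A M d m"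
  by (simp add: scalar_act_def smult_l_distr ract_add_right)

lemma scalar_act_mult:
  "c \<in> carrier K \<Longrightarrow> d \<in> carrier K \<Longrightarrow> m \<in> carrier M \<Longrightarrow>
    scalar_act A M c (scalar_act A M d m) = scalar_act A M (d \<otimes>\<^bsub>K\<^esub> c) m"
  using scalar_central(1)[of c "d \<odot>\<^bsub>A\<^esub> \<one>\<^bsub>A\<^esub>"]
  by (simp add: scalar_act_def ract_assoc[symmetric] smult_assoc1[symmetric] K.m_comm)

lemma scalar_act_one: "m \<in> carrier M \<Longrightarrow> scalar_act A M \<one>\<^bsub>K\<^esub> m = m"
  by (simp add: scalar_act_def ract_one smult_one)

lemma scalar_act_ract:
  "c \<in> carrier K \<Longrightarrow> m \<in> carrier M \<Longrightarrow> a \<in> carrier A \<Longrightarrow>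
    scalar_act A M c (m \<cdot>\<^bsub>M\<^esub> a) = scalar_act A M c m \<cdot>\<^bsub>M\<^esub> a"
  "c \<in> carrier K \<Longrightarrow> m \<in> carrier M \<Longrightarrow> a \<in> carrier A \<Longrightarrow>
    m \<cdot>\<^bsub>M\<^esub> (c \<odot>\<^bsub>A\<^esub> a) = scalar_act A M c (m \<cdot>\<^bsub>M\<^esub> a)"
  by (simp_all add: scalar_act_def ract_assoc[symmetric] scalar_central)

lemma scalar_act_zero_minus:
  assumes "m \<in> carrier M"
  shows "scalar_act A M \<zero>\<^bsub>K\<^esub> m = \<zero>\<^bsub>M\<^esub>"
    "c \<in> carrier K \<Longrightarrow> scalar_act A M (\<ominus>\<^bsub>K\<^esub> c) m = \<ominus>\<^bsub>M\<^esub> scalar_act A M c m"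
  using additive_map_zero_minus[of K M "\<lambda>c. scalar_act A M c m"] assms scalar_act_closed
    scalar_act_add_scalar M.abelian_group_axioms K.is_abelian_group by blast+

abbreviation "subspace \<equiv> op_subgroup (carrier K) (scalar_act A M) M"

text \<open>
  Adding the line through \<open>z\<close> to \<open>U\<close> adds at most one dimension. This is where division by scalars is
  needed.
\<close>

lemma finite_length_add_line:
  assumes fl: "finite_length (carrier K) (scalar_act A M) M U" and U: "subspace U"
    and z: "z \<in> carrier M"
  obtains V where "finite_length (carrier K) (scalar_act A M) M V" "subspace V" "insert z U \<subseteq> V"
proof -
  note Uf = additive_subgroup_facts[OF M.abelian_group_axioms, of U]
  have US: "additive_subgroup U M" and actU: "\<And>c x. c \<in> carrier K \<Longrightarrow> x \<in> U \<Longrightarrow> scalar_act A M c x \<in> U"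
    using U by (auto simp: op_subgroup_def)
  define V where "V = {u \<oplus>\<^bsub>M\<^esub> scalar_act A M c z | u c. u \<in> U \<and> c \<in> carrier K}"
  have VI: "u \<oplus>\<^bsub>M\<^esub> scalar_act A M c z \<in> V" if "u \<in> U" "c \<in> carrier K" for u c
    using that by (auto simp: V_def)
  note cl = Uf(3)[OF US] scalar_act_closed z
  have "U \<subseteq> V"
    using VI[of _ "\<zero>\<^bsub>K\<^esub>"] by (auto simp: scalar_act_zero_minus z cl)
  moreover have "z \<in> V"
    using VI[OF Uf(2)[OF US], of "\<one>\<^bsub>K\<^esub>"] by (simp add: scalar_act_one z)
  moreover have V: "subspace V"
    unfolding op_subgroup_def
  proof (intro conjI ballI additive_subgroupI[OF M.abelian_group_axioms])
    show "V \<subseteq> carrier M" by (auto simp: V_def cl)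
    show "\<zero>\<^bsub>M\<^esub> \<in> V" using \<open>U \<subseteq> V\<close> Uf(2)[OF US] by blast
    fix x assume "x \<in> V"
    then obtain u c where x: "x = u \<oplus>\<^bsub>M\<^esub> scalar_act A M c z" "u \<in> U" "c \<in> carrier K" by (auto simp: V_def)
    show "\<ominus>\<^bsub>M\<^esub> x \<in> V"
      using VI[of "\<ominus>\<^bsub>M\<^esub> u" "\<ominus>\<^bsub>K\<^esub> c"] x Uf(5)[OF US] z
      by (simp add: scalar_act_zero_minus cl M.minus_add)
    show "x \<oplus>\<^bsub>M\<^esub> y \<in> V" if y: "y \<in> V" for y
    proof -
      obtain v d where y: "y = v \<oplus>\<^bsub>M\<^esub> scalar_act A M d z" "v \<in> U" "d \<in> carrier K" using y by (auto simp: V_def)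
      show ?thesis
        using VI[of "u \<oplus>\<^bsub>M\<^esub> v" "c \<oplus>\<^bsub>K\<^esub> d"] x y Uf(4)[OF US]
        by (simp add: scalar_act_add_scalar cl M.a_ac)
    qed
    show "scalar_act A M d x \<in> V" if "d \<in> carrier K" for d
      using VI[of "scalar_act A M d u" "c \<otimes>\<^bsub>K\<^esub> d"] x that actU
      by (simp add: scalar_act_add scalar_act_mult cl)
  qed
  moreover have "finite_length (carrier K) (scalar_act A M) M V"
  proof (rule finite_length.step[OF fl U V \<open>U \<subseteq> V\<close>])
    fix x y assume xy: "x \<in> V - U" "y \<in> V"
    obtain u a where x: "x = u \<oplus>\<^bsub>M\<^esub> scalar_act A M a z" "u \<in> U" "a \<in> carrier K" using xy by (auto simp: V_def)
    obtain v b where y: "y = v \<oplus>\<^bsub>M\<^esub> scalar_act A M b z" "v \<in> U" "b \<in> carrier K" using xy by (auto simp: V_def)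
    have "a \<noteq> \<zero>\<^bsub>K\<^esub>" using xy x by (auto simp: scalar_act_zero_minus z cl)
    then have inv: "inv\<^bsub>K\<^esub> a \<in> carrier K" "a \<otimes>\<^bsub>K\<^esub> inv\<^bsub>K\<^esub> a = \<one>\<^bsub>K\<^esub>"
      using x(3) K.field_Units by auto
    \<comment> \<open>With this scalar the multiples of \<open>z\<close> in \<open>y\<close> and in \<open>c x\<close> cancel.\<close>
    define c where "c = inv\<^bsub>K\<^esub> a \<otimes>\<^bsub>K\<^esub> b"
    have c: "c \<in> carrier K" "a \<otimes>\<^bsub>K\<^esub> c = b"
      using inv x y by (auto simp: c_def K.m_assoc[symmetric])
    have "scalar_act A M c x = scalar_act A M c u \<oplus>\<^bsub>M\<^esub> scalar_act A M b z"
      using x c by (simp add: scalar_act_add scalar_act_mult cl)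
    then have "y \<ominus>\<^bsub>M\<^esub> scalar_act A M c x = v \<ominus>\<^bsub>M\<^esub> scalar_act A M c u"
      using y c x(2) by (simp add: a_minus_def M.minus_add cl M.a_ac M.r_neg1 M.r_neg2 M.r_neg)
    then show "\<exists>c\<in>carrier K. y \<ominus>\<^bsub>M\<^esub> scalar_act A M c x \<in> U"
      using c(1) y x Uf(6)[OF US] actU by (intro bexI[of _ c]) auto
  qed
  ultimately show ?thesis by (intro that[of V]) auto
qed

lemma finite_set_in_finite_length:
  assumes "finite T" "T \<subseteq> carrier M"
  obtains V where "finite_length (carrier K) (scalar_act A M) M V" "subspace V" "T \<subseteq> V"
proof -
  have "\<exists>V. finite_length (carrier K) (scalar_act A M) M V \<and> subspace V \<and> T \<subseteq> V"
    using assms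
  proof induction
    case empty
    have "subspace {\<zero>\<^bsub>M\<^esub>}"
      by (auto simp: op_subgroup_def scalar_act_def ract_zero intro!: additive_subgroupI M.abelian_group_axioms)
    then show ?case using finite_length.zero by blast
  next
    case (insert z T)
    then obtain V where "finite_length (carrier K) (scalar_act A M) M V" "subspace V" "T \<subseteq> V" by auto
    then show ?case using finite_length_add_line[of V z] insert.prems by (metis insert_subset subset_trans)
  qed
  then show ?thesis using that by blast
qed

text \<open>
  The products of the finitely many module generators with the finitely many basis elements of the
  algebra span the module over the field.
\<close>

lemma finite_length_carrier:
  assumes "finite_dimensional K A" "finitely_generated A M"
  shows "finite_length (carrier K) (scalar_act A M) M (carrier M)"
proof -
  obtain B where B: "finite B" "B \<subseteq> carrier A"
    "\<And>x. x \<in> carrier A \<Longrightarrow> \<exists>c. c \<in> B \<rightarrow>\<^sub>E carrier K \<and> x = (\<Oplus>\<^bsub>A\<^esub>b\<in>B. c b \<odot>\<^bsub>A\<^esub> b)"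
  proof -
    obtain B where "is_basis K A B" using assms(1) unfolding finite_dimensional_def by blast
    then have b: "finite B \<and> B \<subseteq> carrier A \<and>
      (\<forall>x\<in>carrier A. \<exists>!c. c \<in> B \<rightarrow>\<^sub>E carrier K \<and> x = (\<Oplus>\<^bsub>A\<^esub>b\<in>B. c b \<odot>\<^bsub>A\<^esub> b))"
      unfolding is_basis_def .
    show ?thesis
      using b[THEN conjunct1] b[THEN conjunct2, THEN conjunct1]
        ex1_implies_ex[OF bspec[OF b[THEN conjunct2, THEN conjunct2]]] by (rule that)
  qed
  obtain S where S: "finite S" "S \<subseteq> carrier M"
    "\<And>m. m \<in> carrier M \<Longrightarrow> \<exists>c\<in>S \<rightarrow> carrier A. m = (\<Oplus>\<^bsub>M\<^esub>s\<in>S. s \<cdot>\<^bsub>M\<^esub> c s)"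
    using assms(2) unfolding finitely_generated_def by blast
  obtain V where V: "finite_length (carrier K) (scalar_act A M) M V" "subspace V"
    "(\<lambda>(s, b). s \<cdot>\<^bsub>M\<^esub> b) ` (S \<times> B) \<subseteq> V"
    by (rule finite_set_in_finite_length[of "(\<lambda>(s, b). s \<cdot>\<^bsub>M\<^esub> b) ` (S \<times> B)"])
      (use S(1,2) B(1,2) in \<open>auto intro!: ract_closed\<close>)
  have VS: "additive_subgroup V M" using V(2) by (simp add: op_subgroup_def)
  have sa: "s \<cdot>\<^bsub>M\<^esub> a \<in> V" if sa: "s \<in> S" "a \<in> carrier A" for s a
  proof -
    have s: "s \<in> carrier M" using sa(1) S(2) by blast
    obtain c where c: "c \<in> B \<rightarrow>\<^sub>E carrier K" "a = (\<Oplus>\<^bsub>A\<^esub>b\<in>B. c b \<odot>\<^bsub>A\<^esub> b)" using B(3)[OF sa(2)] by blast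
    have cb: "c b \<in> carrier K" "b \<in> carrier A" if "b \<in> B" for b using c that B(2) by auto
    have "s \<cdot>\<^bsub>M\<^esub> a = (\<Oplus>\<^bsub>M\<^esub>b\<in>B. s \<cdot>\<^bsub>M\<^esub> (c b \<odot>\<^bsub>A\<^esub> b))"
      unfolding c(2) by (rule finsum_hom)
        (use s cb in \<open>auto intro!: ract_closed ract_add_right abelian_group.axioms(1)[OF A.is_abelian_group] M.abelian_group_axioms smult_closed\<close>)
    also have "\<dots> \<in> V"
      by (rule finsum_in_subgroup[OF M.abelian_group_axioms VS])
        (use V(2,3) sa(1) s cb in \<open>auto simp: scalar_act_ract(2) op_subgroup_def\<close>)
    finally show ?thesis .
  qed
  have "carrier M \<subseteq> V"
  proof
    fix m assume "m \<in> carrier M"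
    then obtain c where c: "c \<in> S \<rightarrow> carrier A" "m = (\<Oplus>\<^bsub>M\<^esub>s\<in>S. s \<cdot>\<^bsub>M\<^esub> c s)" using S(3) by blast
    show "m \<in> V" unfolding c(2)
      by (rule finsum_in_subgroup[OF M.abelian_group_axioms VS]) (use c(1) sa in auto)
  qed
  then have "V = carrier M" using additive_subgroup_facts(1)[OF M.abelian_group_axioms VS] by blast
  then show ?thesis using V(1) by simp
qed

end

lemma full_subcat_simps [simp]:
  "obj (full_subcat A C) = C" "ident (full_subcat A C) X = (\<lambda>x\<in>carrier X. x)"
  "carrier (precat.hom (full_subcat A C) X Y) = rmod_hom A X Y"
  "\<zero>\<^bsub>precat.hom (full_subcat A C) X Y\<^esub> = (\<lambda>x\<in>carrier X. \<zero>\<^bsub>Y\<^esub>)"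
  "f \<oplus>\<^bsub>precat.hom (full_subcat A C) X Y\<^esub> g = (\<lambda>x\<in>carrier X. f x \<oplus>\<^bsub>Y\<^esub> g x)"
  "precat.comp (full_subcat A C) X Y Z g f = compose (carrier X) g f"
  by (simp_all add: full_subcat_def)

lemma rmod_homD:
  assumes "f \<in> rmod_hom A M N"
  shows "f \<in> extensional (carrier M)" "x \<in> carrier M \<Longrightarrow> f x \<in> carrier N"
    "x \<in> carrier M \<Longrightarrow> y \<in> carrier M \<Longrightarrow> f (x \<oplus>\<^bsub>M\<^esub> y) = f x \<oplus>\<^bsub>N\<^esub> f y"
    "x \<in> carrier M \<Longrightarrow> a \<in> carrier A \<Longrightarrow> f (x \<cdot>\<^bsub>M\<^esub> a) = f x \<cdot>\<^bsub>N\<^esub> a"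
  using assms by (auto simp: rmod_hom_def PiE_iff)

lemma rmod_hom_zero:
  assumes "right_module A M" "right_module A N" "f \<in> rmod_hom A M N"
  shows "f \<zero>\<^bsub>M\<^esub> = \<zero>\<^bsub>N\<^esub>"
  using additive_map_zero_minus(1)[of M N f] assms rmod_homD[OF assms(3)]
  by (auto simp: right_module_def)

text \<open>
  Hence evaluation at finitely many generators of \<open>X\<close> embeds \<open>Hom(X, Z)\<close> into a finite power of \<open>Z\<close>.
\<close>

lemma rmod_hom_eq_on_generators:
  assumes X: "right_module A X" and Z: "right_module A Z"
    and S: "S \<subseteq> carrier X" "\<And>m. m \<in> carrier X \<Longrightarrow> \<exists>c\<in>S \<rightarrow> carrier A. m = (\<Oplus>\<^bsub>X\<^esub>s\<in>S. s \<cdot>\<^bsub>X\<^esub> c s)"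
    and f: "f \<in> rmod_hom A X Z" "\<And>s. s \<in> S \<Longrightarrow> f s = \<zero>\<^bsub>Z\<^esub>"
  shows "f = (\<lambda>x\<in>carrier X. \<zero>\<^bsub>Z\<^esub>)"
proof (rule extensionalityI[OF rmod_homD(1)[OF f(1)] restrict_extensional])
  interpret X: right_module A X by fact
  interpret Z: right_module A Z by fact
  fix x assume x: "x \<in> carrier X"
  then obtain c where c: "c \<in> S \<rightarrow> carrier A" "x = (\<Oplus>\<^bsub>X\<^esub>s\<in>S. s \<cdot>\<^bsub>X\<^esub> c s)" using S(2) by blast
  have "f x = (\<Oplus>\<^bsub>Z\<^esub>s\<in>S. f (s \<cdot>\<^bsub>X\<^esub> c s))"
    unfolding c(2) by (rule finsum_hom)
      (use S(1) c(1) f(1) in \<open>auto intro!: X.ract_closed X.M.abelian_monoid_axioms Z.M.abelian_group_axioms dest: rmod_homD\<close>)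
  also have "\<dots> = \<zero>\<^bsub>Z\<^esub>"
    using S(1) c(1) f by (intro Z.M.add.finprod_one_eqI) (auto simp: rmod_homD(4)[OF f(1)] Z.ract_zero Pi_iff subset_iff)
  finally show "f x = (\<lambda>x\<in>carrier X. \<zero>\<^bsub>Z\<^esub>) x" using x by simp
qed

definition hom_scalar_act ::
    "('k, 'a, 'q) module_scheme \<Rightarrow> ('a, 'm) rmodule \<Rightarrow> ('a, 'm) rmodule \<Rightarrow> 'k \<Rightarrow> ('m \<Rightarrow> 'm) \<Rightarrow> 'm \<Rightarrow> 'm" where
  "hom_scalar_act A X Z c f = (\<lambda>x\<in>carrier X. scalar_act A Z c (f x))"

lemma scalar_act_rmod_hom:
  assumes "k_algebra K A" "right_module A X" "c \<in> carrier K"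
  shows "(\<lambda>x\<in>carrier X. scalar_act A X c x) \<in> rmod_hom A X X"
proof -
  interpret k_algebra K A by fact
  interpret X: right_module A X by fact
  interpret module_over_k_algebra K A X ..
  show ?thesis using assms(3)
    by (auto simp: rmod_hom_def scalar_act_closed scalar_act_add scalar_act_ract X.ract_closed)
qed

text \<open>
  Scalars act on \<open>Hom(X, Z)\<close> through \<open>End(Z)\<close> as well as through \<open>End(X)\<close>. A subgroup that is closed
  under composition with endomorphisms, on whichever side, is therefore a subspace.
\<close>

lemma hom_scalar_act_eq_compose:
  assumes "f \<in> rmod_hom A X Z" "k_algebra K A" "right_module A X" "c \<in> carrier K"
  shows "hom_scalar_act A X Z c f = compose (carrier X) (\<lambda>z\<in>carrier Z. scalar_act A Z c z) f"
    "hom_scalar_act A X Z c f = compose (carrier X) f (\<lambda>x\<in>carrier X. scalar_act A X c x)"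
proof -
  interpret k_algebra K A by fact
  show "hom_scalar_act A X Z c f = compose (carrier X) (\<lambda>z\<in>carrier Z. scalar_act A Z c z) f"
    using assms by (auto simp: hom_scalar_act_def compose_def restrict_def rmod_homD(2)[OF assms(1)])
  show "hom_scalar_act A X Z c f = compose (carrier X) f (\<lambda>x\<in>carrier X. scalar_act A X c x)"
    using assms rmod_homD(4)[OF assms(1)]
    by (auto simp: hom_scalar_act_def compose_def restrict_def scalar_act_def smult_closed)
qed

text \<open>
  Evaluation at one more generator of \<open>X\<close> at a time: the morphisms in \<open>U\<close> that vanish at \<open>t\<close> are the kernel of
  a linear map from \<open>U\<close> to \<open>Z\<close>, and \<open>Z\<close> has finite length. Morphisms that vanish at all generators are
  zero.
\<close>

lemma finite_length_rmod_hom: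
  assumes alg: "k_algebra K A" "finite_dimensional K A" and X: "X \<in> fg_mod A" and Z: "Z \<in> fg_mod A"
  shows "finite_length (carrier K) (hom_scalar_act A X Z) (precat.hom (full_subcat A C) X Z) (rmod_hom A X Z)"
    (is "finite_length ?K ?act ?H _")
proof -
  have rm: "right_module A X" "right_module A Z" using X Z by (auto simp: fg_mod_def)
  interpret k_algebra K A by fact
  interpret Z: right_module A Z by fact
  interpret module_over_k_algebra K A Z ..
  have H: "abelian_group ?H" by (rule abelian_group_rmod_hom[OF rm])
  have flZ: "finite_length ?K (scalar_act A Z) Z (carrier Z)"
    using finite_length_carrier alg(2) Z by (simp add: fg_mod_def)
  obtain S where S: "finite S" "S \<subseteq> carrier X"
    "\<And>m. m \<in> carrier X \<Longrightarrow> \<exists>c\<in>S \<rightarrow> carrier A. m = (\<Oplus>\<^bsub>X\<^esub>s\<in>S. s \<cdot>\<^bsub>X\<^esub> c s)"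
    using X unfolding fg_mod_def finitely_generated_def by blast
  have act_closed: "?act c f \<in> rmod_hom A X Z" if "c \<in> ?K" "f \<in> rmod_hom A X Z" for c f
    using compose_rmod_hom[OF rm(1) scalar_act_rmod_hom[OF alg(1) rm(1) that(1)] that(2)]
      hom_scalar_act_eq_compose(2)[OF that(2) alg(1) rm(1) that(1)] by simp
  have eval: "finite_length ?K ?act ?H U \<and> op_subgroup ?K ?act ?H U"
    if "finite T" "T \<subseteq> carrier X" "op_subgroup ?K ?act ?H U"
      "finite_length ?K ?act ?H {f \<in> U. \<forall>s\<in>T. f s = \<zero>\<^bsub>Z\<^esub>}" for T U
    using that
  proof (induction T arbitrary: U)
    case empty
    then show ?case by simp
  next
    case (insert t T)
    have t: "t \<in> carrier X" using insert by simp
    note UD = additive_subgroup_facts[OF H, of U]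
    define U1 where "U1 = {f \<in> U. f t \<in> {\<zero>\<^bsub>Z\<^esub>}}"
    have U: "additive_subgroup U ?H" "\<And>c x. c \<in> carrier K \<Longrightarrow> x \<in> U \<Longrightarrow> ?act c x \<in> U"
      using insert.prems(2) by (auto simp: op_subgroup_def)
    have "additive_subgroup U1 ?H" unfolding U1_def
      by (rule additive_subgroup_vimage[OF H Z.M.abelian_group_axioms _ _ U(1)])
        (use t in \<open>auto simp: rmod_homD intro!: additive_subgroupI Z.M.abelian_group_axioms\<close>)
    then have "op_subgroup ?K ?act ?H U1"
      using t U(2) by (auto simp: op_subgroup_def U1_def hom_scalar_act_def scalar_act_def Z.ract_zero smult_closed)
    moreover have "{f \<in> U1. \<forall>s\<in>T. f s = \<zero>\<^bsub>Z\<^esub>} = {f \<in> U. \<forall>s\<in>insert t T. f s = \<zero>\<^bsub>Z\<^esub>}"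
      by (auto simp: U1_def)
    ultimately have ker: "finite_length ?K ?act ?H {f \<in> U. f t = \<zero>\<^bsub>Z\<^esub>}"
      using insert.IH[of U1] insert.prems by (simp add: U1_def)
    have "finite_length ?K ?act ?H {f \<in> U. f t \<in> carrier Z}"
    proof (rule finite_length_vimage[where h = "\<lambda>f. f t", OF H Z.M.abelian_group_axioms _ _ _ insert.prems(2) ker flZ])
      show "?act c f t = scalar_act A Z c (f t)" for c f using t by (simp add: hom_scalar_act_def)
    qed (use t in \<open>auto simp: rmod_homD\<close>)
    moreover have "{f \<in> U. f t \<in> carrier Z} = U" using UD(3)[OF U(1)] t by (auto dest: rmod_homD(2))
    ultimately show ?case using insert.prems(2) by simp
  qed
  have full: "op_subgroup ?K ?act ?H (rmod_hom A X Z)"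
    using act_closed abelian_group.a_inv_closed[OF H] abelian_monoid.zero_closed[of ?H]
      abelian_monoid.a_closed[of ?H] H
    by (auto simp: op_subgroup_def abelian_group_def intro!: additive_subgroupI[OF H])
  have "{f \<in> rmod_hom A X Z. \<forall>s\<in>S. f s = \<zero>\<^bsub>Z\<^esub>} = {\<zero>\<^bsub>?H\<^esub>}"
    using rmod_hom_eq_on_generators[OF rm S(2,3)] abelian_monoid.zero_closed[of ?H] H S(2)
    by (auto simp: abelian_group_def)
  then show ?thesis using eval[OF S(1,2) full] finite_length.zero[of ?K ?act ?H] by simp
qed


section \<open>Graded submodules of the ring of a preadditive category\<close>

text \<open>
  The ideal \<open>[\<X>]\<close> of the category: the finite sums of morphisms that factor through an object of \<open>\<X>\<close>. The
  identity of \<open>M\<close> belongs to it as soon as \<open>M\<close> is a direct sum of objects of \<open>\<X>\<close>, namely as the sum of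
  the composites of projections and inclusions. Membership of the identity is
  a condition symmetric in left and right, and it makes sense in any preadditive category.
\<close>

inductive_set factoring :: "('o, 'h) precat \<Rightarrow> 'o set \<Rightarrow> 'o \<Rightarrow> 'o \<Rightarrow> 'h set"
  for C :: "('o, 'h) precat" and \<X> :: "'o set" and M N :: 'o where
  zero: "\<zero>\<^bsub>precat.hom C M N\<^esub> \<in> factoring C \<X> M N"
| through: "X \<in> \<X> \<Longrightarrow> f \<in> carrier (precat.hom C M X) \<Longrightarrow> g \<in> carrier (precat.hom C X N) \<Longrightarrow>
    precat.comp C M X N g f \<in> factoring C \<X> M N"
| add: "f \<in> factoring C \<X> M N \<Longrightarrow> g \<in> factoring C \<X> M N \<Longrightarrow>
    f \<oplus>\<^bsub>precat.hom C M N\<^esub> g \<in> factoring C \<X> M N"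

context preadditive_category
begin

lemma factoring_closed:
  assumes "\<X> \<subseteq> obj C" "M \<in> obj C" "N \<in> obj C" "h \<in> factoring C \<X> M N"
  shows "h \<in> carrier (H M N)"
  using assms(4,1-3) by induction (auto intro!: hom_zero_closed hom_add_closed comp_closed)

lemma factoring_comp_left:
  assumes "\<X> \<subseteq> obj C" "M \<in> obj C" "N \<in> obj C" "N' \<in> obj C"
    "h \<in> factoring C \<X> M N" "g \<in> carrier (H N N')"
  shows "cmp M N N' g h \<in> factoring C \<X> M N'"
  using assms(5)
proof induction
  case zero
  then show ?case using assms by (simp add: comp_zero_right factoring.zero)
next
  case (through X f k)
  have "X \<in> obj C" using through assms(1) by blast
  then show ?case
    using through assms factoring.through[of X \<X> f C M "cmp X N N' g k" N']
    by (simp add: comp_assoc[symmetric] comp_closed)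
next
  case (add f k)
  then show ?case using assms factoring_closed[OF assms(1-3)] by (simp add: comp_add_right factoring.add)
qed

lemma factoring_comp_right:
  assumes "\<X> \<subseteq> obj C" "M' \<in> obj C" "M \<in> obj C" "N \<in> obj C"
    "h \<in> factoring C \<X> M N" "f \<in> carrier (H M' M)"
  shows "cmp M' M N h f \<in> factoring C \<X> M' N"
  using assms(5)
proof induction
  case zero
  then show ?case using assms by (simp add: comp_zero_left factoring.zero)
next
  case (through X k g)
  have "X \<in> obj C" using through assms(1) by blast
  then show ?case
    using through assms factoring.through[of X \<X> "cmp M' M X k f" C M' g N]
    by (simp add: comp_assoc comp_closed)
next
  case (add g k)
  then show ?case using assms factoring_closed[OF assms(1,3,4)] by (simp add: comp_add_left factoring.add)
qed

abbreviation \<Gamma> where "\<Gamma> \<equiv> pair_groupoid (obj C)"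

lemma arrows_objects: "arrows \<Gamma> = obj C \<times> obj C" "gobj \<Gamma> = {(X, X) | X. X \<in> obj C}"
  by (auto simp: pair_groupoid_def gobj_def)

lemma hone_R: "hone R (X, X) = single C (X, X) (ident C X)"
  by (simp add: cat_ring_def)

text \<open>
  A homogeneously spanned subgroup \<open>N\<close> of the ring is the same as a family of subgroups of the morphism
  groups. The object \<open>X\<close> is the domain here, so the degree of \<open>component N X Y\<close> is \<open>(Y, X)\<close>.
\<close>

definition component :: "('o \<times> 'o \<Rightarrow> 'h) set \<Rightarrow> 'o \<Rightarrow> 'o \<Rightarrow> 'h set" where
  "component N X Y = {f \<in> carrier (H X Y). single C (Y, X) f \<in> N}"

lemma component_mono: "N \<subseteq> N' \<Longrightarrow> component N X Y \<subseteq> component N' X Y"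
  by (auto simp: component_def)

lemma component_subgroup:
  assumes "X \<in> obj C" "Y \<in> obj C" "additive_subgroup N R"
  shows "additive_subgroup (component N X Y) (H X Y)"
proof -
  interpret XY: abelian_group "H X Y" by (rule hom_group) fact+
  have "single C (Y, X) (f \<oplus>\<^bsub>H X Y\<^esub> g) = single C (Y, X) f \<oplus>\<^bsub>R\<^esub> single C (Y, X) g" for f g
    by (rule R_eqI) (auto simp: hom_zero_closed abelian_monoid.l_zero[OF hom_monoid])
  then show ?thesis unfolding component_def
    by (intro additive_subgroup_vimage[OF XY.abelian_group_axioms abelian_group_R])
      (use assms in \<open>auto intro!: single_closed additive_subgroupI XY.abelian_group_axioms\<close>)
qed

lemma component_comp_right:
  assumes "X' \<in> obj C" "X \<in> obj C" "Y \<in> obj C" "\<forall>\<phi>\<in>N. \<forall>r\<in>carrier R. \<phi> \<otimes>\<^bsub>R\<^esub> r \<in> N"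
    "f \<in> component N X Y" "g \<in> carrier (H X' X)"
  shows "cmp X' X Y f g \<in> component N X' Y"
proof -
  have "single C (Y, X) f \<otimes>\<^bsub>R\<^esub> single C (X, X') g \<in> N"
    using assms by (auto simp: component_def intro!: single_closed)
  then show ?thesis using assms by (auto simp: component_def single_mult comp_closed)
qed

lemma component_comp_left:
  assumes "X \<in> obj C" "Y \<in> obj C" "Y' \<in> obj C" "\<forall>\<phi>\<in>N. \<forall>r\<in>carrier R. r \<otimes>\<^bsub>R\<^esub> \<phi> \<in> N"
    "f \<in> component N X Y" "g \<in> carrier (H Y Y')"
  shows "cmp X Y Y' g f \<in> component N X Y'"
proof -
  have "single C (Y', Y) g \<otimes>\<^bsub>R\<^esub> single C (Y, X) f \<in> N"
    using assms by (auto simp: component_def intro!: single_closed)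
  then show ?thesis using assms by (auto simp: component_def single_mult comp_closed)
qed

lemma subset_if_components_subset:
  assumes N: "homogeneously_spanned \<Gamma> R N" and N': "additive_subgroup N' R"
    and le: "\<And>X Y. X \<in> obj C \<Longrightarrow> Y \<in> obj C \<Longrightarrow> component N X Y \<subseteq> component N' X Y"
  shows "N \<subseteq> N'"
proof
  fix \<phi> assume "\<phi> \<in> N"
  then have ex: "\<exists>F c. finite F \<and> F \<subseteq> arrows \<Gamma> \<and> (\<forall>\<gamma>\<in>F. c \<gamma> \<in> N \<inter> hcomp R \<gamma>) \<and> \<phi> = (\<Oplus>\<^bsub>R\<^esub>\<gamma>\<in>F. c \<gamma>)"
    by (rule bspec[OF N[unfolded homogeneously_spanned_def]])
  from ex obtain F c where F: "F \<subseteq> arrows \<Gamma>" "\<forall>\<gamma>\<in>F. c \<gamma> \<in> N \<inter> hcomp R \<gamma>" "\<phi> = (\<Oplus>\<^bsub>R\<^esub>\<gamma>\<in>F. c \<gamma>)"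
    by (elim exE conjE)
  show "\<phi> \<in> N'" unfolding F(3)
  proof (rule finsum_in_subgroup[OF abelian_group_R N'])
    fix \<gamma> assume g: "\<gamma> \<in> F"
    obtain Y X where YX: "\<gamma> = (Y, X)" "X \<in> obj C" "Y \<in> obj C" using g F(1) by (auto simp: arrows_objects)
    have "c \<gamma> \<in> single C (Y, X) ` carrier (H X Y)"
      using bspec[OF F(2) g] unfolding YX(1) hcomp_R[symmetric] by simp
    then obtain f where "f \<in> carrier (H X Y)" "c \<gamma> = single C (Y, X) f" by blast
    then show "c \<gamma> \<in> N'" using le[OF YX(2,3)] bspec[OF F(2) g] by (auto simp: component_def)
  qed
qed

text \<open>
  Multiplication by \<open>1\<^sub>e\<close> from the left is the identity on \<open>1\<^sub>e R\<close>, and it annihilates the components whose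
  codomain is not \<open>Z\<close>.
\<close>

lemma right_component_off_row:
  assumes "Z \<in> obj C" "X \<in> obj C" "Y \<in> obj C" "Y \<noteq> Z" "N \<subseteq> right_part R (Z, Z)"
    "f \<in> component N X Y"
  shows "single C (Y, X) f = \<zero>\<^bsub>R\<^esub>"
proof -
  have f: "f \<in> carrier (H X Y)" "single C (Y, X) f \<in> right_part R (Z, Z)"
    using assms by (auto simp: component_def)
  then obtain \<psi> where \<psi>: "\<psi> \<in> carrier R" "single C (Y, X) f = hone R (Z, Z) \<otimes>\<^bsub>R\<^esub> \<psi>"
    by (auto simp: right_part_def)
  have h: "hone R (Z, Z) \<in> carrier R" "hone R (Z, Z) \<otimes>\<^bsub>R\<^esub> hone R (Z, Z) = hone R (Z, Z)"
    using assms(1) by (simp_all add: hone_R single_closed single_mult ident_closed ident_left)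
  have "single C (Y, X) f = hone R (Z, Z) \<otimes>\<^bsub>R\<^esub> single C (Y, X) f"
    using h \<psi> by (simp add: R_mult_assoc[symmetric])
  also have "\<dots> = \<zero>\<^bsub>R\<^esub>" using assms f(1) by (simp add: hone_R single_mult ident_closed)
  finally show ?thesis .
qed

lemma left_component_off_column:
  assumes "Z \<in> obj C" "X \<in> obj C" "Y \<in> obj C" "X \<noteq> Z" "N \<subseteq> left_part R (Z, Z)"
    "f \<in> component N X Y"
  shows "single C (Y, X) f = \<zero>\<^bsub>R\<^esub>"
proof -
  have f: "f \<in> carrier (H X Y)" "single C (Y, X) f \<in> left_part R (Z, Z)"
    using assms by (auto simp: component_def)
  then obtain \<psi> where \<psi>: "\<psi> \<in> carrier R" "single C (Y, X) f = \<psi> \<otimes>\<^bsub>R\<^esub> hone R (Z, Z)"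
    by (auto simp: left_part_def)
  have h: "hone R (Z, Z) \<in> carrier R" "hone R (Z, Z) \<otimes>\<^bsub>R\<^esub> hone R (Z, Z) = hone R (Z, Z)"
    using assms(1) by (simp_all add: hone_R single_closed single_mult ident_closed ident_left)
  have "single C (Y, X) f = single C (Y, X) f \<otimes>\<^bsub>R\<^esub> hone R (Z, Z)"
    using h \<psi> by (simp add: R_mult_assoc)
  also have "\<dots> = \<zero>\<^bsub>R\<^esub>" using assms f(1) by (simp add: hone_R single_mult ident_closed)
  finally show ?thesis .
qed

text \<open>
  If a summand of \<open>h\<close> is \<open>i \<circ> p\<close>, where \<open>p : M \<rightarrow> X\<close> and \<open>i : X \<rightarrow> M\<close>, then \<open>f \<circ> i\<close> lies in the component of \<open>N\<close>
  at \<open>X\<close>, hence in that of \<open>N'\<close>, and so \<open>f \<circ> i \<circ> p\<close> lies in the component of \<open>N'\<close> at \<open>M\<close>. For the identity in place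
  of \<open>h\<close> this shows that the components at \<open>\<X>\<close> determine all others.
\<close>

lemma comp_factoring_in_component:
  assumes "\<X> \<subseteq> obj C" "M \<in> obj C" "Z \<in> obj C" "additive_subgroup N' R"
    and N: "\<forall>\<phi>\<in>N. \<forall>r\<in>carrier R. \<phi> \<otimes>\<^bsub>R\<^esub> r \<in> N" and N': "\<forall>\<phi>\<in>N'. \<forall>r\<in>carrier R. \<phi> \<otimes>\<^bsub>R\<^esub> r \<in> N'"
    and le: "\<And>X. X \<in> \<X> \<Longrightarrow> component N X Z \<subseteq> component N' X Z"
    and f: "f \<in> component N M Z" and h: "h \<in> factoring C \<X> M M"
  shows "cmp M M Z f h \<in> component N' M Z"
proof -
  note sub = additive_subgroup_facts[OF hom_group[OF assms(2,3)] component_subgroup[OF assms(2-4)]]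
  have f': "f \<in> carrier (H M Z)" using f by (simp add: component_def)
  from h show ?thesis
  proof induction
    case zero
    then show ?case using sub(2) f' assms by (simp add: comp_zero_right)
  next
    case (through X p i)
    have X: "X \<in> obj C" using through assms(1) by blast
    have "cmp X M Z f i \<in> component N X Z"
      using component_comp_right[OF X assms(2,3) N f] through by blast
    then have "cmp M X Z (cmp X M Z f i) p \<in> component N' M Z"
      using component_comp_right[OF assms(2) X assms(3) N'] le through by blast
    then show ?case using comp_assoc[OF assms(2) X assms(2,3)] through f' by simp
  next
    case (add g k)
    then show ?case
      using sub(4) f' assms factoring_closed[OF assms(1,2,2)] by (simp add: comp_add_right)
  qed
qed

lemma factoring_comp_in_component:
  assumes "\<X> \<subseteq> obj C" "M \<in> obj C" "Z \<in> obj C" "additive_subgroup N' R"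
    and N: "\<forall>\<phi>\<in>N. \<forall>r\<in>carrier R. r \<otimes>\<^bsub>R\<^esub> \<phi> \<in> N" and N': "\<forall>\<phi>\<in>N'. \<forall>r\<in>carrier R. r \<otimes>\<^bsub>R\<^esub> \<phi> \<in> N'"
    and le: "\<And>X. X \<in> \<X> \<Longrightarrow> component N Z X \<subseteq> component N' Z X"
    and f: "f \<in> component N Z M" and h: "h \<in> factoring C \<X> M M"
  shows "cmp Z M M h f \<in> component N' Z M"
proof -
  note sub = additive_subgroup_facts[OF hom_group[OF assms(3,2)] component_subgroup[OF assms(3,2,4)]]
  have f': "f \<in> carrier (H Z M)" using f by (simp add: component_def)
  from h show ?thesis
  proof induction
    case zero
    then show ?case using sub(2) f' assms by (simp add: comp_zero_left)
  next
    case (through X p i)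
    have X: "X \<in> obj C" using through assms(1) by blast
    have "cmp Z M X p f \<in> component N Z X"
      using component_comp_left[OF assms(3,2) X N f] through by blast
    then have "cmp Z X M i (cmp Z M X p f) \<in> component N' Z M"
      using component_comp_left[OF assms(3) X assms(2) N'] le through by blast
    then show ?case using comp_assoc[OF assms(3,2) X assms(2)] through f' by simp
  next
    case (add g k)
    then show ?case
      using sub(4) f' assms factoring_closed[OF assms(1,2,2)] by (simp add: comp_add_left)
  qed
qed

text \<open>
  A graded submodule of \<open>1\<^sub>e R\<close> with \<open>e = (Z, Z)\<close> is determined by its components of degree \<open>(Z, X)\<close> with
  \<open>X \<in> \<X>\<close>, which are \<open>End(X)\<close>-submodules of \<open>Hom(X, Z)\<close>.
\<close>

lemma bounded_rank_right_submodules: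
  assumes "finite \<X>" "\<X> \<subseteq> obj C" "\<And>M. M \<in> obj C \<Longrightarrow> ident C M \<in> factoring C \<X> M M" "Z \<in> obj C"
    and Q: "\<And>X. X \<in> \<X> \<Longrightarrow> bounded_rank (\<lambda>W. additive_subgroup W (H X Z) \<and>
      (\<forall>f\<in>W. \<forall>g\<in>carrier (H X X). cmp X X Z f g \<in> W))"
  shows "bounded_rank (graded_right_submodule \<Gamma> R (Z, Z))"
proof (rule bounded_rank_product[where t = "\<lambda>X N. component N X Z" and X = \<X> and
    Q = "\<lambda>X W. additive_subgroup W (H X Z) \<and> (\<forall>f\<in>W. \<forall>g\<in>carrier (H X X). cmp X X Z f g \<in> W)"])
  show "finite \<X>" by fact
  show "component N X Z \<subseteq> component N' X Z" if "N \<subseteq> N'" for X N N'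
    using that by (rule component_mono)
  show "additive_subgroup (component N X Z) (H X Z) \<and>
      (\<forall>f\<in>component N X Z. \<forall>g\<in>carrier (H X X). cmp X X Z f g \<in> component N X Z)"
    if XN: "X \<in> \<X>" "graded_right_submodule \<Gamma> R (Z, Z) N" for X N
  proof (intro conjI ballI)
    have X: "X \<in> obj C" using XN(1) assms(2) by (rule rev_subsetD)
    show "additive_subgroup (component N X Z) (H X Z)"
      using XN(2) by (intro component_subgroup[OF X assms(4)]) (simp add: graded_right_submodule_def)
    show "cmp X X Z f g \<in> component N X Z" if "f \<in> component N X Z" "g \<in> carrier (H X X)" for f g
      by (rule component_comp_right[OF X X assms(4)]) (use XN(2) that in \<open>simp_all add: graded_right_submodule_def\<close>)
  qed
  fix N N'
  assume "graded_right_submodule \<Gamma> R (Z, Z) N" "graded_right_submodule \<Gamma> R (Z, Z) N'"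
    and eq: "\<And>X. X \<in> \<X> \<Longrightarrow> component N' X Z = component N X Z"
  then have N: "additive_subgroup N R" "\<forall>\<phi>\<in>N. \<forall>r\<in>carrier R. \<phi> \<otimes>\<^bsub>R\<^esub> r \<in> N"
    and N': "\<forall>\<phi>\<in>N'. \<forall>r\<in>carrier R. \<phi> \<otimes>\<^bsub>R\<^esub> r \<in> N'" "homogeneously_spanned \<Gamma> R N'" "N' \<subseteq> right_part R (Z, Z)"
    by (simp_all add: graded_right_submodule_def)
  show "N' \<subseteq> N"
  proof (rule subset_if_components_subset[OF N'(2) N(1)], rule subsetI)
    fix X Y f assume XY: "X \<in> obj C" "Y \<in> obj C" and f: "f \<in> component N' X Y"
    then have fH: "f \<in> carrier (H X Y)" by (simp add: component_def)
    show "f \<in> component N X Y"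
    proof (cases "Y = Z")
      case True
      have "cmp X X Y f (ident C X) \<in> component N X Y"
        by (rule comp_factoring_in_component[OF assms(2) XY N(1) N'(1) N(2) _ f assms(3)[OF XY(1)]])
          (use eq True in blast)
      then show ?thesis using fH XY by (simp add: ident_right)
    next
      case False
      then show ?thesis
        using right_component_off_row[OF assms(4) XY False N'(3) f] fH
          additive_subgroup_facts(2)[OF abelian_group_R N(1)] by (simp add: component_def)
    qed
  qed
qed (rule Q)

text \<open>
  Dually, the components of degree \<open>(X, Z)\<close> with \<open>X \<in> \<X>\<close> determine a graded left submodule.
\<close>

lemma bounded_rank_left_submodules:
  assumes "finite \<X>" "\<X> \<subseteq> obj C" "\<And>M. M \<in> obj C \<Longrightarrow> ident C M \<in> factoring C \<X> M M" "Z \<in> obj C"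
    and Q: "\<And>X. X \<in> \<X> \<Longrightarrow> bounded_rank (\<lambda>W. additive_subgroup W (H Z X) \<and>
      (\<forall>f\<in>W. \<forall>g\<in>carrier (H X X). cmp Z X X g f \<in> W))"
  shows "bounded_rank (graded_left_submodule \<Gamma> R (Z, Z))"
proof (rule bounded_rank_product[where t = "\<lambda>X N. component N Z X" and X = \<X> and
    Q = "\<lambda>X W. additive_subgroup W (H Z X) \<and> (\<forall>f\<in>W. \<forall>g\<in>carrier (H X X). cmp Z X X g f \<in> W)"])
  show "finite \<X>" by fact
  show "component N Z X \<subseteq> component N' Z X" if "N \<subseteq> N'" for X N N'
    using that by (rule component_mono)
  show "additive_subgroup (component N Z X) (H Z X) \<and>
      (\<forall>f\<in>component N Z X. \<forall>g\<in>carrier (H X X). cmp Z X X g f \<in> component N Z X)"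
    if XN: "X \<in> \<X>" "graded_left_submodule \<Gamma> R (Z, Z) N" for X N
  proof (intro conjI ballI)
    have X: "X \<in> obj C" using XN(1) assms(2) by (rule rev_subsetD)
    show "additive_subgroup (component N Z X) (H Z X)"
      using XN(2) by (intro component_subgroup[OF assms(4) X]) (simp add: graded_left_submodule_def)
    show "cmp Z X X g f \<in> component N Z X" if "f \<in> component N Z X" "g \<in> carrier (H X X)" for f g
      by (rule component_comp_left[OF assms(4) X X]) (use XN(2) that in \<open>simp_all add: graded_left_submodule_def\<close>)
  qed
  fix N N'
  assume "graded_left_submodule \<Gamma> R (Z, Z) N" "graded_left_submodule \<Gamma> R (Z, Z) N'"
    and eq: "\<And>X. X \<in> \<X> \<Longrightarrow> component N' Z X = component N Z X"
  then have N: "additive_subgroup N R" "\<forall>\<phi>\<in>N. \<forall>r\<in>carrier R. r \<otimes>\<^bsub>R\<^esub> \<phi> \<in> N"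
    and N': "\<forall>\<phi>\<in>N'. \<forall>r\<in>carrier R. r \<otimes>\<^bsub>R\<^esub> \<phi> \<in> N'" "homogeneously_spanned \<Gamma> R N'" "N' \<subseteq> left_part R (Z, Z)"
    by (simp_all add: graded_left_submodule_def)
  show "N' \<subseteq> N"
  proof (rule subset_if_components_subset[OF N'(2) N(1)], rule subsetI)
    fix X Y f assume XY: "X \<in> obj C" "Y \<in> obj C" and f: "f \<in> component N' X Y"
    then have fH: "f \<in> carrier (H X Y)" by (simp add: component_def)
    show "f \<in> component N X Y"
    proof (cases "X = Z")
      case True
      have "cmp X Y Y (ident C Y) f \<in> component N X Y"
        by (rule factoring_comp_in_component[OF assms(2) XY(2,1) N(1) N'(1) N(2) _ f assms(3)[OF XY(2)]])
          (use eq True in blast)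
      then show ?thesis using fH XY by (simp add: ident_left)
    next
      case False
      then show ?thesis
        using left_component_off_column[OF assms(4) XY False N'(3) f] fH
          additive_subgroup_facts(2)[OF abelian_group_R N(1)] by (simp add: component_def)
    qed
  qed
qed (rule Q)

end

text \<open>
  The rank of \<open>End(X)\<close>-submodules that the two preceding lemmas ask for is the dimension over \<open>K\<close>, by
  \<open>hom_scalar_act_eq_compose\<close>.
\<close>

lemma chain_conditions_if_identities_factor:
  assumes alg: "k_algebra K A" "finite_dimensional K A" and C: "C \<subseteq> fg_mod A"
    and X: "finite \<X>" "\<X> \<subseteq> C"
    and fac: "\<And>M. M \<in> C \<Longrightarrow> (\<lambda>x\<in>carrier M. x) \<in> factoring (full_subcat A C) \<X> M M"
  defines "G \<equiv> pair_groupoid C" and "R \<equiv> cat_ring (full_subcat A C)"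
  shows "left_obj_artinian G R \<and> right_obj_artinian G R \<and> left_obj_noetherian G R \<and> right_obj_noetherian G R"
proof -
  interpret preadditive_category "full_subcat A C" by (rule preadditive_full_subcat[OF C])
  have rm: "right_module A X" if "X \<in> C" for X using that C by (auto simp: fg_mod_def)
  have rank: "bounded_rank (\<lambda>W. additive_subgroup W (H X Y) \<and> (\<forall>f\<in>W. \<forall>c\<in>carrier K. hom_scalar_act A X Y c f \<in> W))"
    if XY: "X \<in> C" "Y \<in> C" for X Y
  proof (rule bounded_rank_subclass[OF bounded_rank_if_finite_length])
    show H: "abelian_group (H X Y)" using XY by (intro hom_group) auto
    show "finite_length (carrier K) (hom_scalar_act A X Y) (H X Y) (rmod_hom A X Y)"
      using finite_length_rmod_hom[OF alg] XY C by blast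
    show "op_subgroup (carrier K) (hom_scalar_act A X Y) (H X Y) W \<and> W \<subseteq> rmod_hom A X Y"
      if "additive_subgroup W (H X Y) \<and> (\<forall>f\<in>W. \<forall>c\<in>carrier K. hom_scalar_act A X Y c f \<in> W)" for W
      using that additive_subgroup_facts(1)[OF H] by (auto simp: op_subgroup_def)
  qed
  have sub: "f \<in> rmod_hom A X Y" if "f \<in> W" "additive_subgroup W (H X Y)" "X \<in> C" "Y \<in> C" for f W X Y
    using additive_subgroup_facts(3)[OF hom_group that(2,1)] that by simp
  have "bounded_rank (graded_right_submodule G R (Z, Z))" if Z: "Z \<in> C" for Z
  proof -
    have "bounded_rank (graded_right_submodule \<Gamma> (cat_ring (full_subcat A C)) (Z, Z))"
    proof (rule bounded_rank_right_submodules[OF X(1)])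
      fix X assume "X \<in> \<X>"
      then have X: "X \<in> C" using X(2) by blast
      show "bounded_rank (\<lambda>W. additive_subgroup W (H X Z) \<and>
          (\<forall>f\<in>W. \<forall>g\<in>carrier (H X X). cmp X X Z f g \<in> W))"
      proof (rule bounded_rank_subclass[OF rank[OF X Z]], intro conjI ballI)
        fix W f c assume W: "additive_subgroup W (H X Z) \<and>
            (\<forall>f\<in>W. \<forall>g\<in>carrier (H X X). cmp X X Z f g \<in> W)" and f: "f \<in> W" and c: "c \<in> carrier K"
        have "compose (carrier X) f (\<lambda>x\<in>carrier X. scalar_act A X c x) \<in> W"
          using W f scalar_act_rmod_hom[OF alg(1) rm[OF X] c] by simp
        then show "hom_scalar_act A X Z c f \<in> W"
          using hom_scalar_act_eq_compose(2)[OF sub[OF f _ X Z] alg(1) rm[OF X] c] W by simp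
      qed blast
    qed (use X fac Z in auto)
    then show ?thesis by (simp add: G_def R_def)
  qed
  moreover have "bounded_rank (graded_left_submodule G R (Z, Z))" if Z: "Z \<in> C" for Z
  proof -
    have "bounded_rank (graded_left_submodule \<Gamma> (cat_ring (full_subcat A C)) (Z, Z))"
    proof (rule bounded_rank_left_submodules[OF X(1)])
      fix X assume "X \<in> \<X>"
      then have X: "X \<in> C" using X(2) by blast
      show "bounded_rank (\<lambda>W. additive_subgroup W (H Z X) \<and>
          (\<forall>f\<in>W. \<forall>g\<in>carrier (H X X). cmp Z X X g f \<in> W))"
      proof (rule bounded_rank_subclass[OF rank[OF Z X]], intro conjI ballI)
        fix W f c assume W: "additive_subgroup W (H Z X) \<and>
            (\<forall>f\<in>W. \<forall>g\<in>carrier (H X X). cmp Z X X g f \<in> W)" and f: "f \<in> W" and c: "c \<in> carrier K"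
        have "compose (carrier Z) (\<lambda>x\<in>carrier X. scalar_act A X c x) f \<in> W"
          using W f scalar_act_rmod_hom[OF alg(1) rm[OF X] c] by simp
        then show "hom_scalar_act A Z X c f \<in> W"
          using hom_scalar_act_eq_compose(1)[OF sub[OF f _ Z X] alg(1) rm[OF Z] c] W by simp
      qed blast
    qed (use X fac Z in auto)
    then show ?thesis by (simp add: G_def R_def)
  qed
  ultimately show ?thesis
    unfolding left_obj_artinian_def right_obj_artinian_def left_obj_noetherian_def right_obj_noetherian_def
    by (auto simp: G_def pair_groupoid_def gobj_def intro: desc_chain_cond_if_bounded_rank asc_chain_cond_if_bounded_rank)
qed


section \<open>Identities that factor through a set of objects\<close>

lemma rmod_isomorphism_inverse:
  assumes M: "right_module A M" and iso: "rmod_isomorphic A M N"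
  obtains f g where "f \<in> rmod_hom A M N" "g \<in> rmod_hom A N M"
    "\<And>x. x \<in> carrier M \<Longrightarrow> g (f x) = x" "\<And>y. y \<in> carrier N \<Longrightarrow> f (g y) = y"
proof -
  interpret M: right_module A M by fact
  obtain f where f: "f \<in> rmod_hom A M N" "bij_betw f (carrier M) (carrier N)"
    using iso unfolding rmod_isomorphic_def by blast
  define g where "g = (\<lambda>y\<in>carrier N. inv_into (carrier M) f y)"
  note fD = rmod_homD[OF f(1)]
  have g: "g y \<in> carrier M" "f (g y) = y" if "y \<in> carrier N" for y
    using that f(2) by (auto simp: g_def bij_betw_def inv_into_into f_inv_into_f)
  have gf: "g (f x) = x" if "x \<in> carrier M" for x
    using that f(2) fD(2) by (auto simp: g_def bij_betw_def)
  have "g (y \<oplus>\<^bsub>N\<^esub> z) = g y \<oplus>\<^bsub>M\<^esub> g z" if "y \<in> carrier N" "z \<in> carrier N" for y z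
    using gf[of "g y \<oplus>\<^bsub>M\<^esub> g z"] fD(3)[of "g y" "g z"] g that by simp
  moreover have "g (y \<cdot>\<^bsub>N\<^esub> a) = g y \<cdot>\<^bsub>M\<^esub> a" if "y \<in> carrier N" "a \<in> carrier A" for y a
    using gf[of "g y \<cdot>\<^bsub>M\<^esub> a"] fD(4)[of "g y" a] g that by (simp add: M.ract_closed)
  ultimately have "g \<in> rmod_hom A N M"
    using g(1) unfolding rmod_hom_def by (auto simp: g_def)
  then show ?thesis using f(1) gf g(2) by (intro that)
qed

lemma rmod_isomorphicI:
  assumes "f \<in> rmod_hom A M N" "g \<in> rmod_hom A N M"
    "\<And>x. x \<in> carrier M \<Longrightarrow> g (f x) = x" "\<And>y. y \<in> carrier N \<Longrightarrow> f (g y) = y"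
  shows "rmod_isomorphic A M N"
  unfolding rmod_isomorphic_def
  by (intro bexI[OF _ assms(1)] bij_betw_byWitness[where f' = g])
    (use assms(3,4) rmod_homD(2)[OF assms(1)] rmod_homD(2)[OF assms(2)] in auto)

lemma rmod_isomorphic_sym: "right_module A M \<Longrightarrow> rmod_isomorphic A M N \<Longrightarrow> rmod_isomorphic A N M"
  by (metis rmod_isomorphism_inverse rmod_isomorphicI)

lemma identity_rmod_hom: "right_module A M \<Longrightarrow> (\<lambda>x\<in>carrier M. x) \<in> rmod_hom A M M"
  using right_module.ract_closed[of A M] abelian_monoid.a_closed[of M]
  by (auto simp: rmod_hom_def right_module_def abelian_group_def)

lemma rmod_isomorphic_refl: "right_module A M \<Longrightarrow> rmod_isomorphic A M M"
  by (rule rmod_isomorphicI[OF identity_rmod_hom identity_rmod_hom]) auto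

text \<open>
  The direct sum need not be an object of \<open>C\<close>, and its elements even have a different type; only the
  composites of its projections and inclusions with the given isomorphism \<open>\<phi>\<close> and its inverse \<open>\<psi>\<close>
  are used. The partial sums of the products of these projections and inclusions are the maps that
  truncate \<open>\<phi> x\<close> after the first \<open>k\<close> coordinates.
\<close>

lemma identity_factors_if_direct_sum:
  assumes C: "C \<subseteq> fg_mod A" "\<X> \<subseteq> C" "M \<in> C" and Ms: "Ms \<in> lists \<X>"
    and iso: "rmod_isomorphic A M (direct_sum Ms)"
  shows "(\<lambda>x\<in>carrier M. x) \<in> factoring (full_subcat A C) \<X> M M"
proof -
  have M: "right_module A M" using C by (auto simp: fg_mod_def)
  interpret M: right_module A M by fact
  let ?n = "length Ms" and ?D = "direct_sum Ms"
  have Ds [simp]: "carrier ?D = (\<Pi>\<^sub>E i\<in>{..<?n}. carrier (Ms ! i))"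
    "\<And>x y. x \<oplus>\<^bsub>?D\<^esub> y = (\<lambda>i\<in>{..<?n}. x i \<oplus>\<^bsub>Ms ! i\<^esub> y i)"
    "\<And>x a. x \<cdot>\<^bsub>?D\<^esub> a = (\<lambda>i\<in>{..<?n}. x i \<cdot>\<^bsub>Ms ! i\<^esub> a)"
    by (simp_all add: direct_sum_def)
  obtain \<phi> \<psi> where \<phi>: "\<phi> \<in> rmod_hom A M ?D" and \<psi>: "\<psi> \<in> rmod_hom A ?D M"
    and inv: "\<And>x. x \<in> carrier M \<Longrightarrow> \<psi> (\<phi> x) = x"
    using rmod_isomorphism_inverse[OF M iso] by metis
  have X: "Ms ! i \<in> \<X>" if "i < ?n" for i using Ms that by (auto simp: in_lists_conv_set)
  have Mi: "right_module A (Ms ! i)" if "i < ?n" for i using X[OF that] C by (auto simp: fg_mod_def)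
  have ab: "abelian_group (Ms ! i)" if "i < ?n" for i using Mi[OF that] by (simp add: right_module_def)
  note zero = abelian_group.axioms(1)[OF ab, THEN abelian_monoid.zero_closed]
    and l0 = abelian_group.axioms(1)[OF ab, THEN abelian_monoid.l_zero]
    and r0 = abelian_group.axioms(1)[OF ab, THEN abelian_monoid.r_zero]
    and acl = abelian_group.axioms(1)[OF ab, THEN abelian_monoid.a_closed]
  note az = right_module.ract_zero[OF Mi] right_module.ract_closed[OF Mi]
  have \<phi>i: "\<phi> x i \<in> carrier (Ms ! i)" if "x \<in> carrier M" "i < ?n" for x i
    using rmod_homD(2)[OF \<phi> that(1)] that(2) by auto
  \<comment> \<open>\<open>tr P x\<close> keeps the coordinates in \<open>P\<close>; applied to a constant family it is the inclusion of a summand.\<close>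
  define tr where "tr P x = (\<lambda>j\<in>{..<?n}. if P j then x j else \<zero>\<^bsub>Ms ! j\<^esub>)" for P :: "nat \<Rightarrow> bool" and x
  have tr: "tr P x \<in> carrier ?D" if "\<And>j. j < ?n \<Longrightarrow> P j \<Longrightarrow> x j \<in> carrier (Ms ! j)" for P x
    using that zero by (auto simp: tr_def)
  have proj: "(\<lambda>x\<in>carrier M. \<phi> x i) \<in> rmod_hom A M (Ms ! i)" if i: "i < ?n" for i
    using i rmod_homD(2-4)[OF \<phi>] by (auto simp: rmod_hom_def M.ract_closed)
  have incl: "(\<lambda>y\<in>carrier (Ms ! i). \<psi> (tr (\<lambda>j. j = i) (\<lambda>_. y))) \<in> rmod_hom A (Ms ! i) M" if i: "i < ?n" for i
  proof -
    have "tr (\<lambda>j. j = i) (\<lambda>_. y \<oplus>\<^bsub>Ms ! i\<^esub> z) = tr (\<lambda>j. j = i) (\<lambda>_. y) \<oplus>\<^bsub>?D\<^esub> tr (\<lambda>j. j = i) (\<lambda>_. z)" for y z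
      using zero l0 by (auto simp: tr_def fun_eq_iff)
    moreover have "tr (\<lambda>j. j = i) (\<lambda>_. y \<cdot>\<^bsub>Ms ! i\<^esub> a) = tr (\<lambda>j. j = i) (\<lambda>_. y) \<cdot>\<^bsub>?D\<^esub> a" if "a \<in> carrier A" for y a
      using az that by (auto simp: tr_def fun_eq_iff)
    moreover have "tr (\<lambda>j. j = i) (\<lambda>_. y) \<in> carrier ?D" if "y \<in> carrier (Ms ! i)" for y
      by (rule tr) (use that in simp)
    ultimately show ?thesis
      using i acl az rmod_homD(2-4)[OF \<psi>] by (auto simp: rmod_hom_def simp del: Ds)
  qed
  have "(\<lambda>x\<in>carrier M. \<psi> (tr (\<lambda>j. j < k) (\<phi> x))) \<in> factoring (full_subcat A C) \<X> M M" if "k \<le> ?n" for k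
    using that
  proof (induction k)
    case 0
    have "\<psi> (tr (\<lambda>j. j < 0) (\<phi> x)) = \<zero>\<^bsub>M\<^esub>" for x
    proof -
      have t: "tr (\<lambda>j. j < 0) (\<phi> x) \<in> carrier ?D" by (rule tr) simp
      have "tr (\<lambda>j. j < 0) (\<phi> x) \<oplus>\<^bsub>?D\<^esub> tr (\<lambda>j. j < 0) (\<phi> x) = tr (\<lambda>j. j < 0) (\<phi> x)"
        using zero l0 by (auto simp: tr_def fun_eq_iff)
      then show ?thesis
        using rmod_homD(2)[OF \<psi> t] rmod_homD(3)[OF \<psi> t t] by (metis M.M.add.l_cancel_one M.M.add.r_cancel_one)
    qed
    then have eq: "(\<lambda>x\<in>carrier M. \<psi> (tr (\<lambda>j. j < 0) (\<phi> x))) = (\<lambda>x\<in>carrier M. \<zero>\<^bsub>M\<^esub>)"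
      by (simp only:)
    show ?case
      using factoring.zero[of "full_subcat A C" M M \<X>] unfolding eq full_subcat_simps .
  next
    case (Suc k)
    then have k: "k < ?n" by simp
    let ?p = "\<lambda>x\<in>carrier M. \<phi> x k" and ?i = "\<lambda>y\<in>carrier (Ms ! k). \<psi> (tr (\<lambda>j. j = k) (\<lambda>_. y))"
    have "compose (carrier M) ?i ?p \<in> factoring (full_subcat A C) \<X> M M"
      using factoring.through[OF X[OF k], of ?p "full_subcat A C" M ?i M] proj[OF k] incl[OF k] by simp
    from factoring.add[OF Suc.IH this]
    have "(\<lambda>x\<in>carrier M. \<psi> (tr (\<lambda>j. j < k) (\<phi> x)) \<oplus>\<^bsub>M\<^esub> \<psi> (tr (\<lambda>j. j = k) (\<lambda>_. \<phi> x k)))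
        \<in> factoring (full_subcat A C) \<X> M M" (is "?l \<in> _")
      using k by (simp add: compose_def \<phi>i cong: restrict_cong)
    also have "?l = (\<lambda>x\<in>carrier M. \<psi> (tr (\<lambda>j. j < Suc k) (\<phi> x)))"
    proof (rule restrict_ext)
      fix x assume x: "x \<in> carrier M"
      have "tr (\<lambda>j. j < Suc k) (\<phi> x) = tr (\<lambda>j. j < k) (\<phi> x) \<oplus>\<^bsub>?D\<^esub> tr (\<lambda>j. j = k) (\<lambda>_. \<phi> x k)"
        using \<phi>i[OF x] zero l0 r0 by (auto simp: tr_def fun_eq_iff)
      moreover have t1: "tr (\<lambda>j. j < k) (\<phi> x) \<in> carrier ?D" by (rule tr) (rule \<phi>i[OF x])
      moreover have t2: "tr (\<lambda>j. j = k) (\<lambda>_. \<phi> x k) \<in> carrier ?D" by (rule tr) (use \<phi>i[OF x k] in simp)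
      ultimately show "\<psi> (tr (\<lambda>j. j < k) (\<phi> x)) \<oplus>\<^bsub>M\<^esub> \<psi> (tr (\<lambda>j. j = k) (\<lambda>_. \<phi> x k)) = \<psi> (tr (\<lambda>j. j < Suc k) (\<phi> x))"
        using rmod_homD(3)[OF \<psi> t1 t2] by (simp del: Ds)
    qed
    finally show ?case .
  qed
  from this[of ?n] have "(\<lambda>x\<in>carrier M. \<psi> (tr (\<lambda>j. j < ?n) (\<phi> x))) \<in> factoring (full_subcat A C) \<X> M M" by simp
  moreover have "tr (\<lambda>j. j < ?n) (\<phi> x) = \<phi> x" if "x \<in> carrier M" for x
    using rmod_homD(2)[OF \<phi> that] by (auto simp: tr_def fun_eq_iff PiE_iff extensional_def)
  ultimately show ?thesis by (simp add: inv cong: restrict_cong)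
qed

text \<open>
  A factorisation through \<open>X\<close> can be rerouted through any isomorphic object. The categories \<open>C\<close> and \<open>D\<close>
  may differ, since the morphisms between two modules do not depend on the full subcategory.
\<close>

lemma factoring_isomorphic_objects:
  assumes M: "right_module A M" and X: "\<And>X. X \<in> \<I> \<Longrightarrow> right_module A X" "\<And>Y. Y \<in> \<X> \<Longrightarrow> right_module A Y"
    and iso: "\<And>X. X \<in> \<I> \<Longrightarrow> \<exists>Y\<in>\<X>. rmod_isomorphic A X Y"
    and h: "h \<in> factoring (full_subcat A D) \<I> M N"
  shows "h \<in> factoring (full_subcat A C) \<X> M N"
  using h
proof induction
  case zero
  show ?case using factoring.zero[of "full_subcat A C" M N \<X>] unfolding full_subcat_simps .
next
  case (through X f g)
  obtain Y where Y: "Y \<in> \<X>" "rmod_isomorphic A X Y"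
    using iso[OF through(1)] by blast
  obtain i j where i: "i \<in> rmod_hom A X Y" and j: "j \<in> rmod_hom A Y X"
    and ji: "\<And>x. x \<in> carrier X \<Longrightarrow> j (i x) = x"
    using rmod_isomorphism_inverse[OF X(1)[OF through(1)] Y(2)] by metis
  have fg: "f \<in> rmod_hom A M X" "g \<in> rmod_hom A X N" using through by simp_all
  have gj: "compose (carrier Y) g j \<in> rmod_hom A Y N"
    by (rule compose_rmod_hom[OF X(2)[OF Y(1)] j fg(2)])
  have "compose (carrier M) (compose (carrier Y) g j) (compose (carrier M) i f) \<in> factoring (full_subcat A C) \<X> M N"
    using factoring.through[OF Y(1), of "compose (carrier M) i f" "full_subcat A C" M "compose (carrier Y) g j" N]
      compose_rmod_hom[OF M fg(1) i] gj by simp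
  also have "compose (carrier M) (compose (carrier Y) g j) (compose (carrier M) i f) = compose (carrier M) g f"
    using rmod_homD(2)[OF fg(1)] rmod_homD(2)[OF i] ji by (auto simp: compose_def fun_eq_iff)
  finally show ?case by simp
next
  case (add f g)
  show ?case using factoring.add[OF add.IH] unfolding full_subcat_simps .
qed


section \<open>Decomposition into indecomposable modules\<close>

text \<open>
  Closure under negatives comes from \<open>- x = x \<cdot> (- 1)\<close>.
\<close>

lemma rsubmodule_iff:
  assumes "right_module A M"
  shows "rsubmodule A M N \<longleftrightarrow> N \<subseteq> carrier M \<and> \<zero>\<^bsub>M\<^esub> \<in> N \<and> (\<forall>x\<in>N. \<forall>y\<in>N. x \<oplus>\<^bsub>M\<^esub> y \<in> N) \<and>
    (\<forall>x\<in>N. \<forall>a\<in>carrier A. x \<cdot>\<^bsub>M\<^esub> a \<in> N)" (is "_ \<longleftrightarrow> ?R")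
proof -
  interpret right_module A M by fact
  show ?thesis
  proof
    assume "rsubmodule A M N"
    then show ?R using additive_subgroup_facts[OF M.abelian_group_axioms, of N] by (auto simp: rsubmodule_def)
  next
    assume N: ?R
    have "\<ominus>\<^bsub>M\<^esub> x \<in> N" if "x \<in> N" for x
    proof -
      have "x \<cdot>\<^bsub>M\<^esub> (\<ominus>\<^bsub>A\<^esub> \<one>\<^bsub>A\<^esub>) \<in> N" using N that by simp
      moreover have "x \<in> carrier M" using N that by blast
      ultimately show ?thesis by (simp add: ract_minus_right ract_one)
    qed
    then show "rsubmodule A M N"
      using N by (auto simp: rsubmodule_def intro!: additive_subgroupI M.abelian_group_axioms)
  qed
qed

lemma right_module_rsubmodule:
  assumes M: "right_module A M" and N: "rsubmodule A M N"
  shows "right_module A (M\<lparr>carrier := N\<rparr>)"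
proof -
  interpret right_module A M by fact
  have S: "additive_subgroup N M" using N by (simp add: rsubmodule_def)
  note Nf = additive_subgroup_facts[OF M.abelian_group_axioms S]
  have "abelian_group (M\<lparr>carrier := N\<rparr>)"
  proof (rule abelian_groupI)
    fix x assume "x \<in> carrier (M\<lparr>carrier := N\<rparr>)"
    then show "\<exists>y\<in>carrier (M\<lparr>carrier := N\<rparr>). y \<oplus>\<^bsub>M\<lparr>carrier := N\<rparr>\<^esub> x = \<zero>\<^bsub>M\<lparr>carrier := N\<rparr>\<^esub>"
      by (intro bexI[of _ "\<ominus>\<^bsub>M\<^esub> x"]) (simp_all add: Nf M.l_neg)
  qed (use Nf in \<open>auto simp: M.a_ac\<close>)
  then show ?thesis
    using N Nf(3) by (intro right_module.intro right_module_axioms.intro A.ring_axioms)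
      (auto simp: rsubmodule_iff[OF M] ract_add_left ract_add_right ract_assoc ract_one)
qed

lemma rsubmodule_of_rsubmodule:
  assumes M: "right_module A M" and N: "rsubmodule A M N" and L: "rsubmodule A (M\<lparr>carrier := N\<rparr>) L"
  shows "rsubmodule A M L" "L \<subseteq> N"
  using rsubmodule_iff[OF right_module_rsubmodule[OF M N], of L] N L rsubmodule_iff[OF M] by auto

lemma complement_projections:
  assumes M: "right_module A M" and N: "rsubmodule A M N" and P: "rsubmodule A M P"
    and sum: "N <+>\<^bsub>M\<^esub> P = carrier M" and int: "N \<inter> P = {\<zero>\<^bsub>M\<^esub>}"
  obtains p q where "p \<in> rmod_hom A M (M\<lparr>carrier := N\<rparr>)" "q \<in> rmod_hom A M (M\<lparr>carrier := P\<rparr>)"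
    "\<And>x. x \<in> carrier M \<Longrightarrow> x = p x \<oplus>\<^bsub>M\<^esub> q x" "p ` carrier M = N" "q ` carrier M = P"
proof -
  interpret right_module A M by fact
  have NS: "additive_subgroup N M" and PS: "additive_subgroup P M" using N P by (simp_all add: rsubmodule_def)
  note Nf = additive_subgroup_facts[OF M.abelian_group_axioms NS]
    and Pf = additive_subgroup_facts[OF M.abelian_group_axioms PS]
  have uniq: "y = y' \<and> z = z'"
    if yz: "y \<in> N" "y' \<in> N" "z \<in> P" "z' \<in> P" "y \<oplus>\<^bsub>M\<^esub> z = y' \<oplus>\<^bsub>M\<^esub> z'" for y y' z z'
  proof -
    have c: "y \<in> carrier M" "y' \<in> carrier M" "z \<in> carrier M" "z' \<in> carrier M" using yz by (simp_all add: Nf(3) Pf(3))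
    have "(y \<ominus>\<^bsub>M\<^esub> y') \<oplus>\<^bsub>M\<^esub> (z \<ominus>\<^bsub>M\<^esub> z') = (y \<oplus>\<^bsub>M\<^esub> z) \<ominus>\<^bsub>M\<^esub> (y' \<oplus>\<^bsub>M\<^esub> z')"
      using c by (simp add: a_minus_def M.minus_add M.a_ac)
    also have "\<dots> = \<zero>\<^bsub>M\<^esub>" using c yz(5) by (simp add: a_minus_def M.r_neg)
    finally have 0: "(y \<ominus>\<^bsub>M\<^esub> y') \<oplus>\<^bsub>M\<^esub> (z \<ominus>\<^bsub>M\<^esub> z') = \<zero>\<^bsub>M\<^esub>" .
    then have eq: "\<ominus>\<^bsub>M\<^esub> (z \<ominus>\<^bsub>M\<^esub> z') = y \<ominus>\<^bsub>M\<^esub> y'" using c by (intro M.minus_equality) auto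
    then have "y \<ominus>\<^bsub>M\<^esub> y' \<in> N \<inter> P" using Nf(6)[OF yz(1,2)] Pf(5)[OF Pf(6)[OF yz(3,4)]] unfolding eq by blast
    then have y: "y \<ominus>\<^bsub>M\<^esub> y' = \<zero>\<^bsub>M\<^esub>" using int by blast
    then have "z \<ominus>\<^bsub>M\<^esub> z' = \<zero>\<^bsub>M\<^esub>" using 0 c by simp
    then show ?thesis
      using y c M.minus_equality[of y "\<ominus>\<^bsub>M\<^esub> y'"] M.minus_equality[of z "\<ominus>\<^bsub>M\<^esub> z'"]
      by (simp add: a_minus_def)
  qed
  have "\<exists>y z. y \<in> N \<and> z \<in> P \<and> x = y \<oplus>\<^bsub>M\<^esub> z" if "x \<in> carrier M" for x
    using that unfolding sum[symmetric] by (auto simp: set_add_defs)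
  then obtain p q where pq: "\<And>x. x \<in> carrier M \<Longrightarrow> p x \<in> N" "\<And>x. x \<in> carrier M \<Longrightarrow> q x \<in> P"
    "\<And>x. x \<in> carrier M \<Longrightarrow> x = p x \<oplus>\<^bsub>M\<^esub> q x"
    by metis
  have pqI: "p x = y \<and> q x = z" if "y \<in> N" "z \<in> P" "x = y \<oplus>\<^bsub>M\<^esub> z" for x y z
  proof -
    have "x \<in> carrier M" using that Nf(3) Pf(3) by simp
    then show ?thesis using uniq[of "p x" y "q x" z] pq that by metis
  qed
  have add: "p (x \<oplus>\<^bsub>M\<^esub> y) = p x \<oplus>\<^bsub>M\<^esub> p y \<and> q (x \<oplus>\<^bsub>M\<^esub> y) = q x \<oplus>\<^bsub>M\<^esub> q y"
    if xy: "x \<in> carrier M" "y \<in> carrier M" for x y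
  proof (rule pqI)
    note c = pq(1,2)[OF xy(1)] pq(1,2)[OF xy(2)]
    have "x \<oplus>\<^bsub>M\<^esub> y = (p x \<oplus>\<^bsub>M\<^esub> q x) \<oplus>\<^bsub>M\<^esub> (p y \<oplus>\<^bsub>M\<^esub> q y)" using pq(3) xy by metis
    then show "x \<oplus>\<^bsub>M\<^esub> y = (p x \<oplus>\<^bsub>M\<^esub> p y) \<oplus>\<^bsub>M\<^esub> (q x \<oplus>\<^bsub>M\<^esub> q y)"
      using c Nf(3) Pf(3) by (simp add: M.a_ac)
  qed (use xy in \<open>simp_all add: pq Nf(4) Pf(4)\<close>)
  have act: "p (x \<cdot>\<^bsub>M\<^esub> a) = p x \<cdot>\<^bsub>M\<^esub> a \<and> q (x \<cdot>\<^bsub>M\<^esub> a) = q x \<cdot>\<^bsub>M\<^esub> a"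
    if x: "x \<in> carrier M" "a \<in> carrier A" for x a
  proof (rule pqI)
    have "x \<cdot>\<^bsub>M\<^esub> a = (p x \<oplus>\<^bsub>M\<^esub> q x) \<cdot>\<^bsub>M\<^esub> a" using pq(3) x by metis
    then show "x \<cdot>\<^bsub>M\<^esub> a = p x \<cdot>\<^bsub>M\<^esub> a \<oplus>\<^bsub>M\<^esub> q x \<cdot>\<^bsub>M\<^esub> a"
      using pq(1,2)[OF x(1)] x Nf(3) Pf(3) by (simp add: ract_add_left)
  qed (use x pq N P in \<open>auto simp: rsubmodule_iff[OF M]\<close>)
  have pN: "p x = x" if "x \<in> N" for x using pqI[of x "\<zero>\<^bsub>M\<^esub>"] that Nf(3) Pf(2) by simp
  have qP: "q x = x" if "x \<in> P" for x using pqI[of "\<zero>\<^bsub>M\<^esub>" x] that Pf(3) Nf(2) by simp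
  show ?thesis
  proof (rule that[of "restrict p (carrier M)" "restrict q (carrier M)"])
    show "restrict p (carrier M) \<in> rmod_hom A M (M\<lparr>carrier := N\<rparr>)"
      "restrict q (carrier M) \<in> rmod_hom A M (M\<lparr>carrier := P\<rparr>)"
      using pq(1,2) add act by (auto simp: rmod_hom_def ract_closed)
    show "x = restrict p (carrier M) x \<oplus>\<^bsub>M\<^esub> restrict q (carrier M) x" if "x \<in> carrier M" for x
      using pq(3)[OF that] that by simp
    show "restrict p (carrier M) ` carrier M = N"
      using pq(1) pN Nf(3) by (force simp: image_iff)
    show "restrict q (carrier M) ` carrier M = P"
      using pq(2) qP Pf(3) by (force simp: image_iff)
  qed
qed

text \<open>
  Collects the coefficients of equal elements. It is needed for the images of generators under a
  homomorphism that identifies some of them.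
\<close>

lemma (in right_module) regroup_coefficients:
  assumes T: "finite T" "T \<subseteq> carrier M" and S: "finite S" "f \<in> S \<rightarrow> T" "c \<in> S \<rightarrow> carrier A"
  shows "\<exists>d\<in>T \<rightarrow> carrier A. (\<Oplus>\<^bsub>M\<^esub>s\<in>S. f s \<cdot>\<^bsub>M\<^esub> c s) = (\<Oplus>\<^bsub>M\<^esub>t\<in>T. t \<cdot>\<^bsub>M\<^esub> d t)"
  using S
proof induction
  case empty
  have "t \<cdot>\<^bsub>M\<^esub> \<zero>\<^bsub>A\<^esub> = \<zero>\<^bsub>M\<^esub>" if "t \<in> T" for t
    using additive_map_zero_minus(1)[of A M "\<lambda>a. t \<cdot>\<^bsub>M\<^esub> a"] ract_closed ract_add_right that T(2)
      M.abelian_group_axioms A.is_abelian_group by blast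
  then have "(\<Oplus>\<^bsub>M\<^esub>t\<in>T. t \<cdot>\<^bsub>M\<^esub> \<zero>\<^bsub>A\<^esub>) = \<zero>\<^bsub>M\<^esub>" by (intro M.add.finprod_one_eqI) auto
  then show ?case by (intro bexI[of _ "\<lambda>_. \<zero>\<^bsub>A\<^esub>"]) auto
next
  case (insert s S)
  then obtain d where d: "d \<in> T \<rightarrow> carrier A" "(\<Oplus>\<^bsub>M\<^esub>s\<in>S. f s \<cdot>\<^bsub>M\<^esub> c s) = (\<Oplus>\<^bsub>M\<^esub>t\<in>T. t \<cdot>\<^bsub>M\<^esub> d t)"
    by auto
  have fs: "f s \<in> T" "c s \<in> carrier A" using insert.prems by auto
  have cl: "t \<cdot>\<^bsub>M\<^esub> d t \<in> carrier M" "t \<cdot>\<^bsub>M\<^esub> c s \<in> carrier M" if "t \<in> T" for t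
    using that T(2) d(1) fs by (auto intro!: ract_closed)
  have "(\<Oplus>\<^bsub>M\<^esub>s\<in>insert s S. f s \<cdot>\<^bsub>M\<^esub> c s) = f s \<cdot>\<^bsub>M\<^esub> c s \<oplus>\<^bsub>M\<^esub> (\<Oplus>\<^bsub>M\<^esub>t\<in>T. t \<cdot>\<^bsub>M\<^esub> d t)"
    unfolding d(2)[symmetric]
    by (rule M.finsum_insert) (use insert T(2) in \<open>auto intro!: ract_closed\<close>)
  also have "f s \<cdot>\<^bsub>M\<^esub> c s = (\<Oplus>\<^bsub>M\<^esub>t\<in>T. if f s = t then t \<cdot>\<^bsub>M\<^esub> c s else \<zero>\<^bsub>M\<^esub>)"
    by (rule M.finsum_singleton[symmetric]) (use fs T(1) cl in auto)
  also have "\<dots> \<oplus>\<^bsub>M\<^esub> (\<Oplus>\<^bsub>M\<^esub>t\<in>T. t \<cdot>\<^bsub>M\<^esub> d t)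
      = (\<Oplus>\<^bsub>M\<^esub>t\<in>T. (if f s = t then t \<cdot>\<^bsub>M\<^esub> c s else \<zero>\<^bsub>M\<^esub>) \<oplus>\<^bsub>M\<^esub> t \<cdot>\<^bsub>M\<^esub> d t)"
    by (rule M.finsum_addf[symmetric]) (use cl in auto)
  also have "\<dots> = (\<Oplus>\<^bsub>M\<^esub>t\<in>T. t \<cdot>\<^bsub>M\<^esub> (if f s = t then c s \<oplus>\<^bsub>A\<^esub> d t else d t))"
    by (rule M.finsum_cong') (use T(2) fs d(1) in \<open>auto simp: Pi_iff subset_iff intro!: ract_closed ract_add_right[symmetric] M.l_zero\<close>)
  finally show ?case
    using d(1) fs by (intro bexI[of _ "\<lambda>t. if f s = t then c s \<oplus>\<^bsub>A\<^esub> d t else d t"]) (auto simp: Pi_iff)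
qed

lemma fg_mod_image:
  assumes M: "M \<in> fg_mod A" and N: "right_module A N"
    and f: "f \<in> rmod_hom A M N" "f ` carrier M = carrier N"
  shows "N \<in> fg_mod A"
proof -
  interpret M: right_module A M using M by (simp add: fg_mod_def)
  interpret N: right_module A N by fact
  note fD = rmod_homD[OF f(1)]
  obtain S where S: "finite S" "S \<subseteq> carrier M"
    "\<And>m. m \<in> carrier M \<Longrightarrow> \<exists>c\<in>S \<rightarrow> carrier A. m = (\<Oplus>\<^bsub>M\<^esub>s\<in>S. s \<cdot>\<^bsub>M\<^esub> c s)"
    using M unfolding fg_mod_def finitely_generated_def by blast
  have "\<exists>d\<in>f ` S \<rightarrow> carrier A. n = (\<Oplus>\<^bsub>N\<^esub>t\<in>f ` S. t \<cdot>\<^bsub>N\<^esub> d t)" if n: "n \<in> carrier N" for n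
  proof -
    obtain m where m: "m \<in> carrier M" "n = f m" using n f(2) by blast
    obtain c where c: "c \<in> S \<rightarrow> carrier A" "m = (\<Oplus>\<^bsub>M\<^esub>s\<in>S. s \<cdot>\<^bsub>M\<^esub> c s)" using S(3)[OF m(1)] by blast
    have "n = (\<Oplus>\<^bsub>N\<^esub>s\<in>S. f (s \<cdot>\<^bsub>M\<^esub> c s))" unfolding m(2) c(2)
      by (rule finsum_hom)
        (use S(2) c(1) fD in \<open>auto intro!: M.ract_closed M.M.abelian_monoid_axioms N.M.abelian_group_axioms\<close>)
    also have "\<dots> = (\<Oplus>\<^bsub>N\<^esub>s\<in>S. f s \<cdot>\<^bsub>N\<^esub> c s)"
      by (rule N.M.finsum_cong') (use S(2) c(1) fD in \<open>auto intro!: N.ract_closed simp: Pi_iff subset_iff\<close>)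
    finally show ?thesis
      using N.regroup_coefficients[of "f ` S" S f c] S(1,2) c(1) fD(2) by auto
  qed
  moreover have "finite (f ` S)" "f ` S \<subseteq> carrier N" using S(1,2) fD(2) by auto
  ultimately have "finitely_generated A N" unfolding finitely_generated_def by blast
  then show ?thesis using N by (simp add: fg_mod_def)
qed

lemma indecomposable_isomorphic:
  assumes M: "right_module A M" and N: "right_module A N" and iso: "rmod_isomorphic A M N"
    and ind: "indecomposable A M"
  shows "indecomposable A N"
proof -
  interpret M: right_module A M by fact
  interpret N: right_module A N by fact
  obtain f g where f: "f \<in> rmod_hom A M N" and g: "g \<in> rmod_hom A N M"
    and gf: "\<And>x. x \<in> carrier M \<Longrightarrow> g (f x) = x" and fg: "\<And>y. y \<in> carrier N \<Longrightarrow> f (g y) = y"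
    using rmod_isomorphism_inverse[OF M iso] by metis
  note fD = rmod_homD[OF f] and gD = rmod_homD[OF g]
  have f0: "f \<zero>\<^bsub>M\<^esub> = \<zero>\<^bsub>N\<^esub>" by (rule rmod_hom_zero[OF M N f])
  have g0: "g \<zero>\<^bsub>N\<^esub> = \<zero>\<^bsub>M\<^esub>" by (rule rmod_hom_zero[OF N M g])
  have sub: "rsubmodule A M (g ` L)" if "rsubmodule A N L" for L
    unfolding rsubmodule_iff[OF M]
  proof (intro conjI ballI)
    have L: "L \<subseteq> carrier N" "\<zero>\<^bsub>N\<^esub> \<in> L" "\<And>x y. x \<in> L \<Longrightarrow> y \<in> L \<Longrightarrow> x \<oplus>\<^bsub>N\<^esub> y \<in> L"
      "\<And>x a. x \<in> L \<Longrightarrow> a \<in> carrier A \<Longrightarrow> x \<cdot>\<^bsub>N\<^esub> a \<in> L"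
      using that by (auto simp: rsubmodule_iff[OF N])
    show "g ` L \<subseteq> carrier M" using L(1) gD(2) by blast
    show "\<zero>\<^bsub>M\<^esub> \<in> g ` L" using L(2) g0 by force
    fix x assume "x \<in> g ` L"
    then obtain l where l: "l \<in> L" "x = g l" by blast
    show "x \<oplus>\<^bsub>M\<^esub> y \<in> g ` L" if y: "y \<in> g ` L" for y
    proof -
      obtain k where k: "k \<in> L" "y = g k" using y by blast
      have "x \<oplus>\<^bsub>M\<^esub> y = g (l \<oplus>\<^bsub>N\<^esub> k)"
        unfolding l(2) k(2) using L(1) l(1) k(1) by (intro gD(3)[symmetric]) auto
      then show ?thesis using L(3)[OF l(1) k(1)] by blast
    qed
    show "x \<cdot>\<^bsub>M\<^esub> a \<in> g ` L" if a: "a \<in> carrier A" for a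
    proof -
      have "x \<cdot>\<^bsub>M\<^esub> a = g (l \<cdot>\<^bsub>N\<^esub> a)"
        unfolding l(2) using L(1) l(1) a by (intro gD(4)[symmetric]) auto
      then show ?thesis using L(4)[OF l(1) a] by blast
    qed
  qed
  show ?thesis
    unfolding indecomposable_def
  proof (intro conjI allI impI)
    show "carrier N \<noteq> {\<zero>\<^bsub>N\<^esub>}"
    proof
      assume "carrier N = {\<zero>\<^bsub>N\<^esub>}"
      then have "x = \<zero>\<^bsub>M\<^esub>" if "x \<in> carrier M" for x
        using gf[OF that] fD(2)[OF that] g0 by simp
      then have "carrier M = {\<zero>\<^bsub>M\<^esub>}" by blast
      then show False using ind by (simp add: indecomposable_def)
    qed
    fix L P assume LP: "rsubmodule A N L \<and> rsubmodule A N P \<and> L <+>\<^bsub>N\<^esub> P = carrier N \<and> L \<inter> P = {\<zero>\<^bsub>N\<^esub>}"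
    have c: "L \<subseteq> carrier N" "P \<subseteq> carrier N" using LP by (simp_all add: rsubmodule_iff[OF N])
    have s: "rsubmodule A M (g ` L)" "rsubmodule A M (g ` P)" using sub LP by blast+
    have "g ` L <+>\<^bsub>M\<^esub> g ` P = carrier M"
    proof
      show "g ` L <+>\<^bsub>M\<^esub> g ` P \<subseteq> carrier M" using s by (auto simp: set_add_defs rsubmodule_iff[OF M])
      show "carrier M \<subseteq> g ` L <+>\<^bsub>M\<^esub> g ` P"
      proof
        fix x assume x: "x \<in> carrier M"
        then have "f x \<in> L <+>\<^bsub>N\<^esub> P" using fD(2) LP by simp
        then obtain l p where lp: "l \<in> L" "p \<in> P" "f x = l \<oplus>\<^bsub>N\<^esub> p" by (auto simp: set_add_defs)
        then have "x = g l \<oplus>\<^bsub>M\<^esub> g p" using gf[OF x] gD(3)[of l p] subsetD[OF c(1) lp(1)] subsetD[OF c(2) lp(2)] by simp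
        then show "x \<in> g ` L <+>\<^bsub>M\<^esub> g ` P" using lp by (auto simp: set_add_defs)
      qed
    qed
    moreover have "g ` L \<inter> g ` P = {\<zero>\<^bsub>M\<^esub>}"
    proof -
      have "inj_on g (carrier N)" by (rule inj_on_inverseI[of _ f]) (rule fg)
      then have "g ` L \<inter> g ` P = g ` (L \<inter> P)" by (rule inj_on_image_Int[OF _ c, symmetric])
      then show ?thesis using LP g0 by simp
    qed
    ultimately have "g ` L = {\<zero>\<^bsub>M\<^esub>} \<or> g ` P = {\<zero>\<^bsub>M\<^esub>}"
      using ind s unfolding indecomposable_def by blast
    moreover have "L = f ` g ` L" "P = f ` g ` P" using c fg by (force simp: image_image)+
    ultimately show "L = {\<zero>\<^bsub>N\<^esub>} \<or> P = {\<zero>\<^bsub>N\<^esub>}" using f0 by (metis image_empty image_insert)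
  qed
qed


lemma right_module_if_fg_mod: "M \<in> fg_mod A \<Longrightarrow> right_module A M"
  by (simp add: fg_mod_def)

text \<open>
  The existence part of the Krull-Schmidt theorem, in the form needed here. Submodules \<open>N\<close> of \<open>M\<close> are
  split by induction on their rank: if \<open>N\<close> is the direct sum of proper submodules \<open>L\<close> and \<open>P\<close>, then its
  identity is the sum of two morphisms that factor through the identities of \<open>L\<close> and \<open>P\<close>. The
  summands are arbitrary modules, so the argument takes place in the category of all finitely
  generated modules.
\<close>

lemma identity_factors_through_indecomposables:
  fixes K :: "('k, 'p) ring_scheme" and A :: "('k, 'a, 'q) module_scheme" and M :: "('a, 'b) rmodule"
  assumes alg: "k_algebra K A" "finite_dimensional K A" and M: "M \<in> fg_mod A"
  shows "(\<lambda>x\<in>carrier M. x) \<in> factoring (full_subcat A (fg_mod A)) {X \<in> fg_mod A. indecomposable A X} M M"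
proof -
  let ?D = "full_subcat A (fg_mod A) :: (('a, 'b) rmodule, 'b \<Rightarrow> 'b) precat"
  let ?I = "{X \<in> fg_mod A. indecomposable A X} :: ('a, 'b) rmodule set"
  interpret D: preadditive_category ?D by (rule preadditive_full_subcat[OF order_refl])
  have rM: "right_module A M" using M by (simp add: fg_mod_def)
  interpret k_algebra K A by fact
  interpret M: right_module A M by fact
  interpret module_over_k_algebra K A M ..
  have rank: "bounded_rank (\<lambda>W. subspace W \<and> W \<subseteq> carrier M)"
    using M alg(2) by (intro bounded_rank_if_finite_length[OF M.M.abelian_group_axioms] finite_length_carrier)
      (auto simp: fg_mod_def)
  obtain r :: "'b set \<Rightarrow> nat" and n where
    "\<And>W. subspace W \<and> W \<subseteq> carrier M \<Longrightarrow> r W \<le> n"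
    and r: "\<And>W W'. subspace W \<and> W \<subseteq> carrier M \<Longrightarrow> subspace W' \<and> W' \<subseteq> carrier M \<Longrightarrow> W \<subset> W' \<Longrightarrow> r W < r W'"
    using bounded_rankE[OF rank] by metis
  have sub: "subspace N \<and> N \<subseteq> carrier M" if "rsubmodule A M N" for N
    using that rsubmodule_iff[OF rM, of N]
    by (auto simp: op_subgroup_def rsubmodule_def scalar_act_def)
  have "(\<lambda>x\<in>N. x) \<in> factoring ?D ?I (M\<lparr>carrier := N\<rparr>) (M\<lparr>carrier := N\<rparr>)"
    if "rsubmodule A M N" "M\<lparr>carrier := N\<rparr> \<in> fg_mod A" for N
    using that
  proof (induction "r N" arbitrary: N rule: less_induct)
    case less
    let ?N = "M\<lparr>carrier := N\<rparr>"
    have rN: "right_module A ?N" using less.prems(2) by (simp add: fg_mod_def)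
    have idN: "(\<lambda>x\<in>N. x) \<in> rmod_hom A ?N ?N" using identity_rmod_hom[OF rN] by simp
    consider "N = {\<zero>\<^bsub>M\<^esub>}" | "indecomposable A ?N" | "N \<noteq> {\<zero>\<^bsub>M\<^esub>}" "\<not> indecomposable A ?N" by blast
    then show ?case
    proof cases
      case 1
      have "(\<lambda>x\<in>N. x) = (\<lambda>x\<in>N. \<zero>\<^bsub>M\<^esub>)" by (intro restrict_ext) (use 1 in simp)
      also have "\<dots> = \<zero>\<^bsub>precat.hom ?D ?N ?N\<^esub>" by simp
      finally show ?thesis by (simp only: factoring.zero)
    next
      case 2
      have "compose N (\<lambda>x\<in>N. x) (\<lambda>x\<in>N. x) \<in> factoring ?D ?I ?N ?N"
        using factoring.through[of ?N ?I "\<lambda>x\<in>N. x" ?D ?N "\<lambda>x\<in>N. x" ?N] 2 less.prems(2) idN by simp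
      moreover have "compose N (\<lambda>x\<in>N. x) (\<lambda>x\<in>N. x) = (\<lambda>x\<in>N. x)" by (auto simp: compose_def fun_eq_iff)
      ultimately show ?thesis by (simp only:)
    next
      case 3
      then obtain L P where LP: "rsubmodule A ?N L" "rsubmodule A ?N P"
        "L <+>\<^bsub>?N\<^esub> P = carrier ?N" "L \<inter> P = {\<zero>\<^bsub>?N\<^esub>}" "L \<noteq> {\<zero>\<^bsub>M\<^esub>}" "P \<noteq> {\<zero>\<^bsub>M\<^esub>}"
        unfolding indecomposable_def by auto
      obtain p q where pq: "p \<in> rmod_hom A ?N (?N\<lparr>carrier := L\<rparr>)" "q \<in> rmod_hom A ?N (?N\<lparr>carrier := P\<rparr>)"
        "\<And>x. x \<in> carrier ?N \<Longrightarrow> x = p x \<oplus>\<^bsub>?N\<^esub> q x" "p ` carrier ?N = L" "q ` carrier ?N = P"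
        using complement_projections[OF rN LP(1-4)] by metis
      \<comment> \<open>The summand \<open>Q\<close> of \<open>N\<close> is a quotient of \<open>N\<close> under its projection \<open>h\<close>, so it is finitely generated.\<close>
      have part: "(\<lambda>x\<in>N. h x) \<in> factoring ?D ?I ?N ?N"
        if Q: "rsubmodule A ?N Q" "Q \<noteq> N" and h: "h \<in> rmod_hom A ?N (M\<lparr>carrier := Q\<rparr>)" "h ` N = Q" for Q h
      proof -
        let ?Q = "M\<lparr>carrier := Q\<rparr>"
        note QM = rsubmodule_of_rsubmodule[OF rM less.prems(1) Q(1)]
        have Qfg: "?Q \<in> fg_mod A"
          using h by (intro fg_mod_image[OF less.prems(2) right_module_rsubmodule[OF rM QM(1)] h(1)]) simp
        have "r Q < r N" using r sub[OF QM(1)] sub[OF less.prems(1)] QM(2) Q(2) by blast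
        then have "(\<lambda>x\<in>Q. x) \<in> factoring ?D ?I ?Q ?Q" using less.hyps QM(1) Qfg by blast
        then have "compose N (\<lambda>x\<in>Q. x) h \<in> factoring ?D ?I ?N ?Q"
          using D.factoring_comp_right[of ?I ?N ?Q ?Q "\<lambda>x\<in>Q. x" h] less.prems(2) Qfg h(1) by auto
        moreover have "(\<lambda>x\<in>Q. x) \<in> rmod_hom A ?Q ?N"
          using QM rsubmodule_iff[OF rM, of Q] by (auto simp: rmod_hom_def)
        ultimately have "compose N (\<lambda>x\<in>Q. x) (compose N (\<lambda>x\<in>Q. x) h) \<in> factoring ?D ?I ?N ?N"
          using D.factoring_comp_left[of ?I ?N ?Q ?N "compose N (\<lambda>x\<in>Q. x) h" "\<lambda>x\<in>Q. x"] less.prems(2) Qfg by auto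
        moreover have "compose N (\<lambda>x\<in>Q. x) (compose N (\<lambda>x\<in>Q. x) h) = (\<lambda>x\<in>N. h x)"
          using h(2) by (auto simp: compose_def fun_eq_iff)
        ultimately show ?thesis by (simp only:)
      qed
      have "L \<noteq> N" "P \<noteq> N"
        using LP(4-6) rsubmodule_of_rsubmodule(2)[OF rM less.prems(1) LP(1)]
          rsubmodule_of_rsubmodule(2)[OF rM less.prems(1) LP(2)] by auto
      then have "(\<lambda>x\<in>N. p x) \<in> factoring ?D ?I ?N ?N" "(\<lambda>x\<in>N. q x) \<in> factoring ?D ?I ?N ?N"
        using part[OF LP(1)] part[OF LP(2)] pq by simp_all
      from factoring.add[OF this] have "(\<lambda>x\<in>N. (\<lambda>x\<in>N. p x) x \<oplus>\<^bsub>M\<^esub> (\<lambda>x\<in>N. q x) x) \<in> factoring ?D ?I ?N ?N"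
        by simp
      also have "(\<lambda>x\<in>N. (\<lambda>x\<in>N. p x) x \<oplus>\<^bsub>M\<^esub> (\<lambda>x\<in>N. q x) x) = (\<lambda>x\<in>N. x)"
        by (intro restrict_ext) (use pq(3) in simp)
      finally show ?thesis .
    qed
  qed
  from this[of "carrier M"] M show ?thesis
    using rsubmodule_iff[OF rM, of "carrier M"] by (auto simp: M.ract_closed)
qed

text \<open>
  Sending an indecomposable object of the skeleton to the isomorphism class of its copies in the type
  over which representation-finiteness is stated is injective, as isomorphic objects of a skeleton
  are equal.
\<close>

lemma finite_indecomposables_of_skeleton:
  fixes A :: "('a, 'p) ring_scheme" and C :: "('a, 'm) rmodule set"
  assumes C: "skeleton_of_fg_mod A C" and fin: "representation_finite A"
  shows "finite {N \<in> C. indecomposable A N}"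
proof -
  let ?Ind = "{M :: ('a, 'a list) rmodule. M \<in> fg_mod A \<and> indecomposable A M}"
  let ?E = "{(M, N). M \<in> ?Ind \<and> N \<in> ?Ind \<and> rmod_isomorphic A M N}"
  have Cfg: "C \<subseteq> fg_mod A" and Ciso: "\<And>M N. M \<in> C \<Longrightarrow> N \<in> C \<Longrightarrow> rmod_isomorphic A M N \<Longrightarrow> M = N"
    using C by (auto simp: skeleton_of_fg_mod_def)
  note rm = right_module_if_fg_mod
  have "\<forall>N\<in>{N \<in> C. indecomposable A N}. \<exists>L. L \<in> ?Ind \<and> rmod_isomorphic A N L"
  proof
    fix N assume N: "N \<in> {N \<in> C. indecomposable A N}"
    then have Nfg: "N \<in> fg_mod A" using Cfg by blast
    obtain L :: "('a, 'a list) rmodule" where L: "L \<in> fg_mod A" "rmod_isomorphic A N L"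
      using Nfg by (rule fg_mod_universe)
    have "indecomposable A L"
      using indecomposable_isomorphic[OF rm[OF Nfg] rm[OF L(1)] L(2)] N by blast
    then show "\<exists>L. L \<in> ?Ind \<and> rmod_isomorphic A N L" using L by blast
  qed
  from bchoice[OF this] obtain h
    where h: "\<And>N. N \<in> {N \<in> C. indecomposable A N} \<Longrightarrow> h N \<in> ?Ind \<and> rmod_isomorphic A N (h N)"
    by blast
  have "inj_on (\<lambda>N. ?E `` {h N}) {N \<in> C. indecomposable A N}"
  proof (rule inj_onI)
    fix N P assume N: "N \<in> {N \<in> C. indecomposable A N}" and P: "P \<in> {N \<in> C. indecomposable A N}"
      and eq: "?E `` {h N} = ?E `` {h P}"
    have hP: "h P \<in> ?Ind" and hN: "h N \<in> ?Ind" using h[OF N] h[OF P] by blast+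
    have "rmod_isomorphic A (h P) (h P)" using hP by (auto intro: rmod_isomorphic_refl rm)
    then have "h P \<in> ?E `` {h P}" using hP by simp
    then have "h P \<in> ?E `` {h N}" unfolding eq .
    then have NP: "rmod_isomorphic A (h N) (h P)" by simp
    have rN: "right_module A N" and rP: "right_module A P" using N P Cfg by (auto intro: rm)
    have "rmod_isomorphic A N (h P)" using rmod_isomorphic_trans[OF rN _ NP] h[OF N] by blast
    moreover have "rmod_isomorphic A (h P) P" using rmod_isomorphic_sym[OF rP] h[OF P] by blast
    ultimately have "rmod_isomorphic A N P" by (rule rmod_isomorphic_trans[OF rN])
    then show "N = P" using Ciso N P by blast
  qed
  moreover have "(\<lambda>N. ?E `` {h N}) ` {N \<in> C. indecomposable A N} \<subseteq> ?Ind // ?E"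
    unfolding quotient_def using h by blast
  moreover have "finite (?Ind // ?E)" using fin unfolding representation_finite_def Let_def .
  ultimately show ?thesis by (rule inj_on_finite)
qed

lemma identity_factors_in_skeleton:
  fixes K :: "('k, 'p) ring_scheme" and A :: "('k, 'a, 'q) module_scheme" and C :: "('a, 'm) rmodule set"
  assumes alg: "k_algebra K A" "finite_dimensional K A"
    and C: "skeleton_of_fg_mod A C" and M: "M \<in> C"
  shows "(\<lambda>x\<in>carrier M. x) \<in> factoring (full_subcat A C) {N \<in> C. indecomposable A N} M M"
proof -
  have Cfg: "C \<subseteq> fg_mod A" using C by (auto simp: skeleton_of_fg_mod_def)
  note rm = right_module_if_fg_mod
  have Mfg: "M \<in> fg_mod A" using M Cfg by blast
  show ?thesis
  proof (rule factoring_isomorphic_objects[OF rm[OF Mfg] _ _ _ identity_factors_through_indecomposables[OF alg Mfg]])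
    fix X :: "('a, 'm) rmodule"
    assume X: "X \<in> {X \<in> fg_mod A. indecomposable A X}"
    obtain N where N: "N \<in> C" "rmod_isomorphic A X N"
      using skeleton_of_fg_mod_dense[OF C, of X] X by blast
    then have "indecomposable A N"
      using indecomposable_isomorphic[OF rm[of X] rm[of N] N(2)] X Cfg by blast
    then show "\<exists>Y\<in>{N \<in> C. indecomposable A N}. rmod_isomorphic A X Y" using N by blast
  qed (use Cfg in \<open>auto intro: rm\<close>)
qed

section \<open>The ring of a category of finitely generated modules\<close>

theorem proposition3p37:
  fixes K :: "('k, 'p) ring_scheme" and A :: "('k, 'a, 'q) module_scheme"
  assumes "k_algebra K A" and "finite_dimensional K A"
  shows
    "(\<forall>C :: ('a, 'm) rmodule set.
        C \<subseteq> fg_mod A \<and>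
        (\<exists>\<X>. finite \<X> \<and> \<X> \<subseteq> C \<and>
           (\<forall>M\<in>C. \<exists>Ms\<in>lists \<X>. rmod_isomorphic A M (direct_sum Ms))) \<longrightarrow>
        (let \<Gamma> = pair_groupoid C; R = cat_ring (full_subcat A C)
         in left_obj_artinian \<Gamma> R \<and> right_obj_artinian \<Gamma> R \<and>
            left_obj_noetherian \<Gamma> R \<and> right_obj_noetherian \<Gamma> R)) \<and>
     (\<forall>C :: ('a, 'n) rmodule set.
        skeleton_of_fg_mod A C \<and> representation_finite A \<longrightarrow>
        (let \<Gamma> = pair_groupoid C; R = cat_ring (full_subcat A C)
         in left_obj_artinian \<Gamma> R \<and> right_obj_artinian \<Gamma> R \<and>
            left_obj_noetherian \<Gamma> R \<and> right_obj_noetherian \<Gamma> R))"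
proof (intro conjI allI impI; elim conjE exE; unfold Let_def)
  fix C :: "('a, 'm) rmodule set" and \<X>
  assume C: "C \<subseteq> fg_mod A" and X: "finite \<X>" "\<X> \<subseteq> C"
    and sums: "\<forall>M\<in>C. \<exists>Ms\<in>lists \<X>. rmod_isomorphic A M (direct_sum Ms)"
  have "(\<lambda>x\<in>carrier M. x) \<in> factoring (full_subcat A C) \<X> M M" if M: "M \<in> C" for M
    using identity_factors_if_direct_sum[OF C X(2) M] sums M by blast
  then show "left_obj_artinian (pair_groupoid C) (cat_ring (full_subcat A C)) \<and>
      right_obj_artinian (pair_groupoid C) (cat_ring (full_subcat A C)) \<and>
      left_obj_noetherian (pair_groupoid C) (cat_ring (full_subcat A C)) \<and>
      right_obj_noetherian (pair_groupoid C) (cat_ring (full_subcat A C))"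
    by (rule chain_conditions_if_identities_factor[OF assms C X])
next
  fix C :: "('a, 'n) rmodule set"
  assume C: "skeleton_of_fg_mod A C" and fin: "representation_finite A"
  have "C \<subseteq> fg_mod A" using C by (auto simp: skeleton_of_fg_mod_def)
  then show "left_obj_artinian (pair_groupoid C) (cat_ring (full_subcat A C)) \<and>
      right_obj_artinian (pair_groupoid C) (cat_ring (full_subcat A C)) \<and>
      left_obj_noetherian (pair_groupoid C) (cat_ring (full_subcat A C)) \<and>
      right_obj_noetherian (pair_groupoid C) (cat_ring (full_subcat A C))"
    using chain_conditions_if_identities_factor[OF assms _ finite_indecomposables_of_skeleton[OF C fin]]
      identity_factors_in_skeleton[OF assms C] by blast
qed

end
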